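(* Let $\ell\geq 2$, $\ell_1=\lfloor\ell/2\rfloor$, $\ell_2=\lceil\ell/2\rceil$. Let $A_1,A_2\in\mathfrak g(\mathfrak o_{\ell_1})$ be regular matrices such that $A_1+A_2$ is regular and $\mathrm{tt}(A_1)=\mathrm{tt}(A_2)=\mathbf{cus}$. For $i\in\{1,2\}$ let $\phi_i$ be an irreducible representation of $S_{A_i}$ whose restriction to $K^{\ell_2}$ contains $\psi_{A_i}$. Then the representation $\mathrm{Res}^{S_{A_1}}_{S_{A_1}\cap S_{A_2}}(\phi_1)\otimes \mathrm{Res}^{S_{A_2}}_{S_{A_1}\cap S_{A_2}}(\phi_2)$ of $S_{A_1}\cap S_{A_2}$ is multiplicity free.
   Context: Let $\mathcal O$ be a complete discrete valuation ring with maximal ideal $\mathfrak p=\pi\mathcal O$ and finite residue field of odd characteristic and cardinality $q$. Let $\mathfrak O=\mathcal O[\vartheta]$ be the unramified quadratic extension, with $\vartheta^2\in\mathcal O^\times$ a non-square, and Galois involution $x\mapsto x^\circ$, $\vartheta^\circ=-\vartheta$. Let $\mathfrak o_k=\mathcal O/\mathfrak p^k$ and $\mathfrak O_k=\mathfrak O/\pi^k\mathfrak O$. $\mathrm G$ denotes either $\mathrm{GL}_2$ (so $\mathrm G(\mathfrak o_k)=\mathrm{GL}_2(\mathfrak o_k)$, $R_k=\mathfrak o_k$, $\epsilon=1$, $\mathfrak g(\mathfrak o_k)=M_2(\mathfrak o_k)$) or $\mathrm{GU}_2$ (so $\mathrm G(\mathfrak o_k)=\{A\in \mathrm{GL}_2(\mathfrak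 O_k): A^\star A=I\}$ where $(a_{ij})^\star=W(a_{ji}^\circ)W^{-1}$, $W=\begin{pmatrix}0&1\\1&0\end{pmatrix}$, $R_k=\mathfrak O_k$, $\epsilon=\vartheta$, $\mathfrak g(\mathfrak o_k)=\{A\in M_2(\mathfrak O_k):A+A^\star=0\}$). Fix an additive character $\psi$ of $R_\ell$ nontrivial on $\pi^{\ell-1}\mathfrak o_\ell$ (for $\mathrm{GU}_2$ with $\psi(x+\vartheta y)=\psi'(x)\psi'(y)$ for such a character $\psi'$ of $\mathfrak o_\ell$). $K^{i}=\{I+\pi^iB\}\cap\mathrm G(\mathfrak o_\ell)$ is the kernel of reduction $\mathrm G(\mathfrak o_\ell)\to\mathrm G(\mathfrak o_i)$. For $A\in\mathfrak g(\mathfrak o_{\ell_1})$, $\psi_A$ is the character of $K^{\ell_2}$ given by $\psi_A(I+\pi^{\ell_2}B)=\psi(\pi^{\ell_2}\mathrm{tr}(\tilde AB))$ for any lift $\tilde A\in\mathfrak g(\mathfrak o_\ell)$ of $A$, and $S_A=\{g\in\mathrm G(\mathfrak o_\ell):\psi_A(g^{-1}xg)=\psi_A(x)\ \forall x\in K^{\ell_2}\}$ is its stabilizer. A matrix in $\mathfrak g(\mathfrak o_{k})$ is regular if its reduction modulo $\pi$ is not scalar. $\mathrm{tt}(A)=\mathbf{cus}$ means $A$ is $\mathrm G(\mathfrak o_{\ell_1})$-conjugate to a matrix in $\mathfrak g(\mathfrak o_{\ell_1})$ of the form $\begin{pmatrix}x&\epsilon\sigma\\ \epsilon&x\end{pmatrix}$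 with $\sigma\in\mathfrak o_{\ell_1}^\times$ a non-square (for $\mathrm{GL}_2$) respectively a square (for $\mathrm{GU}_2$). *)

theory Defs
  imports "Jordan_Normal_Form.Matrix"
begin

definition dvr_with_uniformizer :: "'a::idom \<Rightarrow> bool" where
  "dvr_with_uniformizer \<pi> \<longleftrightarrow> \<pi> \<noteq> 0 \<and> \<not> \<pi> dvd 1 \<and>
     (\<forall>x. x \<noteq> 0 \<longrightarrow> (\<exists>u n. u dvd 1 \<and> x = u * \<pi> ^ n))"

definition pi_adically_complete :: "'a::idom \<Rightarrow> bool" where
  "pi_adically_complete \<pi> \<longleftrightarrow>
     (\<forall>f :: nat \<Rightarrow> 'a. (\<forall>n. \<pi> ^ n dvd f (Suc n) - f n) \<longrightarrow>
        (\<exists>x. \<forall>n. \<pi> ^ n dvd x - f n))"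

definition residue_field :: "'a::idom \<Rightarrow> 'a set set" where
  "residue_field \<pi> = {{y. \<pi> dvd y - x} | x. True}"

definition complete_dvr_finite_odd_residue :: "'a::idom \<Rightarrow> bool" where
  "complete_dvr_finite_odd_residue \<pi> \<longleftrightarrow>
     dvr_with_uniformizer \<pi> \<and> pi_adically_complete \<pi> \<and>
     finite (residue_field \<pi>) \<and> \<not> \<pi> dvd 2"

section \<open>The unramified quadratic extension O[theta], theta^2 = delta\<close>

text \<open>An element (x, y) stands for x + theta*y.  Elements of O are those with y = 0.\<close>

type_synonym 'a qe = "'a \<times> 'a"

definition qadd :: "'a::comm_ring_1 qe \<Rightarrow> 'a qe \<Rightarrow> 'a qe" where
  "qadd p q = (fst p + fst q, snd p + snd q)"

definition qmul :: "'a::comm_ring_1 \<Rightarrow> 'a qe \<Rightarrow> 'a qe \<Rightarrow> 'a qe" where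
  "qmul \<delta> p q = (fst p * fst q + \<delta> * snd p * snd q, fst p * snd q + snd p * fst q)"

definition qconj :: "'a::comm_ring_1 qe \<Rightarrow> 'a qe" where
  "qconj p = (fst p, - snd p)"

definition qsmul :: "'a::comm_ring_1 \<Rightarrow> 'a qe \<Rightarrow> 'a qe" where
  "qsmul c p = (c * fst p, c * snd p)"

definition qcong :: "'a::comm_ring_1 \<Rightarrow> nat \<Rightarrow> 'a qe \<Rightarrow> 'a qe \<Rightarrow> bool" where
  "qcong \<pi> k p q \<longleftrightarrow> \<pi> ^ k dvd fst p - fst q \<and> \<pi> ^ k dvd snd p - snd q"

datatype gtype = GL | GU

definition inR :: "gtype \<Rightarrow> 'a::comm_ring_1 qe \<Rightarrow> bool" where
  "inR G p \<longleftrightarrow> (G = GL \<longrightarrow> snd p = 0)"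

definition eps :: "gtype \<Rightarrow> 'a::comm_ring_1 qe" where
  "eps G = (if G = GL then (1, 0) else (0, 1))"

section \<open>2x2 matrices over O[theta] (lifts of matrices over the finite quotients)\<close>

datatype 'a m2 = M2 (e11: "'a qe") (e12: "'a qe") (e21: "'a qe") (e22: "'a qe")

definition mmul :: "'a::comm_ring_1 \<Rightarrow> 'a m2 \<Rightarrow> 'a m2 \<Rightarrow> 'a m2" where
  "mmul \<delta> A B = M2
     (qadd (qmul \<delta> (e11 A) (e11 B)) (qmul \<delta> (e12 A) (e21 B)))
     (qadd (qmul \<delta> (e11 A) (e12 B)) (qmul \<delta> (e12 A) (e22 B)))
     (qadd (qmul \<delta> (e21 A) (e11 B)) (qmul \<delta> (e22 A) (e21 B)))
     (qadd (qmul \<delta> (e21 A) (e12 B)) (qmul \<delta> (e22 A) (e22 B)))"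

definition madd :: "'a::comm_ring_1 m2 \<Rightarrow> 'a m2 \<Rightarrow> 'a m2" where
  "madd A B = M2 (qadd (e11 A) (e11 B)) (qadd (e12 A) (e12 B))
                 (qadd (e21 A) (e21 B)) (qadd (e22 A) (e22 B))"

definition msmul :: "'a::comm_ring_1 \<Rightarrow> 'a m2 \<Rightarrow> 'a m2" where
  "msmul c A = M2 (qsmul c (e11 A)) (qsmul c (e12 A)) (qsmul c (e21 A)) (qsmul c (e22 A))"

definition mI :: "'a::comm_ring_1 m2" where
  "mI = M2 (1, 0) (0, 0) (0, 0) (1, 0)"

definition mzero :: "'a::comm_ring_1 m2" where
  "mzero = M2 (0, 0) (0, 0) (0, 0) (0, 0)"

definition mtr :: "'a::comm_ring_1 m2 \<Rightarrow> 'a qe" where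
  "mtr A = qadd (e11 A) (e22 A)"

text \<open>(a_ij)^star = W (a_ji conj) W^{-1}, W = antidiagonal(1,1).\<close>
definition mstar :: "'a::comm_ring_1 m2 \<Rightarrow> 'a m2" where
  "mstar A = M2 (qconj (e22 A)) (qconj (e12 A)) (qconj (e21 A)) (qconj (e11 A))"

definition mcong :: "'a::comm_ring_1 \<Rightarrow> nat \<Rightarrow> 'a m2 \<Rightarrow> 'a m2 \<Rightarrow> bool" where
  "mcong \<pi> k A B \<longleftrightarrow> qcong \<pi> k (e11 A) (e11 B) \<and> qcong \<pi> k (e12 A) (e12 B) \<and>
                      qcong \<pi> k (e21 A) (e21 B) \<and> qcong \<pi> k (e22 A) (e22 B)"

definition inM :: "gtype \<Rightarrow> 'a::comm_ring_1 m2 \<Rightarrow> bool" where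
  "inM G A \<longleftrightarrow> inR G (e11 A) \<and> inR G (e12 A) \<and> inR G (e21 A) \<and> inR G (e22 A)"

text \<open>Lifts of the elements of G(o_k): an element of G(o_k) is the class of such a lift
  modulo pi^k (entrywise congruence).\<close>
definition Gset :: "gtype \<Rightarrow> 'a::comm_ring_1 \<Rightarrow> 'a \<Rightarrow> nat \<Rightarrow> 'a m2 set" where
  "Gset G \<delta> \<pi> k = {A. inM G A \<and>
      (\<exists>B. inM G B \<and> mcong \<pi> k (mmul \<delta> A B) mI \<and> mcong \<pi> k (mmul \<delta> B A) mI) \<and>
      (G = GU \<longrightarrow> mcong \<pi> k (mmul \<delta> (mstar A) A) mI)}"

definition minv :: "gtype \<Rightarrow> 'a::comm_ring_1 \<Rightarrow> 'a \<Rightarrow> nat \<Rightarrow> 'a m2 \<Rightarrow> 'a m2" where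
  "minv G \<delta> \<pi> k A = (SOME B. inM G B \<and> mcong \<pi> k (mmul \<delta> A B) mI \<and> mcong \<pi> k (mmul \<delta> B A) mI)"

definition lie :: "gtype \<Rightarrow> 'a::comm_ring_1 \<Rightarrow> nat \<Rightarrow> 'a m2 set" where
  "lie G \<pi> k = {A. inM G A \<and> (G = GU \<longrightarrow> mcong \<pi> k (madd A (mstar A)) mzero)}"

definition Kset :: "gtype \<Rightarrow> 'a::comm_ring_1 \<Rightarrow> 'a \<Rightarrow> nat \<Rightarrow> nat \<Rightarrow> 'a m2 set" where
  "Kset G \<delta> \<pi> l i = {g \<in> Gset G \<delta> \<pi> l.
      \<exists>B. inM G B \<and> mcong \<pi> l g (madd mI (msmul (\<pi> ^ i) B))}"

text \<open>psi(x + theta y) = psi'(x) psi'(y) (for GL the theta-part is 0 and psi'(0) = 1).\<close>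
definition bigpsi :: "('a \<Rightarrow> complex) \<Rightarrow> 'a qe \<Rightarrow> complex" where
  "bigpsi \<psi> p = \<psi> (fst p) * \<psi> (snd p)"

text \<open>psi_A(I + pi^l2 B) = psi(pi^l2 tr(A B)); A is any representative (the value does
  not depend on the lift of A mod pi^l1, nor on the choice of B).\<close>
definition psiA :: "gtype \<Rightarrow> 'a::comm_ring_1 \<Rightarrow> 'a \<Rightarrow> ('a \<Rightarrow> complex) \<Rightarrow> nat \<Rightarrow> 'a m2 \<Rightarrow> 'a m2 \<Rightarrow> complex" where
  "psiA G \<delta> \<pi> \<psi> l A x =
     (let l2 = l - l div 2;
          B = (SOME B. inM G B \<and> mcong \<pi> l x (madd mI (msmul (\<pi> ^ l2) B)))
      in bigpsi \<psi> (qsmul (\<pi> ^ l2) (mtr (mmul \<delta> A B))))"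

definition Stab :: "gtype \<Rightarrow> 'a::comm_ring_1 \<Rightarrow> 'a \<Rightarrow> ('a \<Rightarrow> complex) \<Rightarrow> nat \<Rightarrow> 'a m2 \<Rightarrow> 'a m2 set" where
  "Stab G \<delta> \<pi> \<psi> l A = {g \<in> Gset G \<delta> \<pi> l.
      \<forall>x \<in> Kset G \<delta> \<pi> l (l - l div 2).
        psiA G \<delta> \<pi> \<psi> l A (mmul \<delta> (mmul \<delta> (minv G \<delta> \<pi> l g) x) g) = psiA G \<delta> \<pi> \<psi> l A x}"

definition regular :: "gtype \<Rightarrow> 'a::comm_ring_1 \<Rightarrow> 'a m2 \<Rightarrow> bool" where
  "regular G \<pi> A \<longleftrightarrow> \<not> (\<exists>c. inR G c \<and> mcong \<pi> 1 A (M2 c (0, 0) (0, 0) c))"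

definition tt_cus :: "gtype \<Rightarrow> 'a::comm_ring_1 \<Rightarrow> 'a \<Rightarrow> nat \<Rightarrow> 'a m2 \<Rightarrow> bool" where
  "tt_cus G \<delta> \<pi> k A \<longleftrightarrow>
     (\<exists>g \<in> Gset G \<delta> \<pi> k. \<exists>x \<sigma>.
        inR G x \<and> M2 x (qsmul \<sigma> (eps G)) (eps G) x \<in> lie G \<pi> k \<and>
        (\<exists>z. \<pi> ^ k dvd \<sigma> * z - 1) \<and>
        (G = GL \<longrightarrow> \<not> (\<exists>y. \<pi> ^ k dvd y * y - \<sigma>)) \<and>
        (G = GU \<longrightarrow> (\<exists>y. \<pi> ^ k dvd y * y - \<sigma>)) \<and>
        mcong \<pi> k (mmul \<delta> (mmul \<delta> g A) (minv G \<delta> \<pi> k g)) (M2 x (qsmul \<sigma> (eps G)) (eps G) x))"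

section \<open>Complex representations of subgroups H of G(o_l) (given by their sets of lifts)\<close>

definition is_rep :: "gtype \<Rightarrow> 'a::comm_ring_1 \<Rightarrow> 'a \<Rightarrow> nat \<Rightarrow> 'a m2 set \<Rightarrow> nat \<Rightarrow> ('a m2 \<Rightarrow> complex mat) \<Rightarrow> bool" where
  "is_rep G \<delta> \<pi> l H n \<phi> \<longleftrightarrow>
     (\<forall>g \<in> H. \<phi> g \<in> carrier_mat n n) \<and>
     (\<forall>g \<in> H. \<forall>h \<in> H. mcong \<pi> l g h \<longrightarrow> \<phi> g = \<phi> h) \<and>
     (\<forall>g \<in> H. \<forall>h \<in> H. \<phi> (mmul \<delta> g h) = \<phi> g * \<phi> h) \<and>
     \<phi> mI = 1\<^sub>m n"

definition is_subspace :: "nat \<Rightarrow> complex vec set \<Rightarrow> bool" where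
  "is_subspace n W \<longleftrightarrow> W \<subseteq> carrier_vec n \<and> 0\<^sub>v n \<in> W \<and>
     (\<forall>v \<in> W. \<forall>w \<in> W. v + w \<in> W) \<and> (\<forall>c. \<forall>v \<in> W. c \<cdot>\<^sub>v v \<in> W)"

definition irreducible_rep :: "gtype \<Rightarrow> 'a::comm_ring_1 \<Rightarrow> 'a \<Rightarrow> nat \<Rightarrow> 'a m2 set \<Rightarrow> nat \<Rightarrow> ('a m2 \<Rightarrow> complex mat) \<Rightarrow> bool" where
  "irreducible_rep G \<delta> \<pi> l H n \<phi> \<longleftrightarrow> is_rep G \<delta> \<pi> l H n \<phi> \<and> n > 0 \<and>
     \<not> (\<exists>W. is_subspace n W \<and> W \<noteq> {0\<^sub>v n} \<and> W \<noteq> carrier_vec n \<and>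
            (\<forall>g \<in> H. \<forall>v \<in> W. \<phi> g *\<^sub>v v \<in> W))"

definition contains_char :: "'a m2 set \<Rightarrow> nat \<Rightarrow> ('a m2 \<Rightarrow> complex mat) \<Rightarrow> ('a m2 \<Rightarrow> complex) \<Rightarrow> bool" where
  "contains_char K n \<phi> \<chi> \<longleftrightarrow>
     (\<exists>v \<in> carrier_vec n. v \<noteq> 0\<^sub>v n \<and> (\<forall>x \<in> K. \<phi> x *\<^sub>v v = \<chi> x \<cdot>\<^sub>v v))"

definition tensor_mat :: "nat \<Rightarrow> nat \<Rightarrow> complex mat \<Rightarrow> complex mat \<Rightarrow> complex mat" where
  "tensor_mat n1 n2 A B = mat (n1 * n2) (n1 * n2)
     (\<lambda>(i, j). A $$ (i div n2, j div n2) * B $$ (i mod n2, j mod n2))"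

text \<open>Multiplicity free: every irreducible representation sigma of H occurs with multiplicity
  at most one, i.e. dim Hom_H(sigma, rho) <= 1.\<close>
definition multiplicity_free :: "gtype \<Rightarrow> 'a::comm_ring_1 \<Rightarrow> 'a \<Rightarrow> nat \<Rightarrow> 'a m2 set \<Rightarrow> nat \<Rightarrow> ('a m2 \<Rightarrow> complex mat) \<Rightarrow> bool" where
  "multiplicity_free G \<delta> \<pi> l H n \<rho> \<longleftrightarrow>
     (\<forall>m \<sigma>. irreducible_rep G \<delta> \<pi> l H m \<sigma> \<longrightarrow>
        (\<forall>T1 T2. T1 \<in> carrier_mat n m \<and> T2 \<in> carrier_mat n m \<and>
           (\<forall>h \<in> H. T1 * \<sigma> h = \<rho> h * T1) \<and> (\<forall>h \<in> H. T2 * \<sigma> h = \<rho> h * T2) \<longrightarrow>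
           (\<exists>a b. (a, b) \<noteq> (0, 0) \<and> a \<cdot>\<^sub>m T1 + b \<cdot>\<^sub>m T2 = 0\<^sub>m n m)))"

end

theory Submission
  imports Defs "Jordan_Normal_Form.Spectral_Radius" "HOL-Library.Product_Plus"
begin

text \<open>Write \<open>r = \<lfloor>l/2\<rfloor>\<close>.  Modulo \<open>\<pi>\<^sup>r\<close> and scalars, \<open>A\<^sub>i\<close> is a traceless \<open>N\<^sub>i\<close> with \<open>N\<^sub>i\<^sup>2 = D\<^sub>i\<close> a unit
  that is not a square modulo \<open>\<pi>\<close>, and its stabilizer is \<open>C\<^sub>i K\<^sup>r\<close>, where \<open>C\<^sub>i\<close> consists of the group
  elements of the commutative algebra generated by \<open>N\<^sub>i\<close>.  If \<open>l\<close> is even, both representations are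
  one-dimensional.  If \<open>l\<close> is odd, the truncated exponentials of the elements of the plane \<open>W\<^sub>i\<close>
  orthogonal to \<open>N\<^sub>i\<close> act as a Heisenberg system \<open>E\<^sub>i\<close> on \<open>\<phi>\<^sub>i\<close>.  Because the trace form is anisotropic on
  \<open>W\<^sub>i\<close> modulo \<open>\<pi>\<close>, every element of \<open>C\<^sub>i\<close> acts on \<open>W\<^sub>i\<close> trivially or without fixed points; it follows that
  the commutant of the \<open>E\<^sub>i w\<close> is scalar, so the operators \<open>E\<^sub>1 x \<otimes> E\<^sub>2 y\<close> span all matrices.

  A representation is multiplicity free as soon as its commutant is commutative, so expand an
  element of the commutant of \<open>\<phi>\<^sub>1 \<otimes> \<phi>\<^sub>2\<close> in the operators \<open>E\<^sub>1 x \<otimes> E\<^sub>2 y\<close>.  If \<open>N\<^sub>1\<close> and \<open>N\<^sub>2\<close> do not commute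
  modulo \<open>\<pi>\<^sup>r\<close>, then invariance under \<open>K\<^sup>r\<close> and under suitable elements of \<open>C\<^sub>1\<close> close to the identity
  leaves only coefficients at pairs whose operators commute with each other.  If they commute, then \<open>N\<^sub>2\<close> may be taken to
  be a multiple of \<open>N\<^sub>1\<close>, and the coefficients are invariant under a reflection of the common plane,
  because reflections do not leave the orbits of \<open>C\<^sub>1\<close>; this reflection reverses products
  (Gelfand's trick).\<close>

text \<open>Commutators of elements of \<open>K\<^sup>r\<close> live in the layer
  \<open>\<pi> ^ (2 r)\<close>. For \<open>l = 2 r + 1\<close> this is the last layer on which
  \<psi> is nontrivial, so the operators \<open>E\<close> only see the planes modulo \<pi>, where
  anisotropy is available. The obstacle is that the intersection of the stabilizers may be little
  more than \<open>K\<^sup>r\<close>, so its commutant is examined coefficient by coefficient.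
  Invariance under \<open>K\<^sup>r\<close> confines the coefficients to pairs with
  \<open>N1 x + N2 y = 0\<close> modulo \<pi>, so that \<open>x\<close> determines \<open>y\<close>.
  If the commutator of \<open>N2\<close> and \<open>N1\<close> is \<open>\<pi> ^ j V\<close> with
  \<open>j < r\<close> and \<open>V\<close> nonzero modulo \<pi>, elements of the algebra of
  \<open>N1\<close> at depth \<open>r - j\<close> still stabilize the second matrix, and they force
  \<open>y\<close> to be orthogonal to \<open>V\<close>. The bracket of two such \<open>y\<close>
  commutes modulo \<pi> with \<open>V\<close> and with \<open>N1\<close>; as these anticommute with
  each other, the bracket vanishes. If \<open>N2 = b N1\<close>, then \<open>x\<close> and
  \<open>y\<close> are proportional, so a group element that realises a reflection on one realises
  it on both.\<close>

section \<open>Finitely supported matrices\<close>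

text \<open>Matrices of all sizes live in one ring without unit, where \<open>blk n m\<close> below is the block of the
  \<open>n \<times> m\<close> matrices and \<open>idn n\<close> is a local unit.\<close>
typedef fm = "{f :: nat \<Rightarrow> nat \<Rightarrow> complex. \<exists>N. \<forall>i j. N \<le> i \<or> N \<le> j \<longrightarrow> f i j = 0}"
  morphisms ent Fm by (rule exI[of _ "\<lambda>_ _. 0"]) simp

lemma fm_eqI: "(\<And>i j. ent X i j = ent Y i j) \<Longrightarrow> X = Y"
  by (metis ent_inject ext)

lemma ent_Fm: "(\<And>i j. N \<le> i \<or> N \<le> j \<Longrightarrow> f i j = 0) \<Longrightarrow> ent (Fm f) = f"
  by (rule Fm_inverse) blast

lemma ent_bound: "\<exists>N. \<forall>i j. N \<le> i \<or> N \<le> j \<longrightarrow> ent X i j = 0"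
  using ent[of X] by auto

lemma ent_bound2: "\<exists>N. \<forall>i j. N \<le> i \<or> N \<le> j \<longrightarrow> ent X i j = 0 \<and> ent Y i j = 0"
proof -
  obtain N M where "\<forall>i j. N \<le> i \<or> N \<le> j \<longrightarrow> ent X i j = 0" "\<forall>i j. M \<le> i \<or> M \<le> j \<longrightarrow> ent Y i j = 0"
    using ent_bound by metis
  then show ?thesis by (intro exI[of _ "max N M"]) auto
qed

lemma ent_bound3:
  "\<exists>N. \<forall>i j. N \<le> i \<or> N \<le> j \<longrightarrow> ent X i j = 0 \<and> ent Y i j = 0 \<and> ent Z i j = 0"
proof -
  obtain N M where "\<forall>i j. N \<le> i \<or> N \<le> j \<longrightarrow> ent X i j = 0 \<and> ent Y i j = 0"
    "\<forall>i j. M \<le> i \<or> M \<le> j \<longrightarrow> ent Z i j = 0"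
    using ent_bound ent_bound2 by metis
  then show ?thesis by (intro exI[of _ "max N M"]) auto
qed

instantiation fm :: ring
begin

definition "0 = Fm (\<lambda>_ _. 0)"
definition "X + Y = Fm (\<lambda>i j. ent X i j + ent Y i j)"
definition "- X = Fm (\<lambda>i j. - ent X i j)"
definition "(X :: fm) - Y = Fm (\<lambda>i j. ent X i j - ent Y i j)"
text \<open>The sum runs over the finite support of row \<open>i\<close> of \<open>X\<close>, so the
  product needs no dimension.\<close>

definition "X * Y = Fm (\<lambda>i j. \<Sum>k | ent X i k \<noteq> 0. ent X i k * ent Y k j)"

lemma ent_0: "ent 0 i j = 0"
  unfolding zero_fm_def by (subst ent_Fm) auto

lemma ent_plus: "ent (X + Y) i j = ent X i j + ent Y i j"
proof -
  obtain N where "\<forall>i j. N \<le> i \<or> N \<le> j \<longrightarrow> ent X i j = 0 \<and> ent Y i j = 0"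
    using ent_bound2 by blast
  then show ?thesis unfolding plus_fm_def by (subst ent_Fm[of N]) auto
qed

lemma ent_uminus: "ent (- X) i j = - ent X i j"
proof -
  obtain N where "\<forall>i j. N \<le> i \<or> N \<le> j \<longrightarrow> ent X i j = 0"
    using ent_bound by blast
  then show ?thesis unfolding uminus_fm_def by (subst ent_Fm[of N]) auto
qed

lemma ent_minus: "ent (X - Y) i j = ent X i j - ent Y i j"
proof -
  obtain N where "\<forall>i j. N \<le> i \<or> N \<le> j \<longrightarrow> ent X i j = 0 \<and> ent Y i j = 0"
    using ent_bound2 by blast
  then show ?thesis unfolding minus_fm_def by (subst ent_Fm[of N]) auto
qed

lemma ent_times_row:
  assumes "\<And>k. N \<le> k \<Longrightarrow> ent X i k = 0"
  shows "ent (X * Y) i j = (\<Sum>k<N. ent X i k * ent Y k j)"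
proof -
  obtain M where M: "\<forall>i j. M \<le> i \<or> M \<le> j \<longrightarrow> ent X i j = 0 \<and> ent Y i j = 0"
    using ent_bound2 by blast
  have "ent (X * Y) i j = (\<Sum>k | ent X i k \<noteq> 0. ent X i k * ent Y k j)"
    unfolding times_fm_def using M by (subst ent_Fm[of M]) (auto intro: sum.neutral)
  also have "\<dots> = (\<Sum>k<N. ent X i k * ent Y k j)"
    using assms by (intro sum.mono_neutral_left) (auto simp: not_le[symmetric])
  finally show ?thesis .
qed

lemma ent_times:
  assumes "\<forall>i j. N \<le> i \<or> N \<le> j \<longrightarrow> ent X i j = 0"
  shows "ent (X * Y) i j = (\<Sum>k<N. ent X i k * ent Y k j)"
  using assms by (intro ent_times_row) auto

instance
proof
  fix X Y Z :: fm
  show "X * Y * Z = X * (Y * Z)"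
  proof (rule fm_eqI)
    fix i j
    obtain N where N: "\<forall>i j. N \<le> i \<or> N \<le> j \<longrightarrow> ent X i j = 0 \<and> ent Y i j = 0 \<and> ent Z i j = 0"
      using ent_bound3 by blast
    have XY: "ent (X * Y) i j = (\<Sum>k<N. ent X i k * ent Y k j)"
      and YZ: "ent (Y * Z) i j = (\<Sum>k<N. ent Y i k * ent Z k j)" for i j
      using N by (auto intro!: ent_times)
    have "ent (X * Y * Z) i j = (\<Sum>k<N. ent (X * Y) i k * ent Z k j)"
      using N by (intro ent_times_row) (auto simp: XY)
    also have "\<dots> = (\<Sum>k<N. \<Sum>m<N. ent X i m * ent Y m k * ent Z k j)"
      by (simp add: XY sum_distrib_right)
    also have "\<dots> = (\<Sum>m<N. \<Sum>k<N. ent X i m * ent Y m k * ent Z k j)"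
      by (rule sum.swap)
    also have "\<dots> = (\<Sum>m<N. ent X i m * ent (Y * Z) m j)"
      by (simp add: YZ sum_distrib_left mult.assoc)
    also have "\<dots> = ent (X * (Y * Z)) i j"
      using N by (intro ent_times[symmetric]) auto
    finally show "ent (X * Y * Z) i j = ent (X * (Y * Z)) i j" .
  qed
  show "(X + Y) * Z = X * Z + Y * Z"
  proof (rule fm_eqI)
    fix i j
    obtain N where N: "\<forall>i j. N \<le> i \<or> N \<le> j \<longrightarrow> ent X i j = 0 \<and> ent Y i j = 0"
      using ent_bound2 by blast
    then have N': "\<forall>i j. N \<le> i \<or> N \<le> j \<longrightarrow> ent (X + Y) i j = 0"
      by (auto simp: ent_plus)
    have "ent ((X + Y) * Z) i j = (\<Sum>k<N. ent (X + Y) i k * ent Z k j)"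
      "ent (X * Z) i j = (\<Sum>k<N. ent X i k * ent Z k j)"
      "ent (Y * Z) i j = (\<Sum>k<N. ent Y i k * ent Z k j)"
      using ent_times[OF N'] N by (auto intro!: ent_times)
    then show "ent ((X + Y) * Z) i j = ent (X * Z + Y * Z) i j"
      by (simp add: ent_plus distrib_right sum.distrib)
  qed
  show "X * (Y + Z) = X * Y + X * Z"
  proof (rule fm_eqI)
    fix i j
    obtain N where N: "\<forall>i j. N \<le> i \<or> N \<le> j \<longrightarrow> ent X i j = 0"
      using ent_bound by blast
    show "ent (X * (Y + Z)) i j = ent (X * Y + X * Z) i j"
      by (simp add: ent_plus distrib_left sum.distrib ent_times[OF N])
  qed
qed (auto intro!: fm_eqI simp: ent_plus ent_0 ent_uminus ent_minus)

end

lemma ent_sum: "ent (sum f S) i j = (\<Sum>x\<in>S. ent (f x) i j)"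
  by (induction S rule: infinite_finite_induct) (auto simp: ent_0 ent_plus)

definition sm :: "complex \<Rightarrow> fm \<Rightarrow> fm" where
  "sm c X = Fm (\<lambda>i j. c * ent X i j)"

lemma ent_sm: "ent (sm c X) i j = c * ent X i j"
proof -
  obtain N where "\<forall>i j. N \<le> i \<or> N \<le> j \<longrightarrow> ent X i j = 0"
    using ent_bound by blast
  then show ?thesis unfolding sm_def by (subst ent_Fm[of N]) auto
qed

lemma sm_sm [simp]: "sm a (sm b X) = sm (a * b) X"
  and sm_1 [simp]: "sm 1 X = X"
  and sm_0 [simp]: "sm 0 X = 0"
  by (auto intro!: fm_eqI simp: ent_sm ent_0)

lemma sm_minus: "sm (- a) X = - sm a X"
  by (auto intro!: fm_eqI simp: ent_sm ent_uminus)

lemma sum_sm: "sm (sum f S) X = (\<Sum>x\<in>S. sm (f x) X)"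
  by (rule fm_eqI) (simp add: ent_sm ent_sum sum_distrib_right)

lemma sm_mult_left [simp]: "sm a X * Y = sm a (X * Y)"
proof (rule fm_eqI)
  fix i j
  obtain N where N: "\<forall>i j. N \<le> i \<or> N \<le> j \<longrightarrow> ent X i j = 0"
    using ent_bound by blast
  then have "\<forall>i j. N \<le> i \<or> N \<le> j \<longrightarrow> ent (sm a X) i j = 0" by (simp add: ent_sm)
  then show "ent (sm a X * Y) i j = ent (sm a (X * Y)) i j"
    by (simp add: ent_times[OF N] ent_times ent_sm sum_distrib_left mult.assoc)
qed

lemma sm_mult_right [simp]: "X * sm a Y = sm a (X * Y)"
proof (rule fm_eqI)
  fix i j
  obtain N where N: "\<forall>i j. N \<le> i \<or> N \<le> j \<longrightarrow> ent X i j = 0"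
    using ent_bound by blast
  show "ent (X * sm a Y) i j = ent (sm a (X * Y)) i j"
    by (simp add: ent_times[OF N] ent_sm sum_distrib_left mult.left_commute)
qed

lemma sm_eq_0: "sm a X = 0 \<longleftrightarrow> a = 0 \<or> X = 0"
  by (metis ent_0 ent_sm fm_eqI mult_eq_0_iff)

lemma sm_cancel: "a \<noteq> 0 \<Longrightarrow> sm a X = sm a Y \<longleftrightarrow> X = Y"
  by (metis sm_sm sm_1 left_inverse)

section \<open>Embedding of complex matrices of a fixed size\<close>

definition em :: "complex mat \<Rightarrow> fm" where
  "em A = Fm (\<lambda>i j. if i < dim_row A \<and> j < dim_col A then A $$ (i, j) else 0)"

lemma ent_em: "ent (em A) i j = (if i < dim_row A \<and> j < dim_col A then A $$ (i, j) else 0)"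
  unfolding em_def by (subst ent_Fm[of "max (dim_row A) (dim_col A)"]) auto

lemma em_mult:
  assumes "A \<in> carrier_mat n m" "B \<in> carrier_mat m k"
  shows "em (A * B) = em A * em B"
proof (rule fm_eqI)
  fix i j
  have "ent (em A * em B) i j = (\<Sum>x<m. ent (em A) i x * ent (em B) x j)"
    using assms by (intro ent_times_row) (auto simp: ent_em)
  also have "\<dots> = ent (em (A * B)) i j"
    using assms by (auto simp: ent_em scalar_prod_def lessThan_atLeast0 intro!: sum.neutral)
  finally show "ent (em (A * B)) i j = ent (em A * em B) i j" ..
qed

lemma em_inj:
  assumes "A \<in> carrier_mat n m" "B \<in> carrier_mat n m" "em A = em B"
  shows "A = B"
proof (rule eq_matI)
  show "A $$ (i, j) = B $$ (i, j)" if "i < dim_row B" "j < dim_col B" for i j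
    using assms that ent_em[of A i j] ent_em[of B i j] by auto
qed (use assms in auto)

definition idn :: "nat \<Rightarrow> fm" where
  "idn n = em (1\<^sub>m n)"

lemma ent_idn: "ent (idn n) i j = (if i < n \<and> i = j then 1 else 0)"
  by (auto simp: idn_def ent_em)

definition blk :: "nat \<Rightarrow> nat \<Rightarrow> fm set" where
  "blk n m = {X. idn n * X = X \<and> X * idn m = X}"

lemma ent_idn_mult: "ent (idn n * X) i j = (if i < n then ent X i j else 0)"
proof -
  have "ent (idn n * X) i j = (\<Sum>k<n. ent (idn n) i k * ent X k j)"
    by (intro ent_times) (auto simp: ent_idn)
  also have "\<dots> = (\<Sum>k<n. if k = i then ent X k j else 0)"
    by (rule sum.cong) (auto simp: ent_idn)
  finally show ?thesis by simp
qed

lemma ent_mult_idn: "ent (X * idn n) i j = (if j < n then ent X i j else 0)"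
proof -
  obtain N where N: "\<forall>i j. N \<le> i \<or> N \<le> j \<longrightarrow> ent X i j = 0"
    using ent_bound by blast
  have "ent (X * idn n) i j = (\<Sum>k<N. ent X i k * ent (idn n) k j)"
    by (rule ent_times[OF N])
  also have "\<dots> = (\<Sum>k<N. if k = j then (if j < n then ent X i j else 0) else 0)"
    by (rule sum.cong) (auto simp: ent_idn)
  also have "\<dots> = (if j < n then ent X i j else 0)"
    using N by (auto simp: not_less)
  finally show ?thesis .
qed

lemma blk_iff: "X \<in> blk n m \<longleftrightarrow> (\<forall>i j. n \<le> i \<or> m \<le> j \<longrightarrow> ent X i j = 0)"
proof
  assume X: "X \<in> blk n m"
  then have "ent X i j = ent (idn n * X) i j" "ent X i j = ent (X * idn m) i j" for i j
    by (auto simp: blk_def)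
  then show "\<forall>i j. n \<le> i \<or> m \<le> j \<longrightarrow> ent X i j = 0"
    unfolding ent_idn_mult ent_mult_idn by (metis not_less)
next
  assume "\<forall>i j. n \<le> i \<or> m \<le> j \<longrightarrow> ent X i j = 0"
  then show "X \<in> blk n m"
    by (auto simp: blk_def ent_idn_mult ent_mult_idn not_less intro!: fm_eqI)
qed

lemma blk_left: "X \<in> blk n m \<Longrightarrow> idn n * X = X"
  and blk_right: "X \<in> blk n m \<Longrightarrow> X * idn m = X"
  by (auto simp: blk_def)

lemma blk_idn [simp]: "idn n \<in> blk n n"
  by (auto simp: blk_iff ent_idn)

lemma blk_mult: "X \<in> blk n m \<Longrightarrow> Y \<in> blk m k \<Longrightarrow> X * Y \<in> blk n k"
  unfolding blk_def by (metis (mono_tags, lifting) mem_Collect_eq mult.assoc)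

lemma blk_sm: "X \<in> blk n m \<Longrightarrow> sm c X \<in> blk n m"
  by (auto simp: blk_iff ent_sm)

lemma blk_sum: "(\<And>x. x \<in> S \<Longrightarrow> f x \<in> blk n m) \<Longrightarrow> sum f S \<in> blk n m"
  by (auto simp: blk_iff ent_sum)

lemma em_blk: "A \<in> carrier_mat n m \<Longrightarrow> em A \<in> blk n m"
  by (auto simp: blk_iff ent_em)

lemma blk_em: "X \<in> blk n m \<Longrightarrow> \<exists>A \<in> carrier_mat n m. X = em A"
  by (rule bexI[of _ "mat n m (\<lambda>(i, j). ent X i j)"]) (auto simp: blk_iff ent_em intro!: fm_eqI)

lemma idn_neq_0: "0 < n \<Longrightarrow> idn n \<noteq> 0"
  by (metis ent_0 ent_idn zero_neq_one)

definition ftr :: "nat \<Rightarrow> fm \<Rightarrow> complex" where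
  "ftr n X = (\<Sum>i<n. ent X i i)"

lemma ent_blk_mult: "X \<in> blk n m \<Longrightarrow> ent (X * Y) i j = (\<Sum>k<m. ent X i k * ent Y k j)"
  by (intro ent_times_row) (auto simp: blk_iff)

lemma ftr_comm:
  assumes "X \<in> blk n m" "Y \<in> blk m n"
  shows "ftr n (X * Y) = ftr m (Y * X)"
  unfolding ftr_def ent_blk_mult[OF assms(1)] ent_blk_mult[OF assms(2)]
  by (subst sum.swap) (simp add: mult.commute)

lemma ftr_sm: "ftr n (sm c X) = c * ftr n X"
  and ftr_sum: "ftr n (sum f S) = (\<Sum>x\<in>S. ftr n (f x))"
  and ftr_idn: "ftr n (idn n) = of_nat n"
proof -
  show "ftr n (sum f S) = (\<Sum>x\<in>S. ftr n (f x))"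
    unfolding ftr_def ent_sum by (rule sum.swap)
qed (simp_all add: ftr_def ent_sm ent_idn sum_distrib_left)

definition eu :: "nat \<Rightarrow> nat \<Rightarrow> fm" where
  "eu a b = Fm (\<lambda>i j. if i = a \<and> j = b then 1 else 0)"

lemma ent_eu: "ent (eu a b) i j = (if i = a \<and> j = b then 1 else 0)"
  unfolding eu_def by (subst ent_Fm[of "Suc (max a b)"]) auto

lemma eu_blk: "a < n \<Longrightarrow> b < m \<Longrightarrow> eu a b \<in> blk n m"
  by (auto simp: blk_iff ent_eu)

lemma ent_eu_mult:
  "ent (eu b c * X) i j = (if i = b then ent X c j else 0)"
proof -
  have "ent (eu b c * X) i j = (\<Sum>k<Suc c. ent (eu b c) i k * ent X k j)"
    by (rule ent_times_row) (auto simp: ent_eu)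
  also have "\<dots> = (\<Sum>k<Suc c. if k = c then (if i = b then ent X c j else 0) else 0)"
    by (rule sum.cong) (auto simp: ent_eu)
  finally show ?thesis by simp
qed

lemma em_add: "A \<in> carrier_mat n m \<Longrightarrow> B \<in> carrier_mat n m \<Longrightarrow> em (A + B) = em A + em B"
  and em_smult: "em (c \<cdot>\<^sub>m A) = sm c (em A)"
  and em_zero: "em (0\<^sub>m n m) = 0"
  by (auto intro!: fm_eqI simp: ent_em ent_plus ent_sm ent_0)

section \<open>Representations up to congruence\<close>

definition transversal :: "('g \<Rightarrow> 'g \<Rightarrow> bool) \<Rightarrow> 'g set \<Rightarrow> 'g set \<Rightarrow> bool" where
  "transversal R H Q \<longleftrightarrow> finite Q \<and> Q \<subseteq> H \<and> (\<forall>h\<in>H. \<exists>q\<in>Q. R q h) \<and> (\<forall>q\<in>Q. \<forall>q'\<in>Q. R q q' \<longrightarrow> q = q')"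

text \<open>The finite set \<open>F\<close> need not lie in \<open>H\<close>. The choice
  \<open>c\<close> depends only on the class of its argument, so its values on \<open>H\<close> are
  among its values on \<open>F\<close>.\<close>

lemma transversal_exists:
  assumes R: "equivp R" and F: "finite F" "\<And>h. h \<in> H \<Longrightarrow> \<exists>x\<in>F. R x h"
  shows "\<exists>Q. transversal R H Q"
proof -
  define c where "c h = (SOME k. k \<in> H \<and> R h k)" for h
  have cH: "c h \<in> H \<and> R h (c h)" if "h \<in> H" for h
    unfolding c_def using that equivp_reflp[OF R] by (intro someI[of "\<lambda>k. k \<in> H \<and> R h k" h]) auto
  have ceq: "c h = c h'" if "R h h'" for h h'
    unfolding c_def using that R unfolding equivp_def by metis
  have "c ` H \<subseteq> c ` F"
  proof
    fix y assume "y \<in> c ` H"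
    then obtain h where h: "h \<in> H" "y = c h" by blast
    then obtain x where "x \<in> F" "R x h" using F(2) by blast
    then show "y \<in> c ` F" using h ceq[of x h] image_eqI[of y c x F] by simp
  qed
  then have "finite (c ` H)" using F(1) finite_subset by blast
  moreover have "c h = c h'" if "h \<in> H" "h' \<in> H" "R (c h) (c h')" for h h'
    using that cH ceq by metis
  ultimately have "transversal R H (c ` H)"
    unfolding transversal_def using cH equivp_symp[OF R] by blast
  then show ?thesis by blast
qed

text \<open>A map of \<open>H\<close> that is injective on classes permutes the finitely many
  classes, whatever representatives \<open>Q\<close> holds. Translations, group actions and
  reflections are all reindexed through this.\<close>

lemma transversal_sum:
  assumes R: "equivp R" and Q: "transversal R H Q"
    and m: "\<And>h. h \<in> H \<Longrightarrow> m h \<in> H" "\<And>h h'. h \<in> H \<Longrightarrow> h' \<in> H \<Longrightarrow> R (m h) (m h') \<Longrightarrow> R h h'"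
    and f: "\<And>h h'. h \<in> H \<Longrightarrow> h' \<in> H \<Longrightarrow> R h h' \<Longrightarrow> f h = f h'"
  shows "(\<Sum>q\<in>Q. f (m q)) = (\<Sum>q\<in>Q. f q)"
proof -
  have Q': "finite Q" "Q \<subseteq> H" "\<And>h. h \<in> H \<Longrightarrow> \<exists>q\<in>Q. R q h"
    "\<And>q q'. q \<in> Q \<Longrightarrow> q' \<in> Q \<Longrightarrow> R q q' \<Longrightarrow> q = q'"
    using Q by (auto simp: transversal_def)
  have "\<forall>q\<in>Q. \<exists>q'\<in>Q. R q' (m q)" using Q' m by blast
  then obtain p where p: "\<And>q. q \<in> Q \<Longrightarrow> p q \<in> Q \<and> R (p q) (m q)" by metis
  have "inj_on p Q"
  proof (rule inj_onI)
    fix q q' assume q: "q \<in> Q" "q' \<in> Q" "p q = p q'"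
    then have "R (m q) (m q')" using p equivp_symp[OF R] equivp_transp[OF R] by metis
    then show "q = q'" using q m Q' by blast
  qed
  moreover have "p ` Q \<subseteq> Q" using p by blast
  ultimately have "bij_betw p Q Q"
    using Q'(1) by (simp add: bij_betw_def endo_inj_surj)
  then have "(\<Sum>q\<in>Q. f (p q)) = (\<Sum>q\<in>Q. f q)" by (rule sum.reindex_bij_betw)
  moreover have "f (m q) = f (p q)" if "q \<in> Q" for q
    using that p[OF that] Q'(2) m f[of "p q" "m q"] by (metis subsetD)
  ultimately show ?thesis by simp
qed

definition schur :: "'g set \<Rightarrow> nat \<Rightarrow> ('g \<Rightarrow> fm) \<Rightarrow> bool" where
  "schur H n \<Phi> \<longleftrightarrow> (\<forall>X\<in>blk n n. (\<forall>g\<in>H. X * \<Phi> g = \<Phi> g * X) \<longrightarrow> (\<exists>c. X = sm c (idn n)))"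

lemma mat_scalar_of_action:
  fixes A :: "complex mat"
  assumes A: "A \<in> carrier_mat n n" and act: "\<And>v. v \<in> carrier_vec n \<Longrightarrow> A *\<^sub>v v = k \<cdot>\<^sub>v v"
  shows "A = k \<cdot>\<^sub>m 1\<^sub>m n"
proof (rule eq_matI)
  fix i j assume "i < dim_row (k \<cdot>\<^sub>m 1\<^sub>m n)" "j < dim_col (k \<cdot>\<^sub>m 1\<^sub>m n)"
  then have ij: "i < n" "j < n" by auto
  have "(A *\<^sub>v unit_vec n j) $ i = (k \<cdot>\<^sub>v unit_vec n j) $ i" using act by simp
  moreover have "(A *\<^sub>v unit_vec n j) $ i = A $$ (i, j)"
    using ij A by (subst index_mult_mat_vec) (auto simp: scalar_prod_right_unit)
  ultimately show "A $$ (i, j) = (k \<cdot>\<^sub>m 1\<^sub>m n) $$ (i, j)" using ij by simp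
qed (use A in auto)

text \<open>Over the complex numbers a matrix commuting with the representation has an eigenvalue,
  and its eigenspace is a nonzero invariant subspace, hence everything.\<close>

lemma irreducible_rep_schur:
  assumes "irreducible_rep G \<delta> \<pi> l H n \<phi>"
  shows "schur H n (\<lambda>g. em (\<phi> g))"
  unfolding schur_def
proof (intro ballI impI)
  fix X assume X: "X \<in> blk n n" and comm: "\<forall>g\<in>H. X * em (\<phi> g) = em (\<phi> g) * X"
  have \<phi>: "\<And>g. g \<in> H \<Longrightarrow> \<phi> g \<in> carrier_mat n n" and n: "n > 0"
    and irr: "\<And>W. is_subspace n W \<Longrightarrow> W \<noteq> {0\<^sub>v n} \<Longrightarrow> (\<And>g v. g \<in> H \<Longrightarrow> v \<in> W \<Longrightarrow> \<phi> g *\<^sub>v v \<in> W)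
        \<Longrightarrow> W = carrier_vec n"
    using assms unfolding irreducible_rep_def is_rep_def by auto
  obtain A where A: "A \<in> carrier_mat n n" "X = em A" using blk_em[OF X] by blast
  have AB: "A * \<phi> g = \<phi> g * A" if "g \<in> H" for g
    using that comm A \<phi>[OF that] em_inj[of "A * \<phi> g" n n "\<phi> g * A"] by (simp add: em_mult)
  obtain k where "k \<in> spectrum A" using spectrum_non_empty[OF A(1) n] by blast
  then obtain v where v: "v \<in> carrier_vec n" "v \<noteq> 0\<^sub>v n" "A *\<^sub>v v = k \<cdot>\<^sub>v v"
    using A(1) by (auto simp: spectrum_def eigenvalue_def eigenvector_def)
  define W where "W = {v \<in> carrier_vec n. A *\<^sub>v v = k \<cdot>\<^sub>v v}"
  have "is_subspace n W"
    unfolding is_subspace_def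
  proof (intro conjI ballI allI)
    show "v + w \<in> W" if "v \<in> W" "w \<in> W" for v w
      using that A(1) by (simp add: W_def mult_add_distrib_mat_vec[of A n n] smult_add_distrib_vec[of v n])
    show "c \<cdot>\<^sub>v v \<in> W" if "v \<in> W" for c v
      using that A(1) by (simp add: W_def mult_mat_vec[of A n n] smult_smult_assoc mult.commute)
    show "0\<^sub>v n \<in> W"
      using A(1) by (auto simp: W_def)
  qed (simp add: W_def)
  moreover have "W \<noteq> {0\<^sub>v n}" using v by (auto simp: W_def)
  moreover have "\<phi> g *\<^sub>v v \<in> W" if "g \<in> H" "v \<in> W" for g v
  proof -
    have v: "v \<in> carrier_vec n" "A *\<^sub>v v = k \<cdot>\<^sub>v v" using that by (auto simp: W_def)
    have "A *\<^sub>v (\<phi> g *\<^sub>v v) = (A * \<phi> g) *\<^sub>v v"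
      by (rule assoc_mult_mat_vec[OF A(1) \<phi>[OF that(1)] v(1), symmetric])
    also have "\<dots> = \<phi> g *\<^sub>v (A *\<^sub>v v)"
      unfolding AB[OF that(1)] by (rule assoc_mult_mat_vec[OF \<phi>[OF that(1)] A(1) v(1)])
    also have "\<dots> = k \<cdot>\<^sub>v (\<phi> g *\<^sub>v v)" unfolding v(2) by (rule mult_mat_vec[OF \<phi>[OF that(1)] v(1)])
    finally show ?thesis using mult_mat_vec_carrier[OF \<phi>[OF that(1)] v(1)] by (simp add: W_def)
  qed
  ultimately have W: "W = carrier_vec n" by (rule irr)
  have "A = k \<cdot>\<^sub>m 1\<^sub>m n"
    using W by (intro mat_scalar_of_action A) (auto simp: W_def)
  then show "\<exists>c. X = sm c (idn n)" using A(2) by (auto simp: em_smult idn_def)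
qed

lemma blk_inverse_unique:
  assumes "B' \<in> blk n n" "B \<in> blk n n" "A * B = idn n" "B' * A = idn n"
  shows "B' = B"
proof -
  have "B' = B' * (A * B)" using assms by (simp add: blk_right)
  also have "\<dots> = B' * A * B" by (simp add: mult.assoc)
  also have "\<dots> = B" using assms by (simp add: blk_left)
  finally show ?thesis .
qed

text \<open>The elements are lifts of the elements of a finite group, and \<open>R\<close> is the congruence that
  identifies two lifts of the same element.\<close>
locale pgroup =
  fixes H :: "'g set" and mul :: "'g \<Rightarrow> 'g \<Rightarrow> 'g" (infixl "\<star>" 70) and one :: 'g and R :: "'g \<Rightarrow> 'g \<Rightarrow> bool"
  assumes R: "equivp R" and finite_index: "\<exists>Q. transversal R H Q"
    and one: "one \<in> H" and mul_one: "\<And>a. one \<star> a = a" "\<And>a. a \<star> one = a"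
    and closed: "\<And>a b. a \<in> H \<Longrightarrow> b \<in> H \<Longrightarrow> a \<star> b \<in> H"
    and assoc: "\<And>a b c. a \<star> b \<star> c = a \<star> (b \<star> c)"
    and cong: "\<And>a b c d. R a b \<Longrightarrow> R c d \<Longrightarrow> R (a \<star> c) (b \<star> d)"
    and inverse: "\<And>a. a \<in> H \<Longrightarrow> \<exists>b\<in>H. R (a \<star> b) one \<and> R (b \<star> a) one"
begin

definition prep :: "nat \<Rightarrow> ('g \<Rightarrow> fm) \<Rightarrow> bool" where
  "prep n \<Phi> \<longleftrightarrow> (\<forall>g\<in>H. \<Phi> g \<in> blk n n) \<and> (\<forall>g\<in>H. \<forall>h\<in>H. R g h \<longrightarrow> \<Phi> g = \<Phi> h) \<and>
     (\<forall>g\<in>H. \<forall>h\<in>H. \<Phi> (g \<star> h) = \<Phi> g * \<Phi> h) \<and> \<Phi> one = idn n"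

lemma prepD:
  assumes "prep n \<Phi>"
  shows "g \<in> H \<Longrightarrow> \<Phi> g \<in> blk n n" "g \<in> H \<Longrightarrow> h \<in> H \<Longrightarrow> R g h \<Longrightarrow> \<Phi> g = \<Phi> h"
    "g \<in> H \<Longrightarrow> h \<in> H \<Longrightarrow> \<Phi> (g \<star> h) = \<Phi> g * \<Phi> h" "\<Phi> one = idn n"
  using assms by (auto simp: prep_def)

definition iv :: "'g \<Rightarrow> 'g" where
  "iv a = (SOME b. b \<in> H \<and> R (a \<star> b) one \<and> R (b \<star> a) one)"

lemma iv: "a \<in> H \<Longrightarrow> iv a \<in> H \<and> R (a \<star> iv a) one \<and> R (iv a \<star> a) one"
  unfolding iv_def by (rule someI_ex) (use inverse in blast)

lemma prep_iv:
  assumes "prep n \<Phi>" "g \<in> H"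
  shows "\<Phi> g * \<Phi> (iv g) = idn n" "\<Phi> (iv g) * \<Phi> g = idn n"
  using prepD(4)[OF assms(1)] prepD(2,3)[OF assms(1)] iv[OF assms(2)] assms(2) one closed
  by (metis (no_types, lifting))+

lemma prep_iv_blk: "prep n \<Phi> \<Longrightarrow> g \<in> H \<Longrightarrow> \<Phi> (iv g) \<in> blk n n"
  using iv prepD(1) by blast

text \<open>Averaging yields an intertwiner \<open>U\<close> from \<rho> back to \<sigma> for which
  \<open>U * T1\<close> is a nonzero scalar. \<open>T1 * U\<close> and \<open>T2 * U\<close> lie in
  the commutant of \<rho>; multiplying their commutation relation by \<open>T1\<close> makes
  \<open>T1\<close> and \<open>T2\<close> proportional.\<close>

lemma multiplicity_le_one:
  assumes \<sigma>: "prep m \<sigma>" "schur H m \<sigma>" "m > 0" and \<rho>: "prep n \<rho>"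
    and comm: "\<And>X Y. X \<in> blk n n \<Longrightarrow> Y \<in> blk n n \<Longrightarrow> (\<And>h. h \<in> H \<Longrightarrow> X * \<rho> h = \<rho> h * X) \<Longrightarrow>
        (\<And>h. h \<in> H \<Longrightarrow> Y * \<rho> h = \<rho> h * Y) \<Longrightarrow> X * Y = Y * X"
    and T: "T1 \<in> blk n m" "T2 \<in> blk n m" "\<And>h. h \<in> H \<Longrightarrow> T1 * \<sigma> h = \<rho> h * T1"
      "\<And>h. h \<in> H \<Longrightarrow> T2 * \<sigma> h = \<rho> h * T2"
  shows "\<exists>a b. (a, b) \<noteq> (0, 0) \<and> sm a T1 + sm b T2 = 0"
proof (cases "T1 = 0")
  case True
  then show ?thesis by (intro exI[of _ 1] exI[of _ 0]) simp
next
  case False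
  then obtain i j where ij: "ent T1 i j \<noteq> 0" by (metis ent_0 fm_eqI)
  then have ijb: "i < n" "j < m" using T(1) by (auto simp: blk_iff not_le[symmetric])
  \<comment> \<open>The matrix unit is placed so that the trace of \<open>X * T1\<close> is the
    nonzero entry \<open>ent T1 i j\<close>.\<close>
  define X where "X = eu j i"
  have X: "X \<in> blk m n" unfolding X_def using ijb by (simp add: eu_blk)
  obtain Q where Q: "transversal R H Q" using finite_index by blast
  then have QH: "\<And>q. q \<in> Q \<Longrightarrow> q \<in> H" and finQ: "finite Q" by (auto simp: transversal_def)
  define U where "U = (\<Sum>h\<in>Q. \<sigma> h * X * \<rho> (iv h))"
  \<comment> \<open>\<open>iv\<close> is a choice and need not respect \<open>R\<close>; its image
    under \<rho> does, because inverses in a block are unique.\<close>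
  have ivR: "\<rho> (iv h) = \<rho> (iv h')" if "h \<in> H" "h' \<in> H" "R h h'" for h h'
  proof (rule blk_inverse_unique[of _ n _ "\<rho> h"])
    show "\<rho> h * \<rho> (iv h') = idn n"
      using prep_iv(1)[OF \<rho> that(2)] prepD(2)[OF \<rho> that] by simp
  qed (rule prep_iv_blk[OF \<rho> that(1)], rule prep_iv_blk[OF \<rho> that(2)], rule prep_iv(2)[OF \<rho> that(1)])
  have iv_mul: "\<rho> (iv (g \<star> h)) * \<rho> g = \<rho> (iv h)" if "g \<in> H" "h \<in> H" for g h
  proof (rule blk_inverse_unique[of _ n _ "\<rho> h"])
    show "\<rho> (iv (g \<star> h)) * \<rho> g \<in> blk n n"
      by (rule blk_mult[OF prep_iv_blk[OF \<rho> closed[OF that]] prepD(1)[OF \<rho> that(1)]])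
    show "\<rho> (iv (g \<star> h)) * \<rho> g * \<rho> h = idn n"
      using prep_iv[OF \<rho> closed[OF that]] prepD(3)[OF \<rho> that] by (simp add: mult.assoc)
  qed (use prep_iv_blk[OF \<rho> that(2)] prep_iv[OF \<rho> that(2)] in auto)
  have Ublk: "U \<in> blk m n"
    unfolding U_def
    by (rule blk_sum, rule blk_mult, rule blk_mult, rule prepD(1)[OF \<sigma>(1) QH], assumption,
        rule X, rule prep_iv_blk[OF \<rho> QH])
  have Uint: "\<sigma> g * U = U * \<rho> g" if g: "g \<in> H" for g
  proof -
    have "U * \<rho> g = (\<Sum>h\<in>Q. \<sigma> (g \<star> h) * X * \<rho> (iv (g \<star> h))) * \<rho> g"
    proof -
      have "(\<Sum>h\<in>Q. \<sigma> (g \<star> h) * X * \<rho> (iv (g \<star> h))) = U"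
        unfolding U_def
      proof (rule transversal_sum[OF R Q, where m = "\<lambda>h. g \<star> h" and f = "\<lambda>h. \<sigma> h * X * \<rho> (iv h)"])
        fix h h' assume h: "h \<in> H" "h' \<in> H" "R (g \<star> h) (g \<star> h')"
        have "R (iv g \<star> g \<star> h) (iv g \<star> g \<star> h')"
          using cong[OF equivp_reflp[OF R] h(3)] by (simp add: assoc)
        moreover have "R (iv g \<star> g \<star> h) h" for h
          using cong[of "iv g \<star> g" one h h] iv[OF g] equivp_reflp[OF R] mul_one by simp
        ultimately show "R h h'" using equivp_symp[OF R] equivp_transp[OF R] by metis
      qed (use closed g prepD(2)[OF \<sigma>(1)] ivR in auto)
      then show ?thesis by simp
    qed
    also have "\<dots> = (\<Sum>h\<in>Q. \<sigma> (g \<star> h) * X * \<rho> (iv h))"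
      by (simp add: sum_distrib_right mult.assoc iv_mul[OF g QH])
    also have "\<dots> = \<sigma> g * U"
      unfolding U_def sum_distrib_left
      by (intro sum.cong) (auto simp: prepD(3)[OF \<sigma>(1) g QH] mult.assoc)
    finally show ?thesis ..
  qed
  have scal: "\<exists>\<alpha>. U * T = sm \<alpha> (idn m)" if "T \<in> blk n m" "\<And>h. h \<in> H \<Longrightarrow> T * \<sigma> h = \<rho> h * T" for T
  proof -
    have "U * T * \<sigma> g = \<sigma> g * (U * T)" if "g \<in> H" for g
      using Uint[OF that] \<open>\<And>h. h \<in> H \<Longrightarrow> T * \<sigma> h = \<rho> h * T\<close>[OF that] by (metis mult.assoc)
    then show ?thesis using \<sigma>(2) blk_mult[OF Ublk that(1)] unfolding schur_def by blast
  qed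
  obtain a1 a2 where a: "U * T1 = sm a1 (idn m)" "U * T2 = sm a2 (idn m)"
    using scal T by metis
  \<comment> \<open>Each summand of \<open>U * T1\<close> is conjugate to \<open>X * T1\<close>
    under \<open>\<sigma> h\<close>, so all have the same trace.\<close>
  have "ftr m (\<sigma> h * X * \<rho> (iv h) * T1) = ent T1 i j" if "h \<in> Q" for h
  proof -
    have "\<sigma> h * X * \<rho> (iv h) * T1 = \<sigma> h * (X * T1 * \<sigma> (iv h))"
      using T(3) iv QH[OF that] by (simp add: mult.assoc)
    then have "ftr m (\<sigma> h * X * \<rho> (iv h) * T1) = ftr m (X * T1 * \<sigma> (iv h) * \<sigma> h)"
      using ftr_comm[OF prepD(1)[OF \<sigma>(1) QH[OF that]]
          blk_mult[OF blk_mult[OF X T(1)] prep_iv_blk[OF \<sigma>(1) QH[OF that]]]] by simp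
    also have "X * T1 * \<sigma> (iv h) * \<sigma> h = X * T1"
      using prep_iv[OF \<sigma>(1) QH[OF that]] blk_right[OF T(1)] by (simp add: mult.assoc)
    also have "ftr m (X * T1) = ent T1 i j"
      unfolding X_def ftr_def ent_eu_mult using ijb by simp
    finally show ?thesis .
  qed
  then have "ftr m (U * T1) = of_nat (card Q) * ent T1 i j"
    by (simp add: U_def sum_distrib_right ftr_sum)
  moreover have "Q \<noteq> {}" using Q one by (auto simp: transversal_def)
  ultimately have "a1 \<noteq> 0" using ij finQ a(1) by (auto simp: ftr_sm)
  have "T1 * U * (T2 * U) = T2 * U * (T1 * U)"
  proof (rule comm)
    show "T1 * U * \<rho> h = \<rho> h * (T1 * U)" "T2 * U * \<rho> h = \<rho> h * (T2 * U)" if "h \<in> H" for h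
      using T(3,4)[OF that] Uint[OF that] by (metis mult.assoc)+
  qed (use T Ublk blk_mult in blast)+
  then have "T1 * (U * T2) * U * T1 = T2 * (U * T1) * U * T1" by (simp add: mult.assoc)
  then have "sm (a2 * a1) T1 = sm (a1 * a1) T2"
    using T(1,2) by (simp add: a mult.assoc blk_right)
  then have "sm a1 (sm a2 T1) = sm a1 (sm a1 T2)" by (simp add: mult.commute)
  then have "sm a2 T1 = sm a1 T2" using sm_cancel[OF \<open>a1 \<noteq> 0\<close>] by blast
  then have "sm a2 T1 + sm (- a1) T2 = 0" by (simp add: sm_minus)
  then show ?thesis using \<open>a1 \<noteq> 0\<close> by (intro exI[of _ a2] exI[of _ "- a1"]) auto
qed

end

section \<open>Heisenberg systems\<close>

text \<open>\<open>E\<close> is a projective representation of the finite group \<open>W\<close>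
  modulo \<open>R\<close>. Its cocycle is alternating as well as bimultiplicative, which makes
  \<open>E (- v)\<close> the inverse of \<open>E v\<close> and the square of \<beta> the
  commutator.\<close>

locale heis =
  fixes n :: nat and W :: "'v::ab_group_add set" and R :: "'v \<Rightarrow> 'v \<Rightarrow> bool" and Q :: "'v set"
    and E :: "'v \<Rightarrow> fm" and \<beta> :: "'v \<Rightarrow> 'v \<Rightarrow> complex"
  assumes n: "0 < n"
    and W0: "0 \<in> W" and Wadd: "\<And>v w. v \<in> W \<Longrightarrow> w \<in> W \<Longrightarrow> v + w \<in> W"
    and Wminus: "\<And>v. v \<in> W \<Longrightarrow> - v \<in> W"
    and R: "equivp R" and Radd: "\<And>a b c. R a b \<Longrightarrow> R (a + c) (b + c)"
    and Q: "transversal R W Q"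
    and Eblk: "\<And>v. v \<in> W \<Longrightarrow> E v \<in> blk n n" and E0: "E 0 = idn n"
    and Emult: "\<And>v w. v \<in> W \<Longrightarrow> w \<in> W \<Longrightarrow> E v * E w = sm (\<beta> v w) (E (v + w))"
    and Eper: "\<And>v w. v \<in> W \<Longrightarrow> w \<in> W \<Longrightarrow> R v w \<Longrightarrow> E v = E w"
    and \<beta>l: "\<And>u v w. u \<in> W \<Longrightarrow> v \<in> W \<Longrightarrow> w \<in> W \<Longrightarrow> \<beta> (u + v) w = \<beta> u w * \<beta> v w"
    and \<beta>r: "\<And>u v w. u \<in> W \<Longrightarrow> v \<in> W \<Longrightarrow> w \<in> W \<Longrightarrow> \<beta> w (u + v) = \<beta> w u * \<beta> w v"
    and \<beta>alt: "\<And>v. v \<in> W \<Longrightarrow> \<beta> v v = 1"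
    and \<beta>per: "\<And>u v w. u \<in> W \<Longrightarrow> v \<in> W \<Longrightarrow> w \<in> W \<Longrightarrow> R u v \<Longrightarrow> \<beta> u w = \<beta> v w"
begin

lemma Wdiff: "v \<in> W \<Longrightarrow> w \<in> W \<Longrightarrow> v - w \<in> W"
  using Wadd[of v "- w"] Wminus by simp

lemma QW: "q \<in> Q \<Longrightarrow> q \<in> W" and finQ: "finite Q"
  using Q by (auto simp: transversal_def)

lemma Q_ex: "w \<in> W \<Longrightarrow> \<exists>q\<in>Q. R q w"
  and Q_unique: "q \<in> Q \<Longrightarrow> q' \<in> Q \<Longrightarrow> R q q' \<Longrightarrow> q = q'"
  using Q by (auto simp: transversal_def)

lemma cardQ: "card Q \<noteq> 0"
  using Q W0 by (auto simp: transversal_def)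

lemma \<beta>0l: assumes "w \<in> W" shows "\<beta> 0 w = 1"
proof -
  have "\<beta> w w = \<beta> 0 w * \<beta> w w" using \<beta>l[of 0 w w] assms W0 by simp
  then show ?thesis using \<beta>alt[OF assms] by simp
qed

lemma \<beta>0r: assumes "w \<in> W" shows "\<beta> w 0 = 1"
proof -
  have "\<beta> w w = \<beta> w 0 * \<beta> w w" using \<beta>r[of 0 w w] assms W0 by simp
  then show ?thesis using \<beta>alt[OF assms] by simp
qed

lemma \<beta>swap: assumes "v \<in> W" "w \<in> W" shows "\<beta> v w * \<beta> w v = 1"
proof -
  have "1 = \<beta> (v + w) (v + w)" using Wadd assms \<beta>alt by simp
  also have "\<dots> = \<beta> v w * \<beta> w v"
    using assms Wadd \<beta>l[of v w "v + w"] \<beta>r[of v w v] \<beta>r[of v w w] by (simp add: \<beta>alt)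
  finally show ?thesis by simp
qed

lemma \<beta>minus_l: assumes "v \<in> W" "w \<in> W" shows "\<beta> (- v) w = \<beta> w v"
proof -
  have "\<beta> (- v) w * \<beta> v w = 1" using \<beta>l[of "- v" v w] assms Wminus \<beta>0l by simp
  then have "\<beta> (- v) w * (\<beta> v w * \<beta> w v) = \<beta> w v" by (metis mult.assoc mult_1)
  then show ?thesis using \<beta>swap[OF assms] by simp
qed

lemma \<beta>minus_r: assumes "v \<in> W" "w \<in> W" shows "\<beta> v (- w) = \<beta> w v"
proof -
  have "\<beta> v (- w) * \<beta> v w = 1" using \<beta>r[of "- w" w v] assms Wminus \<beta>0r by simp
  then have "\<beta> v (- w) * (\<beta> v w * \<beta> w v) = \<beta> w v" by (metis mult.assoc mult_1)
  then show ?thesis using \<beta>swap[OF assms] by simp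
qed

lemma R_minus: "R a b \<Longrightarrow> R (- b) (- a)"
  using Radd[of a b "- a - b"] by simp

lemma \<beta>per_r:
  assumes "u \<in> W" "v \<in> W" "w \<in> W" "R u v"
  shows "\<beta> w u = \<beta> w v"
  using \<beta>per[of "- u" "- v" w] R_minus[OF equivp_symp[OF R assms(4)]] assms Wminus
  by (simp add: \<beta>minus_l)

lemma E_inv: assumes "v \<in> W" shows "E v * E (- v) = idn n" "E (- v) * E v = idn n"
  using assms Wminus by (simp_all add: Emult E0 \<beta>minus_l \<beta>minus_r \<beta>alt)

lemma E_comm: assumes "v \<in> W" "w \<in> W"
  shows "E v * E w = sm ((\<beta> v w)\<^sup>2) (E w * E v)"
proof -
  have "(\<beta> v w)\<^sup>2 * \<beta> w v = \<beta> v w" using \<beta>swap[OF assms] by (simp add: power2_eq_square mult.assoc)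
  then show ?thesis using assms by (simp add: Emult add.commute)
qed

lemma E_conj: assumes "v \<in> W" "w \<in> W"
  shows "E v * E w * E (- v) = sm ((\<beta> v w)\<^sup>2) (E w)"
  using E_comm[OF assms] E_inv[OF assms(1)] Eblk[OF assms(2)] by (simp add: mult.assoc blk_right)

lemma R_diff_0: "R a b \<longleftrightarrow> R (a - b) 0"
  using Radd[of a b "- b"] Radd[of "a - b" 0 b] by auto

lemma avg_translate:
  assumes "v \<in> W" and "\<And>u w. u \<in> W \<Longrightarrow> w \<in> W \<Longrightarrow> R u w \<Longrightarrow> f u = f w"
  shows "(\<Sum>k\<in>Q. f (v + k)) = (\<Sum>k\<in>Q. f k)"
proof (rule transversal_sum[OF R Q, where m = "\<lambda>k. v + k"])
  show "R h h'" if "R (v + h) (v + h')" for h h'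
    using Radd[OF that, of "- v"] by simp
qed (use assms Wadd in auto)

text \<open>Translating the index \<open>k\<close> by \<open>v\<close> costs
  \<open>\<beta> v k\<close> on the left of \<open>X\<close> and \<open>\<beta> k v\<close> on the
  right, and these cancel.\<close>

lemma conj_sum_commutes:
  assumes X: "X \<in> blk n n" and v: "v \<in> W"
  shows "E v * (\<Sum>k\<in>Q. E k * X * E (- k)) = (\<Sum>k\<in>Q. E k * X * E (- k)) * E v"
proof -
  let ?S = "\<Sum>k\<in>Q. E k * X * E (- k)"
  have S: "?S \<in> blk n n"
    by (intro blk_sum blk_mult[OF blk_mult]) (auto intro: Eblk QW Wminus X)
  have "E v * (E k * X * E (- k)) * E (- v) = E (v + k) * X * E (- (v + k))" if k: "k \<in> Q" for k
  proof -
    have "E v * (E k * X * E (- k)) * E (- v) = (E v * E k) * X * (E (- k) * E (- v))"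
      by (simp add: mult.assoc)
    also have "\<dots> = sm (\<beta> v k * \<beta> k v) (E (v + k) * X * E (- (v + k)))"
      using v QW[OF k] Wminus by (simp add: Emult \<beta>minus_l \<beta>minus_r add.commute[of k v] mult.commute[of "\<beta> k v"] minus_diff_commute[of k v])
    finally show ?thesis using \<beta>swap[OF v QW[OF k]] by simp
  qed
  then have "E v * ?S * E (- v) = (\<Sum>k\<in>Q. E (v + k) * X * E (- (v + k)))"
    by (simp add: sum_distrib_left sum_distrib_right)
  also have "\<dots> = ?S"
    using Eper Wminus R_minus equivp_symp[OF R] by (intro avg_translate[OF v]) metis
  finally have "E v * ?S * (E (- v) * E v) = ?S * E v" by (simp only: mult.assoc[symmetric])
  then show ?thesis using E_inv[OF v] blk_right[OF blk_mult[OF Eblk[OF v] S]] by simp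
qed

text \<open>Translation by \<open>k0\<close> multiplies the sum by
  \<open>(\<beta> k0 v)\<^sup>2\<close>, a factor different from 1.\<close>

lemma character_sum:
  assumes v: "v \<in> W" and k0: "k0 \<in> W" "(\<beta> k0 v)\<^sup>2 \<noteq> 1"
  shows "(\<Sum>k\<in>Q. (\<beta> k v)\<^sup>2) = 0"
proof -
  have "(\<Sum>k\<in>Q. (\<beta> k v)\<^sup>2) = (\<Sum>k\<in>Q. (\<beta> (k0 + k) v)\<^sup>2)"
    using \<beta>per v by (intro avg_translate[OF k0(1), symmetric]) metis
  also have "\<dots> = (\<beta> k0 v)\<^sup>2 * (\<Sum>k\<in>Q. (\<beta> k v)\<^sup>2)"
    using v k0 QW by (simp add: \<beta>l sum_distrib_left power_mult_distrib)
  finally show ?thesis using k0(2) by (metis mult_cancel_right1)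
qed

text \<open>An element \<open>c\<close> of the complement acting without fixed points on \<open>W\<close> acts on the
  representation by a multiple of \<open>\<Sum>w. E (c w) * E (- w)\<close>, so it lies in the span of the
  operators \<open>E w\<close>.\<close>
lemma scalar_commutant:
  fixes C :: "'c set" and \<Phi> \<Phi>' :: "'c \<Rightarrow> fm" and act :: "'c \<Rightarrow> 'v \<Rightarrow> 'v"
  assumes nondeg: "\<And>v. v \<in> W \<Longrightarrow> \<not> R v 0 \<Longrightarrow> \<exists>k\<in>W. (\<beta> k v)\<^sup>2 \<noteq> 1"
    and \<Phi>: "\<And>c. c \<in> C \<Longrightarrow> \<Phi> c \<in> blk n n" "\<And>c. c \<in> C \<Longrightarrow> \<Phi>' c \<in> blk n n"
      "\<And>c. c \<in> C \<Longrightarrow> \<Phi> c * \<Phi>' c = idn n" "\<And>c. c \<in> C \<Longrightarrow> \<Phi>' c * \<Phi> c = idn n"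
    and comm: "\<And>c d. c \<in> C \<Longrightarrow> d \<in> C \<Longrightarrow> \<Phi> c * \<Phi> d = \<Phi> d * \<Phi> c"
    and act: "\<And>c w. c \<in> C \<Longrightarrow> w \<in> W \<Longrightarrow> act c w \<in> W"
      "\<And>c w. c \<in> C \<Longrightarrow> w \<in> W \<Longrightarrow> \<Phi> c * E w = E (act c w) * \<Phi> c"
      "\<And>c v w. c \<in> C \<Longrightarrow> v \<in> W \<Longrightarrow> w \<in> W \<Longrightarrow> R (act c v) (act c w) \<Longrightarrow> R v w"
      "\<And>c w. c \<in> C \<Longrightarrow> w \<in> W \<Longrightarrow> act c (- w) = - act c w"
      "\<And>c w. c \<in> C \<Longrightarrow> w \<in> W \<Longrightarrow> R w 0 \<Longrightarrow> R (act c w) 0"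
    and dich: "\<And>c. c \<in> C \<Longrightarrow> (\<forall>w\<in>W. R (act c w) w) \<or> (\<forall>w\<in>W. R (act c w) w \<longrightarrow> R w 0)"
    and schur: "\<And>X. X \<in> blk n n \<Longrightarrow> (\<And>w. w \<in> W \<Longrightarrow> X * E w = E w * X) \<Longrightarrow>
        (\<And>c. c \<in> C \<Longrightarrow> X * \<Phi> c = \<Phi> c * X) \<Longrightarrow> \<exists>a. X = sm a (idn n)"
    and X: "X \<in> blk n n" "\<And>w. w \<in> W \<Longrightarrow> X * E w = E w * X"
  shows "\<exists>a. X = sm a (idn n)"
proof (rule schur[OF X])
  fix c assume c: "c \<in> C"
  show "X * \<Phi> c = \<Phi> c * X"
  proof (cases "\<forall>w\<in>W. R (act c w) w")
    case True
    \<comment> \<open>Acting trivially on classes, \<open>\<Phi> c\<close> commutes with every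
      \<open>E w\<close> and with the commuting family of all \<open>\<Phi> d\<close>, so it is
      scalar.\<close>
    have "\<exists>a. \<Phi> c = sm a (idn n)"
    proof (rule schur[OF \<Phi>(1)[OF c]])
      show "\<Phi> c * E w = E w * \<Phi> c" if "w \<in> W" for w
        using act(2)[OF c that] Eper[OF act(1)[OF c that] that] True that by simp
    qed (rule comm[OF c])
    then show ?thesis using X(1) by (auto simp: blk_left blk_right)
  next
    case False
    then have fixfree: "\<And>w. w \<in> W \<Longrightarrow> R (act c w) w \<Longrightarrow> R w 0" using dich[OF c] by blast
    \<comment> \<open>\<open>Y\<close> averages the inverse of \<open>\<Phi> c\<close> over the
      Heisenberg operators. It commutes with them, and with every \<open>\<Phi> d\<close>, which
      only permutes the summands; so \<open>Y\<close> is a scalar \<open>y\<close>, and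
      \<open>\<tau> = \<Phi> c * Y\<close> is \<open>y\<close> times
      \<open>\<Phi> c\<close>.\<close>
    define Y where "Y = (\<Sum>w\<in>Q. E w * \<Phi>' c * E (- w))"
    define \<tau> where "\<tau> = (\<Sum>w\<in>Q. E (act c w) * E (- w))"
    have Yblk: "Y \<in> blk n n"
      unfolding Y_def by (intro blk_sum blk_mult[OF blk_mult]) (auto intro: Eblk QW Wminus \<Phi> c)
    have \<tau>Y: "\<Phi> c * Y = \<tau>"
      unfolding Y_def \<tau>_def sum_distrib_left
    proof (rule sum.cong[OF refl])
      fix w assume w: "w \<in> Q"
      have "\<Phi> c * (E w * \<Phi>' c * E (- w)) = (\<Phi> c * E w) * \<Phi>' c * E (- w)" by (simp add: mult.assoc)
      also have "\<dots> = E (act c w) * (\<Phi> c * \<Phi>' c) * E (- w)"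
        using act(2)[OF c QW[OF w]] by (simp add: mult.assoc)
      also have "\<dots> = E (act c w) * E (- w)"
        using \<Phi>(3)[OF c] Eblk[OF act(1)[OF c QW[OF w]]] by (simp add: blk_right)
      finally show "\<Phi> c * (E w * \<Phi>' c * E (- w)) = E (act c w) * E (- w)" .
    qed
    have "\<exists>y. Y = sm y (idn n)"
    proof (rule schur[OF Yblk])
      show "Y * E w = E w * Y" if "w \<in> W" for w
        unfolding Y_def using conj_sum_commutes[OF \<Phi>(2)[OF c] that] by simp
      show "Y * \<Phi> d = \<Phi> d * Y" if d: "d \<in> C" for d
      proof -
        have comm': "\<Phi> d * \<Phi>' c = \<Phi>' c * \<Phi> d"
        proof -
          have "\<Phi>' c * (\<Phi> c * \<Phi> d) * \<Phi>' c = \<Phi>' c * (\<Phi> d * \<Phi> c) * \<Phi>' c" using comm[OF c d] by simp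
          then have "(\<Phi>' c * \<Phi> c) * \<Phi> d * \<Phi>' c = \<Phi>' c * \<Phi> d * (\<Phi> c * \<Phi>' c)" by (simp add: mult.assoc)
          then show ?thesis
            using \<Phi>(1)[OF d] \<Phi>(3,4)[OF c] blk_right[OF blk_mult[OF \<Phi>(2)[OF c] \<Phi>(1)[OF d]]]
            by (simp add: blk_left)
        qed
        have "\<Phi> d * (E w * \<Phi>' c * E (- w)) = E (act d w) * \<Phi>' c * E (- act d w) * \<Phi> d" if w: "w \<in> W" for w
        proof -
          have "\<Phi> d * (E w * \<Phi>' c * E (- w)) = E (act d w) * (\<Phi> d * \<Phi>' c) * E (- w)"
            using act(2)[OF d w] by (simp add: mult.assoc[symmetric])
          also have "\<dots> = E (act d w) * \<Phi>' c * (\<Phi> d * E (- w))"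
            using comm' by (simp add: mult.assoc)
          also have "\<dots> = E (act d w) * \<Phi>' c * E (- act d w) * \<Phi> d"
            using act(2)[OF d Wminus[OF w]] act(4)[OF d w] by (simp add: mult.assoc)
          finally show ?thesis .
        qed
        then have "\<Phi> d * Y = (\<Sum>w\<in>Q. E (act d w) * \<Phi>' c * E (- act d w)) * \<Phi> d"
          unfolding Y_def sum_distrib_left sum_distrib_right by (intro sum.cong) (auto dest: QW)
        also have "(\<Sum>w\<in>Q. E (act d w) * \<Phi>' c * E (- act d w)) = Y"
          unfolding Y_def
        proof (rule transversal_sum[OF R Q, where m = "act d" and f = "\<lambda>w. E w * \<Phi>' c * E (- w)"])
          show "E h * \<Phi>' c * E (- h) = E h' * \<Phi>' c * E (- h')" if "h \<in> W" "h' \<in> W" "R h h'" for h h'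
            using Eper[OF that] Eper[of "- h" "- h'"] Wminus that R_minus[OF equivp_symp[OF R that(3)]] by simp
        qed (use act d in auto)
        finally show ?thesis ..
      qed
    qed
    then obtain y where y: "Y = sm y (idn n)" by blast
    have \<tau>y: "\<tau> = sm y (\<Phi> c)" using \<tau>Y y \<Phi>(1)[OF c] by (simp add: blk_right)
    have \<tau>blk: "\<tau> \<in> blk n n" unfolding \<tau>y by (rule blk_sm[OF \<Phi>(1)[OF c]])
    \<comment> \<open>Averaging \<tau> once more extracts the coefficient of the identity. The term
      of \<open>w\<close> survives only if \<open>act c w - w\<close> is in the zero class, that is,
      for \<open>w\<close> in the zero class, so the average is \<open>card Q\<close> times the
      identity.\<close>
    have "y \<noteq> 0"
    proof
      assume "y = 0"
      then have "(\<Sum>k\<in>Q. E k * \<tau> * E (- k)) = 0" using \<tau>y by simp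
      moreover have "(\<Sum>k\<in>Q. E k * \<tau> * E (- k)) = sm (of_nat (card Q)) (idn n)"
      proof -
        have 1: "E k * (E (act c w) * E (- w)) * E (- k) = sm (\<beta> w (act c w) * (\<beta> k (act c w - w))\<^sup>2) (E (act c w - w))"
          if "k \<in> Q" "w \<in> Q" for k w
        proof -
          have W: "k \<in> W" "w \<in> W" "act c w \<in> W" "act c w - w \<in> W"
            using that QW act(1)[OF c] Wdiff by auto
          have "E (act c w) * E (- w) = sm (\<beta> w (act c w)) (E (act c w - w))"
            using W Wminus by (simp add: Emult \<beta>minus_r)
          then have "E k * (E (act c w) * E (- w)) * E (- k) = sm (\<beta> w (act c w)) (E k * E (act c w - w) * E (- k))"
            by simp
          then show ?thesis using E_conj[OF W(1,4)] by simp
        qed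
        have "(\<Sum>k\<in>Q. E k * \<tau> * E (- k)) = (\<Sum>w\<in>Q. \<Sum>k\<in>Q. sm (\<beta> w (act c w) * (\<beta> k (act c w - w))\<^sup>2) (E (act c w - w)))"
          unfolding \<tau>_def sum_distrib_left sum_distrib_right
          by (subst sum.swap) (simp add: 1)
        also have "\<dots> = (\<Sum>w\<in>Q. sm (\<beta> w (act c w) * (\<Sum>k\<in>Q. (\<beta> k (act c w - w))\<^sup>2)) (E (act c w - w)))"
          by (simp add: sum_distrib_left sum_sm)
        also have "\<dots> = (\<Sum>w\<in>Q. if R w 0 then sm (of_nat (card Q)) (idn n) else 0)"
        proof (rule sum.cong[OF refl])
          fix w assume w: "w \<in> Q"
          have wW: "w \<in> W" and aW: "act c w \<in> W" and dW: "act c w - w \<in> W"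
            using QW[OF w] act(1)[OF c] Wdiff by auto
          show "sm (\<beta> w (act c w) * (\<Sum>k\<in>Q. (\<beta> k (act c w - w))\<^sup>2)) (E (act c w - w)) =
            (if R w 0 then sm (of_nat (card Q)) (idn n) else 0)"
          proof (cases "R w 0")
            case False
            then have "\<not> R (act c w - w) 0" using fixfree[OF wW] R_diff_0 by blast
            then obtain k0 where "k0 \<in> W" "(\<beta> k0 (act c w - w))\<^sup>2 \<noteq> 1" using nondeg dW by blast
            then show ?thesis using character_sum[OF dW] False by simp
          next
            case True
            then have r0: "R (act c w) 0" "R (act c w - w) 0"
              using act(5)[OF c wW] equivp_symp[OF R] equivp_transp[OF R] R_diff_0 by blast+
            have "\<beta> w (act c w) = 1" using \<beta>per[OF wW W0 aW True] \<beta>0l[OF aW] by simp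
            moreover have "\<beta> k (act c w - w) = 1" if "k \<in> Q" for k
              using \<beta>per_r[OF dW W0 QW[OF that] r0(2)] \<beta>0r[OF QW[OF that]] by simp
            moreover have "E (act c w - w) = idn n" using Eper[OF dW W0 r0(2)] E0 by simp
            ultimately show ?thesis using True by simp
          qed
        qed
        also have "\<dots> = sm (of_nat (card Q)) (idn n)"
        proof -
          obtain q0 where q0: "q0 \<in> Q" "R q0 0" using Q W0 by (auto simp: transversal_def)
          have "w = q0" if "w \<in> Q" "R w 0" for w
            using Q q0(1) that(1) equivp_transp[OF R that(2) equivp_symp[OF R q0(2)]]
            unfolding transversal_def by blast
          then have "(\<Sum>w\<in>Q. if R w 0 then sm (of_nat (card Q)) (idn n) else 0) =
              (\<Sum>w\<in>Q. if w = q0 then sm (of_nat (card Q)) (idn n) else 0)"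
            using q0(2) by (intro sum.cong refl) (metis (full_types))
          then show ?thesis using q0(1) finQ by simp
        qed
        finally show ?thesis .
      qed
      ultimately show False using idn_neq_0[OF n] cardQ by (simp add: sm_eq_0)
    qed
    have "X * \<tau> = \<tau> * X"
      unfolding \<tau>_def sum_distrib_left sum_distrib_right
    proof (rule sum.cong[OF refl])
      fix w assume w: "w \<in> Q"
      show "X * (E (act c w) * E (- w)) = E (act c w) * E (- w) * X"
        using X(2)[OF act(1)[OF c QW[OF w]]] X(2)[OF Wminus[OF QW[OF w]]] by (metis mult.assoc)
    qed
    then have "sm y (X * \<Phi> c) = sm y (\<Phi> c * X)" unfolding \<tau>y by simp
    then show ?thesis using sm_cancel[OF \<open>y \<noteq> 0\<close>] by blast
  qed
qed


text \<open>The entrywise form of \<open>\<Sum>k. E k * X * E (- k) = \<kappa> tr X\<close>; it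
  implies that the operators span all \<open>n\<close> by \<open>n\<close> matrices.\<close>

definition complete :: "complex \<Rightarrow> bool" where
  "complete \<kappa> \<longleftrightarrow> \<kappa> \<noteq> 0 \<and> (\<forall>a<n. \<forall>i<n. \<forall>j<n. \<forall>b<n.
     (\<Sum>k\<in>Q. ent (E k) a i * ent (E (- k)) j b) = (if i = j \<and> a = b then \<kappa> else 0))"

text \<open>The conjugation average of a matrix unit is scalar, and its trace, \<open>card Q\<close>
  times that of the matrix unit, gives the constant \<open>card Q / n\<close>.\<close>

lemma scalar_commutant_complete:
  assumes "\<And>X. X \<in> blk n n \<Longrightarrow> (\<And>w. w \<in> W \<Longrightarrow> X * E w = E w * X) \<Longrightarrow> \<exists>a. X = sm a (idn n)"
  shows "\<exists>\<kappa>. complete \<kappa>"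
proof -
  define \<kappa> :: complex where "\<kappa> = of_nat (card Q) / of_nat n"
  have "(\<Sum>k\<in>Q. ent (E k) a i * ent (E (- k)) j b) = (if i = j \<and> a = b then \<kappa> else 0)"
    if ab: "a < n" "i < n" "j < n" "b < n" for a i j b
  proof -
    let ?S = "\<Sum>k\<in>Q. E k * eu i j * E (- k)"
    have eb: "eu i j \<in> blk n n" using ab by (simp add: eu_blk)
    have S: "?S \<in> blk n n"
      by (intro blk_sum blk_mult[OF blk_mult]) (auto intro: Eblk QW Wminus eb)
    have "\<exists>s. ?S = sm s (idn n)"
      by (rule assms[OF S]) (rule conj_sum_commutes[OF eb, symmetric])
    then obtain s where s: "?S = sm s (idn n)" by blast
    have "ftr n (E k * eu i j * E (- k)) = (if i = j then 1 else 0)" if "k \<in> Q" for k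
    proof -
      have "ftr n (E k * (eu i j * E (- k))) = ftr n (eu i j * E (- k) * E k)"
        by (rule ftr_comm[OF Eblk[OF QW[OF that]] blk_mult[OF eb Eblk[OF Wminus[OF QW[OF that]]]]])
      also have "eu i j * E (- k) * E k = eu i j"
        using E_inv(2)[OF QW[OF that]] eb by (simp add: mult.assoc blk_right)
      also have "ftr n (eu i j) = (\<Sum>x<n. if x = i then (if i = j then 1 else 0) else 0)"
        unfolding ftr_def by (rule sum.cong) (auto simp: ent_eu)
      finally show ?thesis using ab by (simp add: mult.assoc)
    qed
    then have "ftr n ?S = (if i = j then of_nat (card Q) else 0)" by (simp add: ftr_sum)
    then have "s * of_nat n = (if i = j then of_nat (card Q) else 0)"
      unfolding s by (simp add: ftr_sm ftr_idn)
    then have s\<kappa>: "s = (if i = j then \<kappa> else 0)" using n by (auto simp: \<kappa>_def field_simps)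
    have "ent (E k * eu i j * E (- k)) a b = ent (E k) a i * ent (E (- k)) j b" if "k \<in> Q" for k
    proof -
      have "ent (E k * (eu i j * E (- k))) a b = (\<Sum>x<n. if x = i then ent (E k) a i * ent (E (- k)) j b else 0)"
        unfolding ent_blk_mult[OF Eblk[OF QW[OF that]]]
        by (rule sum.cong) (auto simp: ent_eu_mult)
      then show ?thesis using ab by (simp add: mult.assoc)
    qed
    then have "(\<Sum>k\<in>Q. ent (E k) a i * ent (E (- k)) j b) = ent ?S a b"
      by (simp add: ent_sum)
    also have "\<dots> = (if i = j \<and> a = b then \<kappa> else 0)"
      unfolding s s\<kappa> using ab by (simp add: ent_sm ent_idn)
    finally show ?thesis .
  qed
  moreover have "\<kappa> \<noteq> 0" using n cardQ by (simp add: \<kappa>_def)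
  ultimately show ?thesis unfolding complete_def by blast
qed

section \<open>Fourier coefficients with respect to a Heisenberg system\<close>

definition coef :: "fm \<Rightarrow> 'v \<Rightarrow> complex" where
  "coef Z v = ftr n (Z * E (- v))"

text \<open>The completeness relation is a resolution of the identity: contracted with the entries
  of \<open>Z\<close> it returns \<kappa> times \<open>Z\<close>.\<close>

lemma expansion:
  assumes "complete \<kappa>" and Z: "Z \<in> blk n n"
  shows "sm \<kappa> Z = (\<Sum>k\<in>Q. sm (coef Z k) (E k))"
proof (rule fm_eqI)
  fix a b
  show "ent (sm \<kappa> Z) a b = ent (\<Sum>k\<in>Q. sm (coef Z k) (E k)) a b"
  proof (cases "a < n \<and> b < n")
    case False
    moreover have "(\<Sum>k\<in>Q. sm (coef Z k) (E k)) \<in> blk n n"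
      by (intro blk_sum blk_sm Eblk QW)
    ultimately show ?thesis using Z by (auto simp: blk_iff ent_sm not_less)
  next
    case True
    have "ent (\<Sum>k\<in>Q. sm (coef Z k) (E k)) a b =
        (\<Sum>k\<in>Q. \<Sum>i<n. \<Sum>j<n. ent Z i j * (ent (E k) a b * ent (E (- k)) j i))"
      unfolding ent_sum ent_sm coef_def ftr_def ent_blk_mult[OF Z]
      by (simp add: sum_distrib_left sum_distrib_right mult_ac)
    also have "\<dots> = (\<Sum>i<n. \<Sum>j<n. ent Z i j * (\<Sum>k\<in>Q. ent (E k) a b * ent (E (- k)) j i))"
      unfolding sum_distrib_left by (subst sum.swap, rule sum.cong[OF refl], rule sum.swap)
    also have "\<dots> = (\<Sum>i<n. \<Sum>j<n. if j = b then (if i = a then ent Z a b * \<kappa> else 0) else 0)"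
      using assms(1) True unfolding complete_def by (intro sum.cong refl) auto
    also have "\<dots> = ent (sm \<kappa> Z) a b" using True by (simp add: ent_sm mult.commute)
    finally show ?thesis ..
  qed
qed

lemma coef_per:
  assumes "v \<in> W" "w \<in> W" "R v w"
  shows "coef Z v = coef Z w"
  unfolding coef_def using Eper[of "- v" "- w"] R_minus[OF equivp_symp[OF R assms(3)]] assms Wminus by simp

text \<open>Only pairs inside \<open>A\<close> contribute to the double sum for the product, and
  there the operators commute.\<close>

lemma commute_if_coef_supported:
  assumes \<kappa>: "complete \<kappa>" and Z: "Z \<in> blk n n" "Z' \<in> blk n n"
    and supp: "\<And>v. v \<in> W \<Longrightarrow> v \<notin> A \<Longrightarrow> coef Z v = 0" "\<And>v. v \<in> W \<Longrightarrow> v \<notin> A \<Longrightarrow> coef Z' v = 0"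
    and comm: "\<And>v w. v \<in> W \<Longrightarrow> w \<in> W \<Longrightarrow> v \<in> A \<Longrightarrow> w \<in> A \<Longrightarrow> (\<beta> v w)\<^sup>2 = 1"
  shows "Z * Z' = Z' * Z"
proof -
  have "sm (\<kappa> * \<kappa>) (Z * Z') = sm \<kappa> Z * sm \<kappa> Z'" by simp
  also have "\<dots> = (\<Sum>k\<in>Q. \<Sum>m\<in>Q. sm (coef Z k) (E k) * sm (coef Z' m) (E m))"
    unfolding expansion[OF \<kappa> Z(1)] expansion[OF \<kappa> Z(2)] by (rule sum_product)
  also have "\<dots> = (\<Sum>k\<in>Q. \<Sum>m\<in>Q. sm (coef Z' m) (E m) * sm (coef Z k) (E k))"
  proof (intro sum.cong refl)
    fix k m assume km: "k \<in> Q" "m \<in> Q"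
    show "sm (coef Z k) (E k) * sm (coef Z' m) (E m) = sm (coef Z' m) (E m) * sm (coef Z k) (E k)"
    proof (cases "k \<in> A \<and> m \<in> A")
      case True
      then have "E k * E m = E m * E k" using E_comm[of k m] comm km QW by simp
      then show ?thesis by (simp add: mult.commute)
    next
      case False
      then have "coef Z k = 0 \<or> coef Z' m = 0" using supp km QW by blast
      then show ?thesis by auto
    qed
  qed
  also have "\<dots> = (\<Sum>m\<in>Q. \<Sum>k\<in>Q. sm (coef Z' m) (E m) * sm (coef Z k) (E k))" by (rule sum.swap)
  also have "\<dots> = sm \<kappa> Z' * sm \<kappa> Z"
    unfolding expansion[OF \<kappa> Z(1)] expansion[OF \<kappa> Z(2)] by (rule sum_product[symmetric])
  also have "\<dots> = sm (\<kappa> * \<kappa>) (Z' * Z)" by simp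
  finally show ?thesis using \<kappa> by (simp add: complete_def sm_cancel)
qed

text \<open>Gelfand's trick: \<open>E v \<mapsto> E (s v)\<close> reverses products and fixes every \<open>Z\<close> in \<open>D\<close>.\<close>
lemma commute_if_coef_invariant:
  assumes \<kappa>: "complete \<kappa>" and D: "\<And>Z. Z \<in> D \<Longrightarrow> Z \<in> blk n n" "\<And>Z Z'. Z \<in> D \<Longrightarrow> Z' \<in> D \<Longrightarrow> Z * Z' \<in> D"
    and s: "\<And>v. v \<in> W \<Longrightarrow> s v \<in> W" "\<And>v w. v \<in> W \<Longrightarrow> w \<in> W \<Longrightarrow> s (v - w) = s v - s w"
      "\<And>v w. v \<in> W \<Longrightarrow> w \<in> W \<Longrightarrow> R (s v) (s w) \<Longrightarrow> R v w"
      "\<And>v w. v \<in> W \<Longrightarrow> w \<in> W \<Longrightarrow> \<beta> (s v) (s w) = \<beta> w v"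
    and inv: "\<And>Z v. Z \<in> D \<Longrightarrow> v \<in> W \<Longrightarrow> coef Z (s v) = coef Z v"
    and Z: "Z \<in> D" "Z' \<in> D"
  shows "Z * Z' = Z' * Z"
proof -
  have \<kappa>0: "\<kappa> \<noteq> 0" using \<kappa> by (simp add: complete_def)
  note Zb = D(1)[OF Z(1)] D(1)[OF Z(2)]
  have "coef (Z * Z') u = coef (Z' * Z) u" if u: "u \<in> W" for u
  proof -
    have su: "s u \<in> W" using s(1)[OF u] .
    have tr1: "ftr n (E w * Z' * E (- s u)) = \<beta> w (s u) * coef Z' (s u - w)" if w: "w \<in> W" for w
    proof -
      have "ftr n (E w * (Z' * E (- s u))) = ftr n (Z' * E (- s u) * E w)"
        by (rule ftr_comm[OF Eblk[OF w] blk_mult[OF Zb(2) Eblk[OF Wminus[OF su]]]])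
      also have "Z' * E (- s u) * E w = sm (\<beta> w (s u)) (Z' * E (- (s u - w)))"
        using w su Wminus by (simp add: mult.assoc Emult \<beta>minus_l)
      finally show ?thesis by (simp add: mult.assoc ftr_sm coef_def)
    qed
    have tr2: "ftr n (Z' * E w * E (- u)) = \<beta> u w * coef Z' (u - w)" if w: "w \<in> W" for w
    proof -
      have "Z' * E w * E (- u) = sm (\<beta> u w) (Z' * E (- (u - w)))"
        using w u Wminus by (simp add: mult.assoc Emult \<beta>minus_r)
      then show ?thesis by (simp add: ftr_sm coef_def)
    qed
    have "\<kappa> * coef (Z * Z') (s u) = ftr n (sm \<kappa> Z * Z' * E (- s u))"
      by (simp add: coef_def ftr_sm)
    also have "\<dots> = (\<Sum>w\<in>Q. coef Z w * (\<beta> w (s u) * coef Z' (s u - w)))"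
      unfolding expansion[OF \<kappa> Zb(1)] sum_distrib_right ftr_sum
      by (intro sum.cong refl) (simp add: ftr_sm tr1 QW)
    \<comment> \<open>Substituting \<open>w = s v\<close> turns \<open>\<beta> w (s u)\<close> into
      \<open>\<beta> u v\<close>, the constant that belongs to \<open>Z' * Z\<close>: here the order
      of the factors is reversed.\<close>
    also have "\<dots> = (\<Sum>v\<in>Q. coef Z (s v) * (\<beta> (s v) (s u) * coef Z' (s u - s v)))"
    proof (rule transversal_sum[OF R Q, where m = s, symmetric])
      show "coef Z h * (\<beta> h (s u) * coef Z' (s u - h)) = coef Z h' * (\<beta> h' (s u) * coef Z' (s u - h'))"
        if h: "h \<in> W" "h' \<in> W" "R h h'" for h h'
      proof -
        have "R (- h) (- h')" by (rule R_minus[OF equivp_symp[OF R h(3)]])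
        then have "R (s u - h) (s u - h')" using Radd[of "- h" "- h'" "s u"] by simp
        then show ?thesis
          using coef_per[OF h, of Z] \<beta>per[OF h(1,2) su h(3)] coef_per[of "s u - h" "s u - h'" Z'] Wdiff su h by simp
      qed
    qed (use s in auto)
    also have "\<dots> = (\<Sum>v\<in>Q. coef Z v * (\<beta> u v * coef Z' (u - v)))"
      by (intro sum.cong refl) (simp add: s(2)[symmetric] s(4) inv[OF Z(1)] inv[OF Z(2)] u QW Wdiff)
    also have "\<dots> = ftr n (Z' * sm \<kappa> Z * E (- u))"
      unfolding expansion[OF \<kappa> Zb(1)] sum_distrib_left sum_distrib_right ftr_sum
      by (intro sum.cong refl) (simp add: ftr_sm tr2 QW)
    also have "\<dots> = \<kappa> * coef (Z' * Z) u" by (simp add: coef_def ftr_sm)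
    \<comment> \<open>The product lies in \<open>D\<close> again, so its coefficient at
      \<open>s u\<close> is also the one at \<open>u\<close>.\<close>
    finally show ?thesis using \<kappa>0 inv[OF D(2)[OF Z] u] by simp
  qed
  then have "sm \<kappa> (Z * Z') = sm \<kappa> (Z' * Z)"
    unfolding expansion[OF \<kappa> blk_mult[OF Zb]] expansion[OF \<kappa> blk_mult[OF Zb(2,1)]]
    by (intro sum.cong refl) (simp add: QW)
  then show ?thesis using sm_cancel[OF \<kappa>0] by blast
qed

text \<open>\<open>Z\<close> commutes with \<open>h\<close>, so the trace that defines the
  coefficient is unchanged under conjugation by \<open>h\<close>, which carries
  \<open>E (- v)\<close> to \<mu> times \<open>E (- w)\<close>.\<close>

lemma coef_eq_conj:
  assumes Z: "Z \<in> blk n n" "h \<in> blk n n" "h' \<in> blk n n" "h * h' = idn n" "h' * h = idn n" "Z * h = h * Z"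
    and vw: "v \<in> W" "w \<in> W" "h * E (- v) = sm \<mu> (E (- w) * h)"
  shows "coef Z v = \<mu> * coef Z w"
proof -
  have "Z * E (- v) = Z * (h' * h) * E (- v)" using Z by (simp add: blk_right)
  also have "\<dots> = sm \<mu> (Z * h' * E (- w) * h)" using vw(3) by (simp add: mult.assoc)
  finally have "coef Z v = \<mu> * ftr n (Z * h' * E (- w) * h)" by (simp add: coef_def ftr_sm)
  also have "ftr n (Z * h' * E (- w) * h) = ftr n (h * (Z * h' * E (- w)))"
    by (rule ftr_comm) (auto intro!: blk_mult Z Eblk Wminus vw)
  also have "h * (Z * h' * E (- w)) = Z * (h * h') * E (- w)"
    using Z(6) by (simp add: mult.assoc[symmetric])
  finally show ?thesis using Z by (simp add: coef_def blk_right)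
qed

end

section \<open>Tensor products of Heisenberg systems\<close>

definition ten :: "nat \<Rightarrow> nat \<Rightarrow> fm \<Rightarrow> fm \<Rightarrow> fm" where
  "ten n1 n2 X Y = em (mat (n1 * n2) (n1 * n2)
     (\<lambda>(i, j). ent X (i div n2) (j div n2) * ent Y (i mod n2) (j mod n2)))"

lemma ent_ten:
  "i < n1 * n2 \<Longrightarrow> j < n1 * n2 \<Longrightarrow>
    ent (ten n1 n2 X Y) i j = ent X (i div n2) (j div n2) * ent Y (i mod n2) (j mod n2)"
  by (simp add: ten_def ent_em)

lemma ten_blk: "ten n1 n2 X Y \<in> blk (n1 * n2) (n1 * n2)"
  unfolding ten_def by (intro em_blk) simp

lemma div_mod_less:
  assumes "i < n1 * n2"
  shows "i div n2 < n1" "i mod n2 < (n2::nat)"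
  using assms by (simp add: less_mult_imp_div_less, metis mod_less_divisor mult_0_right not_less0 neq0_conv)

lemma mult_add_less:
  assumes "a < n1" "b < n2"
  shows "a * n2 + b < n1 * (n2::nat)"
proof -
  have "a * n2 + b < Suc a * n2" using assms by simp
  also have "\<dots> \<le> n1 * n2" using assms by (intro mult_le_mono1) simp
  finally show ?thesis .
qed

lemma em_tensor_mat:
  assumes "A \<in> carrier_mat n1 n1" "B \<in> carrier_mat n2 n2"
  shows "em (tensor_mat n1 n2 A B) = ten n1 n2 (em A) (em B)"
  unfolding ten_def tensor_mat_def using assms div_mod_less
  by (intro arg_cong[of _ _ em] eq_matI) (auto simp: ent_em)

lemma sum_div_mod:
  fixes f g :: "nat \<Rightarrow> complex"
  shows "(\<Sum>k<n1 * n2. f (k div n2) * g (k mod n2)) = (\<Sum>a<n1. f a) * (\<Sum>b<n2. g b)"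
proof -
  have "(\<Sum>k<n1 * n2. f (k div n2) * g (k mod n2)) = (\<Sum>(a, b)\<in>{..<n1} \<times> {..<n2}. f a * g b)"
    by (rule sum.reindex_bij_witness[where j = "\<lambda>k. (k div n2, k mod n2)" and i = "\<lambda>(a, b). a * n2 + b"])
      (auto simp: div_mod_less intro: mult_add_less)
  then show ?thesis by (simp add: sum_product sum.cartesian_product)
qed

lemma ten_mult:
  assumes "X \<in> blk n1 n1" "Y \<in> blk n2 n2"
  shows "ten n1 n2 X Y * ten n1 n2 X' Y' = ten n1 n2 (X * X') (Y * Y')"
proof (rule fm_eqI)
  fix i j
  let ?N = "n1 * n2"
  show "ent (ten n1 n2 X Y * ten n1 n2 X' Y') i j = ent (ten n1 n2 (X * X') (Y * Y')) i j"
  proof (cases "i < ?N \<and> j < ?N")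
    case False
    then show ?thesis
      using ten_blk[of n1 n2 "X * X'" "Y * Y'"] blk_mult[OF ten_blk[of n1 n2 X Y] ten_blk[of n1 n2 X' Y']]
      by (auto simp: blk_iff not_less)
  next
    case True
    have "ent (ten n1 n2 X Y * ten n1 n2 X' Y') i j =
        (\<Sum>k<?N. (ent X (i div n2) (k div n2) * ent X' (k div n2) (j div n2)) *
                 (ent Y (i mod n2) (k mod n2) * ent Y' (k mod n2) (j mod n2)))"
      unfolding ent_blk_mult[OF ten_blk] using True by (intro sum.cong refl) (simp add: ent_ten)
    also have "\<dots> = ent (X * X') (i div n2) (j div n2) * ent (Y * Y') (i mod n2) (j mod n2)"
      unfolding ent_blk_mult[OF assms(1)] ent_blk_mult[OF assms(2)]
      by (rule sum_div_mod[where f = "\<lambda>k. ent X (i div n2) k * ent X' k (j div n2)"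
            and g = "\<lambda>k. ent Y (i mod n2) k * ent Y' k (j mod n2)"])
    finally show ?thesis using True by (simp add: ent_ten)
  qed
qed

lemma ten_idn: "ten n1 n2 (idn n1) (idn n2) = idn (n1 * n2)"
proof (rule fm_eqI)
  fix i j
  have "i div n2 = j div n2 \<Longrightarrow> i mod n2 = j mod n2 \<Longrightarrow> i = j"
    by (metis div_mult_mod_eq)
  then show "ent (ten n1 n2 (idn n1) (idn n2)) i j = ent (idn (n1 * n2)) i j"
    using ten_blk[of n1 n2 "idn n1" "idn n2"] div_mod_less[of i n1 n2] div_mod_less[of j n1 n2]
    by (cases "i < n1 * n2 \<and> j < n1 * n2") (auto simp: ent_ten ent_idn blk_iff not_less)
qed

lemma ten_sm: "ten n1 n2 (sm a X) (sm b Y) = sm (a * b) (ten n1 n2 X Y)"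
  unfolding ten_def by (rule fm_eqI) (simp add: ent_em ent_sm)

lemma heis_tensor:
  assumes "heis n1 W1 R1 Q1 E1 \<beta>1" "heis n2 W2 R2 Q2 E2 \<beta>2"
  shows "heis (n1 * n2) (W1 \<times> W2) (rel_prod R1 R2) (Q1 \<times> Q2) (\<lambda>(v, w). ten n1 n2 (E1 v) (E2 w))
    (\<lambda>(v, w) (v', w'). \<beta>1 v v' * \<beta>2 w w')"
proof -
  interpret h1: heis n1 W1 R1 Q1 E1 \<beta>1 by fact
  interpret h2: heis n2 W2 R2 Q2 E2 \<beta>2 by fact
  show ?thesis
  proof
    show "equivp (rel_prod R1 R2)"
    proof (rule equivpI; (rule reflpI sympI transpI)?)
      show "rel_prod R1 R2 x x" for x
        using equivp_reflp[OF h1.R] equivp_reflp[OF h2.R] by (simp add: rel_prod_sel)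
      show "rel_prod R1 R2 y x" if "rel_prod R1 R2 x y" for x y
        using that equivp_symp[OF h1.R, of "fst x" "fst y"] equivp_symp[OF h2.R, of "snd x" "snd y"]
        by (simp add: rel_prod_sel)
      show "rel_prod R1 R2 x z" if "rel_prod R1 R2 x y" "rel_prod R1 R2 y z" for x y z
        using that equivp_transp[OF h1.R, of "fst x" "fst y" "fst z"]
          equivp_transp[OF h2.R, of "snd x" "snd y" "snd z"] by (simp add: rel_prod_sel)
    qed
    show "transversal (rel_prod R1 R2) (W1 \<times> W2) (Q1 \<times> Q2)"
      unfolding transversal_def
    proof (intro conjI ballI impI)
      show "\<exists>q\<in>Q1 \<times> Q2. rel_prod R1 R2 q h" if h: "h \<in> W1 \<times> W2" for h
      proof -
        obtain q1 q2 where "q1 \<in> Q1" "R1 q1 (fst h)" "q2 \<in> Q2" "R2 q2 (snd h)"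
          using h h1.Q_ex[of "fst h"] h2.Q_ex[of "snd h"] by (auto simp: mem_Times_iff)
        then show ?thesis by (intro bexI[of _ "(q1, q2)"]) (auto simp: rel_prod_sel)
      qed
      show "q = q'" if "q \<in> Q1 \<times> Q2" "q' \<in> Q1 \<times> Q2" "rel_prod R1 R2 q q'" for q q'
        using that h1.Q_unique[of "fst q" "fst q'"] h2.Q_unique[of "snd q" "snd q'"]
        by (simp add: rel_prod_sel prod_eq_iff mem_Times_iff)
      show "finite (Q1 \<times> Q2)" using h1.finQ h2.finQ by simp
      show "Q1 \<times> Q2 \<subseteq> W1 \<times> W2" using h1.QW h2.QW by blast
    qed
    show "rel_prod R1 R2 (a + c) (b + c)" if "rel_prod R1 R2 a b" for a b c
      using that by (simp add: rel_prod_sel h1.Radd h2.Radd)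
    show "(case v of (v, w) \<Rightarrow> ten n1 n2 (E1 v) (E2 w)) * (case w of (v, w) \<Rightarrow> ten n1 n2 (E1 v) (E2 w)) =
       sm ((case v of (v, w) \<Rightarrow> \<lambda>(v', w'). \<beta>1 v v' * \<beta>2 w w') w)
         (case v + w of (v, w) \<Rightarrow> ten n1 n2 (E1 v) (E2 w))"
      if "v \<in> W1 \<times> W2" "w \<in> W1 \<times> W2" for v w
      using that by (cases v; cases w) (simp add: ten_mult h1.Eblk h2.Eblk h1.Emult h2.Emult ten_sm)
    show "(case v of (v, w) \<Rightarrow> ten n1 n2 (E1 v) (E2 w)) = (case w of (v, w) \<Rightarrow> ten n1 n2 (E1 v) (E2 w))"
      if "v \<in> W1 \<times> W2" "w \<in> W1 \<times> W2" "rel_prod R1 R2 v w" for v w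
    proof (cases v; cases w)
      fix a b c d assume v: "v = (a, b)" and w: "w = (c, d)"
      have "E1 a = E1 c" using that v w by (intro h1.Eper) auto
      moreover have "E2 b = E2 d" using that v w by (intro h2.Eper) auto
      ultimately show ?thesis using v w by simp
    qed
    show "(case u of (v, w) \<Rightarrow> \<lambda>(v', w'). \<beta>1 v v' * \<beta>2 w w') w = (case v of (v, w) \<Rightarrow> \<lambda>(v', w'). \<beta>1 v v' * \<beta>2 w w') w"
      if "u \<in> W1 \<times> W2" "v \<in> W1 \<times> W2" "w \<in> W1 \<times> W2" "rel_prod R1 R2 u v" for u v w
    proof (cases u; cases v; cases w)
      fix a b c d x y assume v: "u = (a, b)" "v = (c, d)" "w = (x, y)"
      have "\<beta>1 a x = \<beta>1 c x" using that v by (intro h1.\<beta>per) auto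
      moreover have "\<beta>2 b y = \<beta>2 d y" using that v by (intro h2.\<beta>per) auto
      ultimately show ?thesis using v by simp
    qed
  next
    show "0 < n1 * n2" using h1.n h2.n by simp
    show "0 \<in> W1 \<times> W2" using h1.W0 h2.W0 by (simp add: zero_prod_def)
    show "(case 0 of (v, w) \<Rightarrow> ten n1 n2 (E1 v) (E2 w)) = idn (n1 * n2)"
      by (simp add: zero_prod_def h1.E0 h2.E0 ten_idn)
    show "v + w \<in> W1 \<times> W2" if "v \<in> W1 \<times> W2" "w \<in> W1 \<times> W2" for v w
      using that by (simp add: mem_Times_iff h1.Wadd h2.Wadd)
    show "- v \<in> W1 \<times> W2" if "v \<in> W1 \<times> W2" for v
      using that by (simp add: mem_Times_iff h1.Wminus h2.Wminus)
  qed (auto simp: ten_blk h1.\<beta>l h2.\<beta>l h1.\<beta>r h2.\<beta>r h1.\<beta>alt h2.\<beta>alt)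
qed

text \<open>A matrix index splits into quotient and remainder by \<open>n2\<close>, and the relation
  factorises accordingly.\<close>

lemma complete_tensor:
  assumes h: "heis n1 W1 R1 Q1 E1 \<beta>1" "heis n2 W2 R2 Q2 E2 \<beta>2"
    and c: "heis.complete n1 Q1 E1 \<kappa>1" "heis.complete n2 Q2 E2 \<kappa>2"
  shows "heis.complete (n1 * n2) (Q1 \<times> Q2) (\<lambda>(v, w). ten n1 n2 (E1 v) (E2 w)) (\<kappa>1 * \<kappa>2)"
  unfolding heis.complete_def[OF heis_tensor[OF h]]
proof (intro conjI allI impI)
  show "\<kappa>1 * \<kappa>2 \<noteq> 0" using c unfolding heis.complete_def[OF h(1)] heis.complete_def[OF h(2)] by simp
  fix a i j b assume ab: "a < n1 * n2" "i < n1 * n2" "j < n1 * n2" "b < n1 * n2"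
  have "(\<Sum>k\<in>Q1 \<times> Q2. ent (case k of (v, w) \<Rightarrow> ten n1 n2 (E1 v) (E2 w)) a i *
        ent (case - k of (v, w) \<Rightarrow> ten n1 n2 (E1 v) (E2 w)) j b) =
     (\<Sum>(v, w)\<in>Q1 \<times> Q2. (ent (E1 v) (a div n2) (i div n2) * ent (E1 (- v)) (j div n2) (b div n2)) *
        (ent (E2 w) (a mod n2) (i mod n2) * ent (E2 (- w)) (j mod n2) (b mod n2)))"
    using ab by (intro sum.cong refl) (auto simp: ent_ten)
  also have "\<dots> = (\<Sum>v\<in>Q1. ent (E1 v) (a div n2) (i div n2) * ent (E1 (- v)) (j div n2) (b div n2)) *
     (\<Sum>w\<in>Q2. ent (E2 w) (a mod n2) (i mod n2) * ent (E2 (- w)) (j mod n2) (b mod n2))"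
    by (simp add: sum_product sum.cartesian_product)
  also have "\<dots> = (if i div n2 = j div n2 \<and> a div n2 = b div n2 then \<kappa>1 else 0) *
      (if i mod n2 = j mod n2 \<and> a mod n2 = b mod n2 then \<kappa>2 else 0)"
    using c ab div_mod_less unfolding heis.complete_def[OF h(1)] heis.complete_def[OF h(2)] by simp
  also have "\<dots> = (if i = j \<and> a = b then \<kappa>1 * \<kappa>2 else 0)"
  proof -
    have *: "x div n2 = y div n2 \<Longrightarrow> x mod n2 = y mod n2 \<Longrightarrow> x = y" for x y
      by (metis div_mult_mod_eq)
    show ?thesis using *[of i j] *[of a b] by (cases "i = j"; cases "a = b") auto
  qed
  finally show "(\<Sum>k\<in>Q1 \<times> Q2. ent (case k of (v, w) \<Rightarrow> ten n1 n2 (E1 v) (E2 w)) a i *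
        ent (case - k of (v, w) \<Rightarrow> ten n1 n2 (E1 v) (E2 w)) j b) = (if i = j \<and> a = b then \<kappa>1 * \<kappa>2 else 0)" .
qed

section \<open>Arithmetic of the ring and of its matrices\<close>

locale odd_dvr =
  fixes \<pi> :: "'a::idom"
  assumes O: "complete_dvr_finite_odd_residue \<pi>"
begin

lemma pi_nz: "\<pi> \<noteq> 0" and pi_nunit: "\<not> \<pi> dvd 1"
  and decomp: "x \<noteq> 0 \<Longrightarrow> \<exists>u n. u dvd 1 \<and> x = u * \<pi> ^ n"
  and pi_2: "\<not> \<pi> dvd 2"
  using O by (auto simp: complete_dvr_finite_odd_residue_def dvr_with_uniformizer_def)

lemma unit_iff: "x dvd 1 \<longleftrightarrow> \<not> \<pi> dvd x"
proof
  assume "x dvd 1" then show "\<not> \<pi> dvd x" using pi_nunit dvd_trans by blast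
next
  assume x: "\<not> \<pi> dvd x"
  then have "x \<noteq> 0" by auto
  then obtain u n where un: "u dvd 1" "x = u * \<pi> ^ n" using decomp by blast
  then have "n = 0" using x by (cases n) auto
  then show "x dvd 1" using un by simp
qed

lemma unit_ex: "\<not> \<pi> dvd x \<Longrightarrow> \<exists>y. x * y = 1"
  using unit_iff[of x] by (metis dvdE)

lemma pi_prime: "\<pi> dvd x * y \<Longrightarrow> \<pi> dvd x \<or> \<pi> dvd y"
  using unit_iff[of x] unit_iff[of y] unit_iff[of "x * y"] by (metis mult_dvd_mono mult_1)

lemma pow_nz: "\<pi> ^ k \<noteq> 0"
  using pi_nz by simp

lemma pow_dvd_unit_mult:
  assumes "\<not> \<pi> dvd u" "\<pi> ^ k dvd u * x" shows "\<pi> ^ k dvd x"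
proof -
  obtain v where "u * v = 1" using unit_ex[OF assms(1)] by blast
  then have "x = u * x * v" by (metis mult.assoc mult.commute mult_1)
  then show ?thesis using assms(2) by (metis dvd_mult2)
qed

lemma pow_dvd_cancel: "\<pi> ^ (a + b) dvd \<pi> ^ a * x \<longleftrightarrow> \<pi> ^ b dvd x"
  using pi_nz by (simp add: power_add)

lemma separated: assumes "\<And>n. \<pi> ^ n dvd x" shows "x = 0"
proof (rule ccontr)
  assume "x \<noteq> 0"
  then obtain u n where un: "u dvd 1" "x = u * \<pi> ^ n" using decomp by blast
  have "\<pi> ^ (n + 1) dvd \<pi> ^ n * u" using assms[of "n + 1"] un by (simp add: mult.commute)
  then show False using un unit_iff by (simp only: pow_dvd_cancel) simp
qed

definition hf :: 'a where "hf = (SOME h. 2 * h = 1)"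

lemma hf2: "2 * hf = 1"
  unfolding hf_def by (rule someI_ex) (rule unit_ex[OF pi_2])

lemma hf_add: "hf * x + hf * x = x"
  by (metis hf2 distrib_right mult.assoc mult_1 mult_2)

lemma two_nz: "(2::'a) \<noteq> 0" using pi_2 by auto

lemma double_eq_0: "(x::'a) + x = 0 \<longleftrightarrow> x = 0"
  using two_nz by (simp add: mult_2[symmetric])

text \<open>Digit expansion: a residue system modulo \<open>\<pi> ^ k\<close> is refined by adding
  \<open>\<pi> ^ k\<close> times representatives of the residue field.\<close>

lemma finite_residues: "\<exists>F. finite F \<and> (\<forall>x. \<exists>y\<in>F. \<pi> ^ k dvd x - y)"
proof (induction k)
  case 0
  show ?case by (rule exI[of _ "{0}"]) simp
next
  case (Suc k)
  then obtain F where F: "finite F" "\<And>x. \<exists>y\<in>F. \<pi> ^ k dvd x - y" by blast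
  have fin: "finite (residue_field \<pi>)"
    using O by (simp add: complete_dvr_finite_odd_residue_def)
  define c where "c S = (SOME x. x \<in> S)" for S :: "'a set"
  define F' where "F' = (\<lambda>(y, S). y + \<pi> ^ k * c S) ` (F \<times> residue_field \<pi>)"
  have "\<exists>y\<in>F'. \<pi> ^ Suc k dvd x - y" for x
  proof -
    obtain y t where y: "y \<in> F" "x - y = \<pi> ^ k * t" using F(2)[of x] by (meson dvdE)
    define S where "S = {z. \<pi> dvd z - t}"
    have "S \<in> residue_field \<pi>" by (auto simp: residue_field_def S_def)
    moreover have "c S \<in> S" unfolding c_def by (rule someI[of _ t]) (simp add: S_def)
    then have "\<pi> dvd t - c S" unfolding S_def by (metis dvd_minus_iff minus_diff_eq mem_Collect_eq)
    then have "\<pi> ^ Suc k dvd \<pi> ^ k * (t - c S)" by (metis mult_dvd_mono dvd_refl power_Suc2)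
    moreover have "x - (y + \<pi> ^ k * c S) = \<pi> ^ k * (t - c S)" using y(2) by (simp add: algebra_simps)
    ultimately show ?thesis unfolding F'_def using y(1) by (intro bexI[of _ "y + \<pi> ^ k * c S"]) (auto intro!: image_eqI[of _ _ "(y, S)"])
  qed
  then show ?case using F(1) fin by (intro exI[of _ F']) (auto simp: F'_def)
qed

lemma hensel_step:
  assumes "\<not> \<pi> dvd u" "\<pi> ^ Suc n dvd z * z - u"
  shows "\<exists>z'. \<pi> ^ Suc (Suc n) dvd z' * z' - u \<and> \<pi> ^ Suc n dvd z' - z"
proof -
  have "\<not> \<pi> dvd z"
  proof
    assume "\<pi> dvd z"
    moreover have "\<pi> dvd z * z - u" using assms(2) by (metis dvd_mult_left power_Suc)
    ultimately have "\<pi> dvd z * z - (z * z - u)" by (metis dvd_diff dvd_mult)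
    then show False using assms(1) by simp
  qed
  then have "\<not> \<pi> dvd 2 * z" using pi_prime pi_2 by blast
  then obtain w where w: "2 * z * w = 1" using unit_ex by blast
  define d where "d = z * z - u"
  \<comment> \<open>Newton's step for \<open>z * z - u\<close>: as \<open>w\<close> inverts
    \<open>2 * z\<close>, the linear error cancels and \<open>d * d * (w * w)\<close>
    remains.\<close>
  define z' where "z' = z - d * w"
  have "z' * z' - u = d - d * (2 * z * w) + d * d * (w * w)"
    unfolding z'_def d_def by (simp add: algebra_simps)
  then have e: "z' * z' - u = d * d * (w * w)" using w by simp
  have "\<pi> ^ Suc (Suc n) dvd \<pi> ^ Suc n * \<pi> ^ Suc n"
    by (metis le_add2 le_imp_power_dvd power_add add_Suc add_Suc_shift)
  also have "\<dots> dvd d * d" using assms(2) unfolding d_def by (rule mult_dvd_mono[OF _ assms(2)])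
  finally have "\<pi> ^ Suc (Suc n) dvd z' * z' - u" unfolding e by (rule dvd_mult2)
  moreover have "\<pi> ^ Suc n dvd z' - z" unfolding z'_def using assms(2) d_def by simp
  ultimately show ?thesis by blast
qed

lemma hensel:
  assumes "\<not> \<pi> dvd u" "\<pi> dvd y * y - u"
  shows "\<exists>z. z * z = u"
proof -
  have "\<exists>f. \<forall>n. \<pi> ^ Suc n dvd f n * f n - u \<and> \<pi> ^ Suc n dvd f (Suc n) - f n"
    by (rule dependent_nat_choice[where P = "\<lambda>n z. \<pi> ^ Suc n dvd z * z - u"
          and Q = "\<lambda>n z z'. \<pi> ^ Suc n dvd z' - z"])
      (use assms hensel_step in auto)
  then obtain f where f: "\<And>n. \<pi> ^ Suc n dvd f n * f n - u" "\<And>n. \<pi> ^ Suc n dvd f (Suc n) - f n"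
    by blast
  \<comment> \<open>Consecutive approximations agree modulo \<open>\<pi> ^ Suc n\<close>, one power
    more than completeness asks for.\<close>
  have "\<pi> ^ n dvd f (Suc n) - f n" for n
    using f(2)[of n] by (metis dvd_mult_right power_Suc)
  then obtain x where x: "\<And>n. \<pi> ^ n dvd x - f n"
    using O unfolding complete_dvr_finite_odd_residue_def pi_adically_complete_def by blast
  have "\<pi> ^ n dvd x * x - u" for n
  proof -
    have "\<pi> ^ n dvd f n * f n - u" using f(1)[of n] by (metis dvd_mult_right power_Suc)
    moreover have "\<pi> ^ n dvd (x - f n) * (x + f n)" using x[of n] by (rule dvd_mult2)
    ultimately have "\<pi> ^ n dvd (x - f n) * (x + f n) + (f n * f n - u)" by (rule dvd_add[rotated])
    then show ?thesis by (simp add: algebra_simps)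
  qed
  then have "x * x - u = 0" by (rule separated)
  then show ?thesis by auto
qed

end

section \<open>The ring of 2 by 2 matrices with its adjoint and its congruences\<close>

instantiation m2 :: (comm_ring_1) ab_group_add
begin

definition "0 = (mzero :: 'a m2)"
definition "A + B = (madd A B :: 'a m2)"
definition "- A = (msmul (- 1) A :: 'a m2)"
definition "A - B = (madd A (msmul (- 1) B) :: 'a m2)"

instance
  by standard (auto simp: zero_m2_def plus_m2_def uminus_m2_def minus_m2_def madd_def msmul_def
      mzero_def qadd_def qsmul_def algebra_simps intro!: m2.expand)

end

lemmas m2_defs = plus_m2_def minus_m2_def uminus_m2_def zero_m2_def madd_def msmul_def mzero_def mI_def
  mmul_def mtr_def mstar_def qadd_def qsmul_def qmul_def qconj_def

lemma m2_eqI: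
  assumes "fst (e11 A) = fst (e11 B)" "snd (e11 A) = snd (e11 B)" "fst (e12 A) = fst (e12 B)" "snd (e12 A) = snd (e12 B)"
    "fst (e21 A) = fst (e21 B)" "snd (e21 A) = snd (e21 B)" "fst (e22 A) = fst (e22 B)" "snd (e22 A) = snd (e22 B)"
  shows "A = B"
  using assms by (intro m2.expand) (auto intro: prod_eqI)

lemma mm_assoc: "mmul \<delta> (mmul \<delta> A B) C = mmul \<delta> A (mmul \<delta> B C)"
  by (rule m2_eqI) (simp_all add: m2_defs algebra_simps)

lemma mm_add_left: "mmul \<delta> (A + B) C = mmul \<delta> A C + mmul \<delta> B C"
  and mm_add_right: "mmul \<delta> A (B + C) = mmul \<delta> A B + mmul \<delta> A C"
  and mm_diff_left: "mmul \<delta> (A - B) C = mmul \<delta> A C - mmul \<delta> B C"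
  and mm_diff_right: "mmul \<delta> A (B - C) = mmul \<delta> A B - mmul \<delta> A C"
  and mm_minus_left: "mmul \<delta> (- A) B = - mmul \<delta> A B"
  and mm_minus_right: "mmul \<delta> A (- B) = - mmul \<delta> A B"
  by (rule m2_eqI; simp add: m2_defs algebra_simps)+

lemma mm_one_left [simp]: "mmul \<delta> mI A = A"
  and mm_one_right [simp]: "mmul \<delta> A mI = A"
  and mm_zero_left [simp]: "mmul \<delta> 0 A = 0"
  and mm_zero_right [simp]: "mmul \<delta> A 0 = 0"
  by (rule m2_eqI; simp add: m2_defs algebra_simps)+

lemma msmul_mult_left: "mmul \<delta> (msmul c A) B = msmul c (mmul \<delta> A B)"
  and msmul_mult_right: "mmul \<delta> A (msmul c B) = msmul c (mmul \<delta> A B)"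
  and msmul_add: "msmul c (A + B) = msmul c A + msmul c B"
  and msmul_diff: "msmul c (A - B) = msmul c A - msmul c B"
  and msmul_minus: "msmul c (- A) = - msmul c A"
  and msmul_minus_left: "msmul (- c) A = - msmul c A"
  and msmul_add_left: "msmul (c + d) A = msmul c A + msmul d A"
  and msmul_diff_left: "msmul (c - d) A = msmul c A - msmul d A"
  and msmul_msmul [simp]: "msmul c (msmul d A) = msmul (c * d) A"
  and msmul_1 [simp]: "msmul 1 A = A"
  and msmul_0 [simp]: "msmul 0 A = 0"
  and msmul_zero [simp]: "msmul c 0 = 0"
  by (rule m2_eqI; simp add: m2_defs algebra_simps)+

lemmas mm_ring = mm_add_left mm_add_right mm_diff_left mm_diff_right mm_minus_left mm_minus_right
  msmul_mult_left msmul_mult_right msmul_add msmul_diff msmul_minus mm_assoc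

lemma mstar_add: "mstar (A + B) = mstar A + mstar B"
  and mstar_diff: "mstar (A - B) = mstar A - mstar B"
  and mstar_minus: "mstar (- A) = - mstar A"
  and mstar_msmul: "mstar (msmul c A) = msmul c (mstar A)"
  and mstar_mult: "mstar (mmul \<delta> A B) = mmul \<delta> (mstar B) (mstar A)"
  and mstar_mstar [simp]: "mstar (mstar A) = A"
  and mstar_mI [simp]: "mstar mI = mI"
  and mstar_0 [simp]: "mstar 0 = 0"
  by (rule m2_eqI; simp add: m2_defs algebra_simps)+

lemma mtr_add: "mtr (A + B) = mtr A + mtr B"
  and mtr_diff: "mtr (A - B) = mtr A - mtr B"
  and mtr_minus: "mtr (- A) = - mtr A"
  and mtr_msmul: "mtr (msmul c A) = qsmul c (mtr A)"
  and mtr_comm: "mtr (mmul \<delta> A B) = mtr (mmul \<delta> B A)"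
  and mtr_0 [simp]: "mtr 0 = 0"
  and mtr_mI: "mtr mI = (2, 0)"
  and mtr_mstar: "mtr (mstar A) = qconj (mtr A)"
  by (rule prod_eqI; simp add: m2_defs algebra_simps)+

text \<open>Scalars from the extension, in contrast to \<open>msmul\<close>, whose scalars come from
  the base ring; both are central.\<close>

definition qsc :: "'a::comm_ring_1 qe \<Rightarrow> 'a m2" where
  "qsc x = M2 x (0, 0) (0, 0) x"

lemma qsc_comm: "mmul \<delta> (qsc x) A = mmul \<delta> A (qsc x)"
  and qsc_mult: "mmul \<delta> (qsc x) (qsc y) = qsc (qmul \<delta> x y)"
  and qsc_add: "qsc x + qsc y = qsc (x + y)"
  and qsc_diff: "qsc x - qsc y = qsc (x - y)"
  and qsc_minus: "- qsc x = qsc (- x)"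
  and qsc_msmul: "msmul c (qsc x) = qsc (qsmul c x)"
  and qsc_mstar: "mstar (qsc x) = qsc (qconj x)"
  and qsc_1: "qsc (1, 0) = mI"
  and qsc_0: "qsc 0 = 0"
  by (rule m2_eqI; simp add: m2_defs qsc_def algebra_simps)+

lemma qsc_c: "qsc (c, 0) = msmul c mI"
  by (rule m2_eqI; simp add: m2_defs qsc_def)

lemma mcong_iff_dvd:
  "mcong \<pi> k A B \<longleftrightarrow> (\<pi> ^ k dvd fst (e11 (A - B)) \<and> \<pi> ^ k dvd snd (e11 (A - B))) \<and>
     (\<pi> ^ k dvd fst (e12 (A - B)) \<and> \<pi> ^ k dvd snd (e12 (A - B))) \<and>
     (\<pi> ^ k dvd fst (e21 (A - B)) \<and> \<pi> ^ k dvd snd (e21 (A - B))) \<and>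
     (\<pi> ^ k dvd fst (e22 (A - B)) \<and> \<pi> ^ k dvd snd (e22 (A - B)))"
  by (simp add: mcong_def qcong_def m2_defs)

lemma mcong_diff: "mcong \<pi> k A B \<longleftrightarrow> mcong \<pi> k (A - B) 0"
  by (simp add: mcong_iff_dvd)

lemma mcong_0_iff: "mcong \<pi> k A 0 \<longleftrightarrow> (\<exists>C. A = msmul (\<pi> ^ k) C)"
proof
  assume "mcong \<pi> k A 0"
  then have "\<pi> ^ k dvd fst (e11 A)" "\<pi> ^ k dvd snd (e11 A)" "\<pi> ^ k dvd fst (e12 A)" "\<pi> ^ k dvd snd (e12 A)"
     "\<pi> ^ k dvd fst (e21 A)" "\<pi> ^ k dvd snd (e21 A)" "\<pi> ^ k dvd fst (e22 A)" "\<pi> ^ k dvd snd (e22 A)"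
    by (simp_all add: mcong_iff_dvd)
  then obtain a b c d e f g h where
    "fst (e11 A) = \<pi> ^ k * a" "snd (e11 A) = \<pi> ^ k * b" "fst (e12 A) = \<pi> ^ k * c" "snd (e12 A) = \<pi> ^ k * d"
     "fst (e21 A) = \<pi> ^ k * e" "snd (e21 A) = \<pi> ^ k * f" "fst (e22 A) = \<pi> ^ k * g" "snd (e22 A) = \<pi> ^ k * h"
    unfolding dvd_def by blast
  then have "A = msmul (\<pi> ^ k) (M2 (a, b) (c, d) (e, f) (g, h))"
    by (intro m2_eqI) (simp_all add: m2_defs)
  then show "\<exists>C. A = msmul (\<pi> ^ k) C" by blast
qed (auto simp: mcong_iff_dvd m2_defs)

lemma mcong_iff: "mcong \<pi> k A B \<longleftrightarrow> (\<exists>C. A = B + msmul (\<pi> ^ k) C)"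
  unfolding mcong_diff[of \<pi> k A B] mcong_0_iff by (metis add_diff_cancel_left' diff_add_cancel add.commute)

lemma mcong_refl [simp]: "mcong \<pi> k A A"
  by (simp add: mcong_iff_dvd m2_defs)

lemma mcong_sym: "mcong \<pi> k A B \<Longrightarrow> mcong \<pi> k B A"
  unfolding mcong_iff by (metis add_diff_cancel_right' diff_conv_add_uminus msmul_minus)

lemma mcong_trans: "mcong \<pi> k A B \<Longrightarrow> mcong \<pi> k B C \<Longrightarrow> mcong \<pi> k A C"
  unfolding mcong_iff by (metis add.assoc msmul_add)

lemma mcong_equivp: "equivp (mcong \<pi> k)"
  by (rule equivpI) (auto intro: reflpI sympI transpI mcong_sym mcong_trans)

lemma mcong_add: "mcong \<pi> k A B \<Longrightarrow> mcong \<pi> k C D \<Longrightarrow> mcong \<pi> k (A + C) (B + D)"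
  unfolding mcong_diff[of \<pi> k A B] mcong_diff[of \<pi> k C D] mcong_diff[of \<pi> k "A + C" "B + D"] mcong_0_iff
  by (metis add_diff_add msmul_add)

lemma mcong_minus: "mcong \<pi> k A B \<Longrightarrow> mcong \<pi> k (- A) (- B)"
  unfolding mcong_iff by (metis minus_add_distrib msmul_minus)

lemma mcong_sub: "mcong \<pi> k A B \<Longrightarrow> mcong \<pi> k C D \<Longrightarrow> mcong \<pi> k (A - C) (B - D)"
  using mcong_add[of \<pi> k A B "- C" "- D"] mcong_minus by fastforce

lemma mcong_msmul: "mcong \<pi> k A B \<Longrightarrow> mcong \<pi> k (msmul c A) (msmul c B)"
  unfolding mcong_iff by (metis msmul_add msmul_msmul mult.commute)

lemma mcong_mult_left: "mcong \<pi> k A B \<Longrightarrow> mcong \<pi> k (mmul \<delta> C A) (mmul \<delta> C B)"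
  unfolding mcong_iff by (metis mm_add_right msmul_mult_right)

lemma mcong_mult_right: "mcong \<pi> k A B \<Longrightarrow> mcong \<pi> k (mmul \<delta> A C) (mmul \<delta> B C)"
  unfolding mcong_iff by (metis mm_add_left msmul_mult_left)

lemma mcong_mult: "mcong \<pi> k A B \<Longrightarrow> mcong \<pi> k C D \<Longrightarrow> mcong \<pi> k (mmul \<delta> A C) (mmul \<delta> B D)"
  by (rule mcong_trans[OF mcong_mult_right mcong_mult_left])

lemma mcong_star: "mcong \<pi> k A B \<Longrightarrow> mcong \<pi> k (mstar A) (mstar B)"
  unfolding mcong_iff by (metis mstar_add mstar_msmul)

lemma mcong_mono: "mcong \<pi> k A B \<Longrightarrow> j \<le> k \<Longrightarrow> mcong \<pi> j A B"
  unfolding mcong_iff by (metis le_add_diff_inverse msmul_msmul power_add)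

lemma mcong_scaled: "mcong \<pi> k A B \<Longrightarrow> mcong \<pi> (j + k) (msmul (\<pi> ^ j) A) (msmul (\<pi> ^ j) B)"
  unfolding mcong_iff by (metis msmul_add msmul_msmul power_add)

lemma mcong_pow_0: "k \<le> j \<Longrightarrow> mcong \<pi> k (msmul (\<pi> ^ j) A) 0"
  unfolding mcong_0_iff by (metis le_add_diff_inverse msmul_msmul power_add)

lemma mcong_pow_0': "k \<le> j \<Longrightarrow> mcong \<pi> k (msmul (c * \<pi> ^ j) A) 0"
  using mcong_msmul[OF mcong_pow_0, where c = c] by fastforce

lemma qsmul_mult_eq: "qsmul c (qsmul d x) = qsmul (c * d) x"
  by (simp add: qsmul_def mult.assoc)

lemma inM_0 [simp]: "inM G 0" and inM_mI [simp]: "inM G mI"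
  and inM_add: "inM G A \<Longrightarrow> inM G B \<Longrightarrow> inM G (A + B)"
  and inM_diff: "inM G A \<Longrightarrow> inM G B \<Longrightarrow> inM G (A - B)"
  and inM_minus: "inM G A \<Longrightarrow> inM G (- A)"
  and inM_mult: "inM G A \<Longrightarrow> inM G B \<Longrightarrow> inM G (mmul \<delta> A B)"
  and inM_msmul: "inM G A \<Longrightarrow> inM G (msmul c A)"
  and inM_star: "inM G A \<Longrightarrow> inM G (mstar A)"
  and inM_qsc: "inR G x \<Longrightarrow> inM G (qsc x)"
  by (auto simp: inM_def inR_def m2_defs qsc_def)

lemmas inM_intros = inM_0 inM_mI inM_add inM_diff inM_minus inM_mult inM_msmul inM_star inM_qsc

context odd_dvr
begin

lemma msmul_pow_cancel: "msmul (\<pi> ^ k) A = msmul (\<pi> ^ k) B \<longleftrightarrow> A = B"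
  using pow_nz[of k] by (auto simp: m2_defs intro!: m2_eqI)

lemma mcong_scaled_iff: "mcong \<pi> (j + k) (msmul (\<pi> ^ j) A) (msmul (\<pi> ^ j) B) \<longleftrightarrow> mcong \<pi> k A B"
proof
  assume "mcong \<pi> (j + k) (msmul (\<pi> ^ j) A) (msmul (\<pi> ^ j) B)"
  then obtain C where "msmul (\<pi> ^ j) A = msmul (\<pi> ^ j) (B + msmul (\<pi> ^ k) C)"
    unfolding mcong_iff by (auto simp: msmul_add power_add)
  then show "mcong \<pi> k A B" unfolding msmul_pow_cancel mcong_iff by blast
qed (rule mcong_scaled)

lemma mcong_iff_inM:
  assumes "inM G A" "inM G B" "mcong \<pi> k A B"
  shows "\<exists>C. inM G C \<and> A = B + msmul (\<pi> ^ k) C"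
proof -
  obtain C where C: "A = B + msmul (\<pi> ^ k) C" using assms(3) mcong_iff by blast
  have "inM G C"
    using assms(1,2) pow_nz[of k] unfolding C by (auto simp: inM_def inR_def m2_defs)
  then show ?thesis using C by blast
qed

lemma mcong_unit_cancel:
  assumes "\<not> \<pi> dvd u" "mcong \<pi> k (msmul u A) (msmul u B)"
  shows "mcong \<pi> k A B"
proof -
  obtain v where "u * v = 1" using unit_ex[OF assms(1)] by blast
  then show ?thesis using mcong_msmul[OF assms(2), of v] by (simp add: mult.commute)
qed

end

section \<open>The groups and the stabilizers\<close>

locale setting = odd_dvr \<pi> for \<pi> :: "'a::idom" +
  fixes \<delta> :: 'a and \<psi> :: "'a \<Rightarrow> complex" and G :: gtype and l :: nat
  assumes theta: "\<delta> dvd 1" "\<not> (\<exists>y. y * y = \<delta>)"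
    and psi_add: "\<And>x y. \<psi> (x + y) = \<psi> x * \<psi> y"
    and psi_unit: "\<And>x. norm (\<psi> x) = 1"
    and psi_level: "\<And>z. \<psi> (\<pi> ^ l * z) = 1"
    and psi_nontriv: "\<exists>z. \<psi> (\<pi> ^ (l - 1) * z) \<noteq> 1"
    and l: "l \<ge> 2"
begin

abbreviation mm :: "'a m2 \<Rightarrow> 'a m2 \<Rightarrow> 'a m2" (infixl "\<star>" 70) where
  "A \<star> B \<equiv> mmul \<delta> A B"

abbreviation r :: nat where "r \<equiv> l div 2"
abbreviation l2 :: nat where "l2 \<equiv> l - l div 2"
abbreviation cg :: "nat \<Rightarrow> 'a m2 \<Rightarrow> 'a m2 \<Rightarrow> bool" where "cg \<equiv> mcong \<pi>"
abbreviation Gl :: "'a m2 set" where "Gl \<equiv> Gset G \<delta> \<pi> l"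

lemma r1: "1 \<le> r" and rl: "r \<le> l2" and l2r: "l2 + r = l" and l2l: "l2 + l2 \<ge> l" "l2 \<le> l" "r \<le> l"
  using l by auto

lemma delta_unit: "\<not> \<pi> dvd \<delta>"
  using theta unit_iff by blast

text \<open>By Hensel, a unit that is a square modulo \<pi> is a square.\<close>

lemma delta_nonsquare: "\<not> \<pi> dvd y * y - \<delta>"
  using hensel[OF delta_unit] theta(2) by blast

lemma psi_0: "\<psi> 0 = 1"
proof -
  have "\<psi> 0 * \<psi> 0 = \<psi> 0" using psi_add[of 0 0] by simp
  moreover have "\<psi> 0 \<noteq> 0" using psi_unit[of 0] by auto
  ultimately show ?thesis by simp
qed

lemma psi_dvd: "\<pi> ^ l dvd x \<Longrightarrow> \<psi> x = 1"
  using psi_level by (auto elim!: dvdE)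

lemma psi_cong: assumes "\<pi> ^ l dvd x - y" shows "\<psi> x = \<psi> y"
  using psi_add[of "x - y" y] psi_dvd[OF assms] by simp

lemma psi_minus: "\<psi> x * \<psi> (- x) = 1"
  using psi_add[of x "- x"] psi_0 by simp

text \<open>If \<open>u\<close> had valuation \<open>j < l - m\<close>, the multiples of
  \<open>\<pi> ^ m * u\<close> would include those of \<open>\<pi> ^ (l - 1)\<close>, where \<psi>
  is nontrivial.\<close>

lemma psi_nondeg:
  assumes "m \<le> l" "\<And>z. \<psi> (\<pi> ^ m * (u * z)) = 1"
  shows "\<pi> ^ (l - m) dvd u"
proof (rule ccontr)
  assume nd: "\<not> \<pi> ^ (l - m) dvd u"
  then have "u \<noteq> 0" by auto
  then obtain v j where v: "v dvd 1" "u = v * \<pi> ^ j" using decomp by blast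
  then obtain w where w: "v * w = 1" by (metis dvdE)
  have "\<not> l - m \<le> j" using nd v(2) le_imp_power_dvd[of "l - m" j \<pi>] by auto
  then have e: "l - 1 = m + (j + (l - 1 - m - j))" by simp
  have "\<psi> (\<pi> ^ (l - 1) * z) = 1" for z
  proof -
    have "\<pi> ^ (l - 1) * z = \<pi> ^ m * (u * (w * \<pi> ^ (l - 1 - m - j) * z)) "
      unfolding v(2) by (subst e) (use w in \<open>simp add: power_add mult_ac\<close>)
    then show ?thesis using assms(2)[of "w * \<pi> ^ (l - 1 - m - j) * z"] by argo
  qed
  then show False using psi_nontriv by blast
qed

lemma bigpsi_add: "bigpsi \<psi> (p + q) = bigpsi \<psi> p * bigpsi \<psi> q"
  by (simp add: bigpsi_def psi_add)

lemma bigpsi_real: "bigpsi \<psi> (x, 0) = \<psi> x"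
  by (simp add: bigpsi_def psi_0)

lemma bigpsi_cong: "qcong \<pi> l p q \<Longrightarrow> bigpsi \<psi> p = bigpsi \<psi> q"
  unfolding qcong_def bigpsi_def using psi_cong by metis

lemma mcong_mtr: "cg k A B \<Longrightarrow> qcong \<pi> k (mtr A) (mtr B)"
  unfolding mcong_iff qcong_def by (auto simp: m2_defs)

lemma qcong_scaled: "qcong \<pi> k p q \<Longrightarrow> qcong \<pi> (j + k) (qsmul (\<pi> ^ j) p) (qsmul (\<pi> ^ j) q)"
  unfolding qcong_def qsmul_def by (simp add: power_add right_diff_distrib[symmetric] mult_dvd_mono)

lemma bigpsi_scaled:
  "qcong \<pi> r p q \<Longrightarrow> bigpsi \<psi> (qsmul (\<pi> ^ l2) p) = bigpsi \<psi> (qsmul (\<pi> ^ l2) q)"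
  using bigpsi_cong qcong_scaled[of r p q l2] unfolding l2r by blast

text \<open>Since \<open>l2 + r = l\<close>, the matrix \<open>B\<close> is determined by
  \<open>x\<close> modulo \<open>\<pi> ^ r\<close>, and the value depends on nothing finer; so any
  witness may replace the one picked by \<open>SOME\<close>.\<close>

lemma psiA_eq:
  assumes "inM G B" "cg l x (mI + msmul (\<pi> ^ l2) B)"
  shows "psiA G \<delta> \<pi> \<psi> l A x = bigpsi \<psi> (qsmul (\<pi> ^ l2) (mtr (A \<star> B)))"
proof -
  define B' where "B' = (SOME B. inM G B \<and> cg l x (madd mI (msmul (\<pi> ^ l2) B)))"
  have "inM G B' \<and> cg l x (madd mI (msmul (\<pi> ^ l2) B'))"
    unfolding B'_def by (rule someI[of _ B]) (use assms in \<open>simp add: plus_m2_def\<close>)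
  then have "cg l x (mI + msmul (\<pi> ^ l2) B')" by (simp add: plus_m2_def)
  then have "cg l (mI + msmul (\<pi> ^ l2) B' - mI) (mI + msmul (\<pi> ^ l2) B - mI)"
    by (rule mcong_sub[OF mcong_trans[OF mcong_sym assms(2)] mcong_refl])
  then have "cg (l2 + r) (msmul (\<pi> ^ l2) B') (msmul (\<pi> ^ l2) B)" using l2r by simp
  then have "cg r B' B" by (simp only: mcong_scaled_iff)
  then have "qcong \<pi> r (mtr (A \<star> B')) (mtr (A \<star> B))" by (intro mcong_mtr mcong_mult_left)
  then have "bigpsi \<psi> (qsmul (\<pi> ^ l2) (mtr (A \<star> B'))) = bigpsi \<psi> (qsmul (\<pi> ^ l2) (mtr (A \<star> B)))"
    by (rule bigpsi_scaled)
  then show ?thesis unfolding psiA_def Let_def B'_def[symmetric] .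
qed

lemma psiA_cong:
  assumes "cg r A A'" "x \<in> Kset G \<delta> \<pi> l l2"
  shows "psiA G \<delta> \<pi> \<psi> l A x = psiA G \<delta> \<pi> \<psi> l A' x"
proof -
  obtain B where B: "inM G B" "cg l x (mI + msmul (\<pi> ^ l2) B)"
    using assms(2) by (auto simp: Kset_def plus_m2_def)
  have "qcong \<pi> r (mtr (A \<star> B)) (mtr (A' \<star> B))" by (intro mcong_mtr mcong_mult_right assms)
  then show ?thesis unfolding psiA_eq[OF B] by (rule bigpsi_scaled)
qed

lemma GsetI:
  assumes "inM G A" "inM G B" "cg k (A \<star> B) mI" "cg k (B \<star> A) mI" "G = GU \<Longrightarrow> cg k (mstar A \<star> A) mI"
  shows "A \<in> Gset G \<delta> \<pi> k"
  using assms by (auto simp: Gset_def)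

lemma GsetD:
  assumes "A \<in> Gset G \<delta> \<pi> k"
  shows "inM G A" "G = GU \<Longrightarrow> cg k (mstar A \<star> A) mI"
    "inM G (minv G \<delta> \<pi> k A)" "cg k (A \<star> minv G \<delta> \<pi> k A) mI" "cg k (minv G \<delta> \<pi> k A \<star> A) mI"
proof -
  show "inM G A" "G = GU \<Longrightarrow> cg k (mstar A \<star> A) mI" using assms by (auto simp: Gset_def)
  have "\<exists>B. inM G B \<and> cg k (A \<star> B) mI \<and> cg k (B \<star> A) mI" using assms by (auto simp: Gset_def)
  then have "inM G (minv G \<delta> \<pi> k A) \<and> cg k (A \<star> minv G \<delta> \<pi> k A) mI \<and> cg k (minv G \<delta> \<pi> k A \<star> A) mI"
    unfolding minv_def by (rule someI_ex)
  then show "inM G (minv G \<delta> \<pi> k A)" "cg k (A \<star> minv G \<delta> \<pi> k A) mI" "cg k (minv G \<delta> \<pi> k A \<star> A) mI"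
    by auto
qed

lemma mcong_middle: assumes "cg k (B \<star> C) mI" shows "cg k (A \<star> B \<star> (C \<star> D)) (A \<star> D)"
proof -
  have "cg k (A \<star> (B \<star> C) \<star> D) (A \<star> mI \<star> D)" by (intro mcong_mult_left mcong_mult_right assms)
  then show ?thesis by (simp add: mm_assoc)
qed

lemma Gset_mult:
  assumes "A \<in> Gset G \<delta> \<pi> k" "B \<in> Gset G \<delta> \<pi> k"
  shows "A \<star> B \<in> Gset G \<delta> \<pi> k"
proof (rule GsetI)
  let ?A = "minv G \<delta> \<pi> k A" let ?B = "minv G \<delta> \<pi> k B"
  note a = GsetD[OF assms(1)] and b = GsetD[OF assms(2)]
  show "inM G (A \<star> B)" "inM G (?B \<star> ?A)" using a b by (auto intro: inM_mult)
  show "cg k (A \<star> B \<star> (?B \<star> ?A)) mI" using mcong_trans[OF mcong_middle[OF b(4)] a(4)] .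
  show "cg k (?B \<star> ?A \<star> (A \<star> B)) mI" using mcong_trans[OF mcong_middle[OF a(5)] b(5)] .
  show "cg k (mstar (A \<star> B) \<star> (A \<star> B)) mI" if "G = GU"
    unfolding mstar_mult using mcong_trans[OF mcong_middle[OF a(2)[OF that]] b(2)[OF that]] .
qed

lemma Gset_one: "mI \<in> Gset G \<delta> \<pi> k"
  by (rule GsetI[of _ mI]) auto

lemma minv_star:
  assumes "A \<in> Gset G \<delta> \<pi> k" "G = GU"
  shows "cg k (minv G \<delta> \<pi> k A) (mstar A)"
proof -
  note a = GsetD[OF assms(1)]
  have "cg k (mstar A \<star> A \<star> minv G \<delta> \<pi> k A) (mI \<star> minv G \<delta> \<pi> k A)"
    by (rule mcong_mult_right[OF a(2)[OF assms(2)]])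
  moreover have "cg k (mstar A \<star> (A \<star> minv G \<delta> \<pi> k A)) (mstar A \<star> mI)"
    by (rule mcong_mult_left[OF a(4)])
  ultimately show ?thesis by (simp add: mm_assoc) (metis mcong_sym mcong_trans)
qed

lemma Gset_minv:
  assumes "A \<in> Gset G \<delta> \<pi> k"
  shows "minv G \<delta> \<pi> k A \<in> Gset G \<delta> \<pi> k"
proof (rule GsetI)
  let ?B = "minv G \<delta> \<pi> k A"
  note a = GsetD[OF assms]
  show "inM G ?B" "inM G A" "cg k (?B \<star> A) mI" "cg k (A \<star> ?B) mI" using a by auto
  show "cg k (mstar ?B \<star> ?B) mI" if "G = GU"
  proof -
    have "cg k (mstar ?B) A" using mcong_star[OF minv_star[OF assms that]] by simp
    then show ?thesis using a(4) mcong_mult_right mcong_trans by blast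
  qed
qed

lemma KsetI:
  assumes "x \<in> Gl" "cg i x mI" shows "x \<in> Kset G \<delta> \<pi> l i"
proof -
  obtain B where "inM G B" "x = mI + msmul (\<pi> ^ i) B"
    using mcong_iff_inM[OF GsetD(1)[OF assms(1)] inM_mI assms(2)] by blast
  then have "inM G B \<and> cg l x (madd mI (msmul (\<pi> ^ i) B))" by (simp add: plus_m2_def)
  then show ?thesis using assms(1) by (auto simp: Kset_def)
qed

lemma KsetD:
  assumes "x \<in> Kset G \<delta> \<pi> l i" "i \<le> l" shows "x \<in> Gl" "cg i x mI"
proof -
  obtain B where B: "x \<in> Gl" "cg l x (mI + msmul (\<pi> ^ i) B)"
    using assms(1) by (auto simp: Kset_def plus_m2_def)
  then show "x \<in> Gl" by simp
  have "cg i (mI + msmul (\<pi> ^ i) B) mI" unfolding mcong_iff by blast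
  then show "cg i x mI" using mcong_trans[OF mcong_mono[OF B(2) assms(2)]] by blast
qed

text \<open>Elements \<open>X\<close> with \<open>ah X\<close> are exact lifts of elements of the Lie algebra.\<close>
definition ah :: "'a m2 \<Rightarrow> bool" where
  "ah X \<longleftrightarrow> inM G X \<and> (G = GU \<longrightarrow> mstar X = - X)"

lemma ahD: "ah X \<Longrightarrow> inM G X" "ah X \<Longrightarrow> G = GU \<Longrightarrow> mstar X = - X"
  unfolding ah_def by simp_all

lemma ah_GL: "G = GL \<Longrightarrow> inM G X \<Longrightarrow> ah X"
  and ah_GU: "G = GU \<Longrightarrow> mstar X = - X \<Longrightarrow> ah X"
  unfolding ah_def inM_def inR_def by simp_all

lemma ah_add: "ah X \<Longrightarrow> ah Y \<Longrightarrow> ah (X + Y)"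
  and ah_diff: "ah X \<Longrightarrow> ah Y \<Longrightarrow> ah (X - Y)"
  and ah_minus: "ah X \<Longrightarrow> ah (- X)"
  and ah_0: "ah 0"
  and ah_msmul: "ah X \<Longrightarrow> ah (msmul c X)"
  and ah_bracket: "ah X \<Longrightarrow> ah Y \<Longrightarrow> ah (X \<star> Y - Y \<star> X)"
  by (auto simp: ah_def mstar_add mstar_diff mstar_minus mstar_msmul mstar_mult mm_ring intro: inM_intros)

text \<open>The anti-hermitian part. It turns a lift of an element of the Lie algebra modulo
  \<open>\<pi> ^ k\<close> into an exact one.\<close>

definition antisym :: "'a m2 \<Rightarrow> 'a m2" where
  "antisym A = (if G = GU then msmul hf (A - mstar A) else A)"

lemma antisym_ah: "inM G A \<Longrightarrow> ah (antisym A)"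
  by (auto simp: antisym_def ah_def mstar_msmul mstar_diff inM_def inR_def msmul_minus[symmetric])

lemma msmul_half: "msmul hf (A + A) = A"
proof -
  have "msmul hf (A + A) = msmul (hf * 1 + hf * 1) A" by (simp only: msmul_add msmul_add_left mult_1_right)
  then show ?thesis by (simp only: hf_add msmul_1)
qed

lemma antisym_cong:
  assumes "G = GU \<Longrightarrow> cg k (A + mstar A) 0"
  shows "cg k (antisym A) A"
proof (cases "G = GU")
  case True
  have "cg k (msmul hf (A + A) - msmul hf (A + mstar A)) (msmul hf (A + A) - msmul hf 0)"
    by (intro mcong_sub mcong_msmul mcong_refl assms True)
  moreover have "msmul hf (A + A) - msmul hf (A + mstar A) = antisym A"
    unfolding antisym_def if_P[OF True] by (simp add: msmul_add msmul_diff)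
  ultimately show ?thesis using msmul_half[of A] by simp
qed (simp add: antisym_def)

lemma trace_form_nondeg_GL:
  assumes "G = GL" "inM G U"
    and "\<And>B. ah B \<Longrightarrow> bigpsi \<psi> (qsmul (\<pi> ^ l2) (mtr (U \<star> B))) = 1"
  shows "cg r U 0"
proof -
  have *: "\<pi> ^ r dvd u" if "\<And>z. \<psi> (\<pi> ^ l2 * (u * z)) = 1" for u
    using psi_nondeg[of l2 u] that by simp
  have U0: "snd (e11 U) = 0" "snd (e12 U) = 0" "snd (e21 U) = 0" "snd (e22 U) = 0"
    using assms(1,2) by (simp_all add: inM_def inR_def)
  have "\<pi> ^ r dvd fst (e11 U)"
  proof (rule *)
    show "\<psi> (\<pi> ^ l2 * (fst (e11 U) * z)) = 1" for z
      using assms(3)[OF ah_GL[OF assms(1)], of "M2 (z,0) (0,0) (0,0) (0,0)"] U0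
      by (simp add: assms(1) inM_def inR_def m2_defs bigpsi_def psi_0)
  qed
  moreover have "\<pi> ^ r dvd fst (e12 U)"
  proof (rule *)
    show "\<psi> (\<pi> ^ l2 * (fst (e12 U) * z)) = 1" for z
      using assms(3)[OF ah_GL[OF assms(1)], of "M2 (0,0) (0,0) (z,0) (0,0)"] U0
      by (simp add: assms(1) inM_def inR_def m2_defs bigpsi_def psi_0)
  qed
  moreover have "\<pi> ^ r dvd fst (e21 U)"
  proof (rule *)
    show "\<psi> (\<pi> ^ l2 * (fst (e21 U) * z)) = 1" for z
      using assms(3)[OF ah_GL[OF assms(1)], of "M2 (0,0) (z,0) (0,0) (0,0)"] U0
      by (simp add: assms(1) inM_def inR_def m2_defs bigpsi_def psi_0)
  qed
  moreover have "\<pi> ^ r dvd fst (e22 U)"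
  proof (rule *)
    show "\<psi> (\<pi> ^ l2 * (fst (e22 U) * z)) = 1" for z
      using assms(3)[OF ah_GL[OF assms(1)], of "M2 (0,0) (0,0) (0,0) (z,0)"] U0
      by (simp add: assms(1) inM_def inR_def m2_defs bigpsi_def psi_0)
  qed
  ultimately show ?thesis using assms(1,2) by (simp add: mcong_iff_dvd inM_def inR_def)
qed

text \<open>For anti-hermitian \<open>U\<close> and \<open>B\<close> the trace of the product lies
  in the base ring, so \<open>bigpsi\<close> reduces to \<psi>. The four families of test matrices
  span the anti-hermitian matrices, and the factors 2 and \<delta> that they produce are
  units.\<close>

lemma trace_form_nondeg_GU:
  assumes "G = GU" "ah U"
    and "\<And>B. ah B \<Longrightarrow> bigpsi \<psi> (qsmul (\<pi> ^ l2) (mtr (U \<star> B))) = 1"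
  shows "cg r U 0"
proof -
  have *: "\<pi> ^ r dvd u" if "\<And>z. \<psi> (\<pi> ^ l2 * (u * z)) = 1" for u
    using psi_nondeg[of l2 u] that by simp
  have st: "mstar U = - U" by (rule ahD(2)[OF assms(2,1)])
  have st1: "fst (e22 U) = - fst (e11 U)" "snd (e22 U) = snd (e11 U)"
    "fst (e12 U) = 0" "fst (e21 U) = 0"
    using arg_cong[OF st, of "\<lambda>M. fst (e11 M)"] arg_cong[OF st, of "\<lambda>M. snd (e11 M)"]
      arg_cong[OF st, of "\<lambda>M. fst (e12 M)"] arg_cong[OF st, of "\<lambda>M. fst (e21 M)"] double_eq_0
    by (auto simp: m2_defs eq_neg_iff_add_eq_0)
  have "\<pi> ^ r dvd 2 * fst (e11 U)"
  proof (rule *)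
    fix z
    have "qsmul (\<pi> ^ l2) (mtr (U \<star> M2 (z,0) (0,0) (0,0) (-z,0))) = (\<pi> ^ l2 * (2 * fst (e11 U) * z), 0)"
      by (rule prod_eqI) (simp_all add: m2_defs st1 algebra_simps)
    moreover have "mstar (M2 (z,0) (0,0) (0,0) (-z,0)) = - M2 (z,0) (0,0) (0,0) (-z,0)"
      by (rule m2_eqI) (simp_all add: m2_defs)
    ultimately show "\<psi> (\<pi> ^ l2 * (2 * fst (e11 U) * z)) = 1"
      using assms(3)[OF ah_GU[OF assms(1)]] bigpsi_real by metis
  qed
  moreover have "\<pi> ^ r dvd 2 * \<delta> * snd (e11 U)"
  proof (rule *)
    fix z
    have "qsmul (\<pi> ^ l2) (mtr (U \<star> M2 (0,z) (0,0) (0,0) (0,z))) = (\<pi> ^ l2 * (2 * \<delta> * snd (e11 U) * z), 0)"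
      by (rule prod_eqI) (simp_all add: m2_defs st1 algebra_simps)
    moreover have "mstar (M2 (0,z) (0,0) (0,0) (0,z)) = - M2 (0,z) (0,0) (0,0) (0,z)"
      by (rule m2_eqI) (simp_all add: m2_defs)
    ultimately show "\<psi> (\<pi> ^ l2 * (2 * \<delta> * snd (e11 U) * z)) = 1"
      using assms(3)[OF ah_GU[OF assms(1)]] bigpsi_real by metis
  qed
  moreover have "\<pi> ^ r dvd \<delta> * snd (e12 U)"
  proof (rule *)
    fix z
    have "qsmul (\<pi> ^ l2) (mtr (U \<star> M2 (0,0) (0,0) (0,z) (0,0))) = (\<pi> ^ l2 * (\<delta> * snd (e12 U) * z), 0)"
      by (rule prod_eqI) (simp_all add: m2_defs st1 algebra_simps)
    moreover have "mstar (M2 (0,0) (0,0) (0,z) (0,0)) = - M2 (0,0) (0,0) (0,z) (0,0)"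
      by (rule m2_eqI) (simp_all add: m2_defs)
    ultimately show "\<psi> (\<pi> ^ l2 * (\<delta> * snd (e12 U) * z)) = 1"
      using assms(3)[OF ah_GU[OF assms(1)]] bigpsi_real by metis
  qed
  moreover have "\<pi> ^ r dvd \<delta> * snd (e21 U)"
  proof (rule *)
    fix z
    have "qsmul (\<pi> ^ l2) (mtr (U \<star> M2 (0,0) (0,z) (0,0) (0,0))) = (\<pi> ^ l2 * (\<delta> * snd (e21 U) * z), 0)"
      by (rule prod_eqI) (simp_all add: m2_defs st1 algebra_simps)
    moreover have "mstar (M2 (0,0) (0,z) (0,0) (0,0)) = - M2 (0,0) (0,z) (0,0) (0,0)"
      by (rule m2_eqI) (simp_all add: m2_defs)
    ultimately show "\<psi> (\<pi> ^ l2 * (\<delta> * snd (e21 U) * z)) = 1"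
      using assms(3)[OF ah_GU[OF assms(1)]] bigpsi_real by metis
  qed
  ultimately have "\<pi> ^ r dvd fst (e11 U)" "\<pi> ^ r dvd snd (e11 U)" "\<pi> ^ r dvd snd (e12 U)" "\<pi> ^ r dvd snd (e21 U)"
    using pow_dvd_unit_mult pi_2 delta_unit pi_prime by (blast, blast, blast, blast)
  then show ?thesis using st1 by (simp add: mcong_iff_dvd m2_defs)
qed

lemma trace_form_nondeg:
  assumes "inM G U" "G = GU \<Longrightarrow> cg r (U + mstar U) 0"
    and "\<And>B. ah B \<Longrightarrow> bigpsi \<psi> (qsmul (\<pi> ^ l2) (mtr (U \<star> B))) = 1"
  shows "cg r U 0"
proof (cases G)
  case GL
  then show ?thesis using trace_form_nondeg_GL assms by blast
next
  case GU
  have U: "cg r (antisym U) U" by (rule antisym_cong[OF assms(2)])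
  have "cg r (antisym U) 0"
  proof (rule trace_form_nondeg_GU[OF GU antisym_ah[OF assms(1)]])
    fix B assume "ah B"
    have "bigpsi \<psi> (qsmul (\<pi> ^ l2) (mtr (antisym U \<star> B))) = bigpsi \<psi> (qsmul (\<pi> ^ l2) (mtr (U \<star> B)))"
      by (intro bigpsi_scaled mcong_mtr mcong_mult_right U)
    then show "bigpsi \<psi> (qsmul (\<pi> ^ l2) (mtr (antisym U \<star> B))) = 1"
      using assms(3)[OF \<open>ah B\<close>] by simp
  qed
  then show ?thesis using U mcong_sym mcong_trans by blast
qed

text \<open>\<open>mI - msmul (\<pi> ^ i) B\<close> is the inverse because the quadratic term
  vanishes modulo \<open>\<pi> ^ l\<close>; in the unitary case it is also the adjoint.\<close>

lemma one_plus_Kset: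
  assumes "ah B" "i + i \<ge> l"
  shows "mI + msmul (\<pi> ^ i) B \<in> Gl"
proof (rule GsetI)
  let ?P = "mI + msmul (\<pi> ^ i) B" let ?N = "mI - msmul (\<pi> ^ i) B"
  have "?P \<star> ?N = mI - msmul (\<pi> ^ (i + i)) (B \<star> B)" "?N \<star> ?P = mI - msmul (\<pi> ^ (i + i)) (B \<star> B)"
    by (simp_all add: mm_ring power_add)
  moreover have "cg l (mI - msmul (\<pi> ^ (i + i)) (B \<star> B)) (mI - 0)"
    by (intro mcong_sub mcong_refl mcong_pow_0 assms)
  ultimately show "cg l (?P \<star> ?N) mI" "cg l (?N \<star> ?P) mI" by simp_all
  then show "cg l (mstar ?P \<star> ?P) mI" if "G = GU"
    using ahD(2)[OF assms(1) that] by (simp add: mstar_add mstar_msmul msmul_minus)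
qed (use assms in \<open>auto simp: ah_def intro!: inM_intros\<close>)

lemma mtr_cycle: "mtr (A \<star> (B \<star> C \<star> D)) = mtr (D \<star> A \<star> B \<star> C)"
  using mtr_comm[of \<delta> "A \<star> B \<star> C" D] by (simp add: mm_assoc)

lemma conj_one_plus:
  assumes g: "g \<in> Gl" and x: "cg l x (mI + msmul c B)"
  shows "cg l (minv G \<delta> \<pi> l g \<star> x \<star> g) (mI + msmul c (minv G \<delta> \<pi> l g \<star> B \<star> g))"
proof -
  let ?h = "minv G \<delta> \<pi> l g"
  have "cg l (?h \<star> x \<star> g) (?h \<star> (mI + msmul c B) \<star> g)" by (intro mcong_mult_left mcong_mult_right x)
  also have "?h \<star> (mI + msmul c B) \<star> g = ?h \<star> g + msmul c (?h \<star> B \<star> g)" by (simp add: mm_ring)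
  finally have 1: "cg l (?h \<star> x \<star> g) (?h \<star> g + msmul c (?h \<star> B \<star> g))" .
  have "cg l (?h \<star> g + msmul c (?h \<star> B \<star> g)) (mI + msmul c (?h \<star> B \<star> g))"
    by (intro mcong_add mcong_refl GsetD(5)[OF g])
  then show ?thesis using 1 mcong_trans by blast
qed

text \<open>With \<open>U = g A g\<^sup>-\<^sup>1 - A\<close>, conjugation by \<open>g\<close>
  changes the character at \<open>1 + \<pi> ^ l2 B\<close> by the value of \<open>bigpsi\<close> at
  \<open>\<pi> ^ l2 tr (U B)\<close>. Nondegeneracy of the trace form turns triviality of this
  factor into \<open>U = 0\<close> modulo \<open>\<pi> ^ r\<close>.\<close>

lemma Stab_iff:
  assumes A: "A \<in> lie G \<pi> r"
  shows "g \<in> Stab G \<delta> \<pi> \<psi> l A \<longleftrightarrow> g \<in> Gl \<and> cg r (g \<star> A) (A \<star> g)"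
proof (cases "g \<in> Gl")
  case g: True
  let ?h = "minv G \<delta> \<pi> l g"
  note gd = GsetD[OF g]
  define U where "U = g \<star> A \<star> ?h - A"
  have AM: "inM G A" using A by (simp add: lie_def)
  have val: "psiA G \<delta> \<pi> \<psi> l A (?h \<star> x \<star> g) = bigpsi \<psi> (qsmul (\<pi> ^ l2) (mtr (U \<star> B))) * psiA G \<delta> \<pi> \<psi> l A x"
    if B: "inM G B" "cg l x (mI + msmul (\<pi> ^ l2) B)" for x B
  proof -
    have "psiA G \<delta> \<pi> \<psi> l A (?h \<star> x \<star> g) = bigpsi \<psi> (qsmul (\<pi> ^ l2) (mtr (A \<star> (?h \<star> B \<star> g))))"
      using B gd by (intro psiA_eq conj_one_plus[OF g]) (auto intro: inM_mult)
    also have "mtr (A \<star> (?h \<star> B \<star> g)) = mtr (U \<star> B) + mtr (A \<star> B)"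
      unfolding mtr_cycle U_def by (simp add: mm_ring mtr_diff)
    also have "qsmul (\<pi> ^ l2) (mtr (U \<star> B) + mtr (A \<star> B)) =
        qsmul (\<pi> ^ l2) (mtr (U \<star> B)) + qsmul (\<pi> ^ l2) (mtr (A \<star> B))"
      by (simp add: qsmul_def algebra_simps)
    finally show ?thesis by (simp add: bigpsi_add psiA_eq[OF B])
  qed
  have nz: "bigpsi \<psi> p \<noteq> 0" for p
    using psi_unit[of "fst p"] psi_unit[of "snd p"] by (auto simp: bigpsi_def)
  have U: "cg r U 0 \<longleftrightarrow> cg r (g \<star> A) (A \<star> g)"
  proof
    assume "cg r U 0"
    then have "cg r (U \<star> g) (0 \<star> g)" by (rule mcong_mult_right)
    then have "cg r (g \<star> A \<star> (?h \<star> g)) (A \<star> g)"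
      by (subst mcong_diff) (simp add: U_def mm_ring)
    moreover have "cg r (g \<star> A \<star> (?h \<star> g)) (g \<star> A \<star> mI)"
      by (intro mcong_mult_left mcong_mono[OF gd(5)] l2l)
    ultimately show "cg r (g \<star> A) (A \<star> g)" using mcong_sym mcong_trans by fastforce
  next
    assume "cg r (g \<star> A) (A \<star> g)"
    then have "cg r (g \<star> A \<star> ?h) (A \<star> g \<star> ?h)" by (rule mcong_mult_right)
    moreover have "cg r (A \<star> (g \<star> ?h)) (A \<star> mI)"
      by (intro mcong_mult_left mcong_mono[OF gd(4)] l2l)
    ultimately have "cg r (g \<star> A \<star> ?h) A" using mcong_trans by (fastforce simp: mm_assoc)
    then show "cg r U 0" unfolding U_def using mcong_diff by blast
  qed
  have "(\<forall>x\<in>Kset G \<delta> \<pi> l l2. psiA G \<delta> \<pi> \<psi> l A (?h \<star> x \<star> g) = psiA G \<delta> \<pi> \<psi> l A x) \<longleftrightarrow> cg r U 0"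
  proof
    assume U0: "cg r U 0"
    show "\<forall>x\<in>Kset G \<delta> \<pi> l l2. psiA G \<delta> \<pi> \<psi> l A (?h \<star> x \<star> g) = psiA G \<delta> \<pi> \<psi> l A x"
    proof
      fix x assume "x \<in> Kset G \<delta> \<pi> l l2"
      then obtain B where B: "inM G B" "cg l x (mI + msmul (\<pi> ^ l2) B)"
        by (auto simp: Kset_def plus_m2_def)
      have "bigpsi \<psi> (qsmul (\<pi> ^ l2) (mtr (U \<star> B))) = bigpsi \<psi> (qsmul (\<pi> ^ l2) (mtr (0 \<star> B)))"
        by (intro bigpsi_scaled mcong_mtr mcong_mult_right U0)
      also have "\<dots> = 1" by (simp add: qsmul_def bigpsi_def psi_0)
      finally show "psiA G \<delta> \<pi> \<psi> l A (?h \<star> x \<star> g) = psiA G \<delta> \<pi> \<psi> l A x" using val[OF B] by simp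
    qed
  next
    assume inv: "\<forall>x\<in>Kset G \<delta> \<pi> l l2. psiA G \<delta> \<pi> \<psi> l A (?h \<star> x \<star> g) = psiA G \<delta> \<pi> \<psi> l A x"
    show "cg r U 0"
    proof (rule trace_form_nondeg)
      show "inM G U" unfolding U_def using gd AM by (auto intro!: inM_intros)
      show "cg r (U + mstar U) 0" if GU: "G = GU"
      proof -
        have As: "cg r (mstar A) (- A)"
        proof -
          have "cg r (A + mstar A) 0" using A GU by (simp add: lie_def plus_m2_def zero_m2_def)
          then have "cg r (A + mstar A - A) (0 - A)" by (intro mcong_sub mcong_refl)
          then show ?thesis by simp
        qed
        have hs: "cg r ?h (mstar g)" by (rule mcong_mono[OF minv_star[OF g GU] l2l(3)])
        have "cg r (mstar (g \<star> A \<star> ?h)) (g \<star> (- A) \<star> ?h)"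
          unfolding mstar_mult
          using mcong_mult[OF mcong_mult[OF _ As] mcong_sym[OF hs], of "mstar ?h" g \<delta> \<delta>] mcong_star[OF hs]
          by (simp add: mm_assoc)
        then have "cg r (U + mstar U) (g \<star> A \<star> ?h - A + (g \<star> (- A) \<star> ?h - (- A)))"
          unfolding U_def mstar_diff by (intro mcong_add mcong_sub mcong_refl As)
        then show ?thesis by (simp add: mm_ring)
      qed
      fix B assume B: "ah B"
      let ?x = "mI + msmul (\<pi> ^ l2) B"
      have x: "?x \<in> Kset G \<delta> \<pi> l l2"
        by (rule KsetI[OF one_plus_Kset[OF B l2l(1)]]) (auto simp: mcong_iff)
      have BM: "inM G B" using B by (simp add: ah_def)
      have "psiA G \<delta> \<pi> \<psi> l A ?x \<noteq> 0" unfolding psiA_eq[OF BM mcong_refl] by (rule nz)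
      then show "bigpsi \<psi> (qsmul (\<pi> ^ l2) (mtr (U \<star> B))) = 1"
        using val[OF BM mcong_refl] inv x by simp
    qed
  qed
  then show ?thesis using U g by (simp add: Stab_def)
qed (simp add: Stab_def)

end

section \<open>Traceless elements of the Lie algebra\<close>

lemma mtr_qsc: "mtr (qsc x) = x + x"
  by (simp add: mtr_def qsc_def qadd_def plus_prod_def)

context setting
begin

definition es :: 'a where "es = (if G = GL then 1 else \<delta>)"

text \<open>Coordinates for the traceless part of the Lie algebra, the same for both groups: they
  range over the base ring, and products of two such matrices involve \<open>eps G\<close> on the
  diagonal only through its square \<open>es\<close>.\<close>

definition G0 :: "'a \<Rightarrow> 'a \<Rightarrow> 'a \<Rightarrow> 'a m2" where
  "G0 p q s = M2 (p, 0) (qsmul q (eps G)) (qsmul s (eps G)) (- p, 0)"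

definition g0 :: "'a m2 set" where "g0 = {X. ah X \<and> mtr X = 0}"

text \<open>On \<open>g0\<close> the trace of a product has no theta-component, so
  \<open>fst\<close> loses nothing there.\<close>

definition tf :: "'a m2 \<Rightarrow> 'a m2 \<Rightarrow> 'a" where "tf X Y = fst (mtr (X \<star> Y))"

lemma es_GL: "G = GL \<Longrightarrow> es = 1" and es_GU: "G = GU \<Longrightarrow> es = \<delta>"
  unfolding es_def by simp_all

lemma es_unit: "\<not> \<pi> dvd es"
  using delta_unit pi_nunit by (simp add: es_def)

lemma g0D: "X \<in> g0 \<Longrightarrow> ah X" "X \<in> g0 \<Longrightarrow> mtr X = 0" "X \<in> g0 \<Longrightarrow> inM G X"
  by (auto simp: g0_def ahD)

lemma g0_coord: assumes "X \<in> g0" shows "\<exists>p q s. X = G0 p q s"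
proof -
  have tr: "fst (e22 X) = - fst (e11 X)" "snd (e22 X) = - snd (e11 X)"
    using arg_cong[OF g0D(2)[OF assms], of fst] arg_cong[OF g0D(2)[OF assms], of snd]
    by (auto simp: m2_defs zero_prod_def eq_neg_iff_add_eq_0 add.commute)
  show ?thesis
  proof (cases G)
    case GL
    have "snd (e11 X) = 0" "snd (e12 X) = 0" "snd (e21 X) = 0"
      using g0D(3)[OF assms] unfolding inM_def inR_def using GL by simp_all
    then have "X = G0 (fst (e11 X)) (fst (e12 X)) (fst (e21 X))"
      unfolding G0_def eps_def using GL tr by (intro m2_eqI) (simp_all add: qsmul_def)
    then show ?thesis by blast
  next
    case GU
    have st: "mstar X = - X" by (rule ahD(2)[OF g0D(1)[OF assms] GU])
    have "snd (e11 X) = 0" "fst (e12 X) = 0" "fst (e21 X) = 0"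
      using arg_cong[OF st, of "\<lambda>M. snd (e11 M)"] tr(2)
        arg_cong[OF st, of "\<lambda>M. fst (e12 M)"] arg_cong[OF st, of "\<lambda>M. fst (e21 M)"] double_eq_0
      by (auto simp: m2_defs eq_neg_iff_add_eq_0)
    then have "X = G0 (fst (e11 X)) (snd (e12 X)) (snd (e21 X))"
      unfolding G0_def eps_def using GU tr by (intro m2_eqI) (simp_all add: qsmul_def)
    then show ?thesis by blast
  qed
qed

lemma G0_g0: "G0 p q s \<in> g0"
proof -
  have "mstar (G0 p q s) = - G0 p q s" if "G = GU"
    unfolding G0_def eps_def using that by (intro m2_eqI) (simp_all add: m2_defs)
  moreover have "inM G (G0 p q s)" by (simp add: inM_def inR_def G0_def eps_def qsmul_def)
  ultimately show ?thesis
    by (auto simp: g0_def ah_def) (simp add: G0_def m2_defs zero_prod_def)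
qed

lemma eps_sq: "qmul \<delta> (qsmul q (eps G)) (qsmul s (eps G)) = (es * (q * s), 0)"
  by (simp add: eps_def es_def qmul_def qsmul_def mult_ac)

lemma G0_mult:
  "G0 p q s \<star> G0 p' q' s' = M2 (p * p' + es * (q * s'), 0) (qsmul (p * q' - q * p') (eps G))
     (qsmul (s * p' - p * s') (eps G)) (es * (s * q') + p * p', 0)"
  unfolding G0_def mmul_def m2.sel eps_sq
  by (simp add: qadd_def qmul_def qsmul_def algebra_simps)

lemma tf_G0: "tf (G0 p q s) (G0 p' q' s') = 2 * (p * p') + es * (q * s' + s * q')"
  by (simp add: tf_def G0_mult mtr_def qadd_def algebra_simps)

lemma mtr_g0: assumes "X \<in> g0" "Y \<in> g0" shows "mtr (X \<star> Y) = (tf X Y, 0)"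
proof -
  obtain p q s p' q' s' where "X = G0 p q s" "Y = G0 p' q' s'" using g0_coord assms by metis
  then show ?thesis by (intro prod_eqI) (simp_all add: tf_def G0_mult mtr_def qadd_def)
qed

text \<open>Cayley-Hamilton for traceless matrices, polarised.\<close>

lemma g0_anticomm: assumes "X \<in> g0" "Y \<in> g0" shows "X \<star> Y + Y \<star> X = msmul (tf X Y) mI"
proof -
  obtain p q s p' q' s' where XY: "X = G0 p q s" "Y = G0 p' q' s'" using g0_coord assms by metis
  show ?thesis
    unfolding XY G0_mult tf_G0 by (intro m2_eqI) (simp_all add: m2_defs algebra_simps)
qed

lemma tf_sym: "tf X Y = tf Y X"
  by (simp add: tf_def mtr_comm)

lemma tf_add_left: "tf (X + Y) Z = tf X Z + tf Y Z"
  and tf_add_right: "tf Z (X + Y) = tf Z X + tf Z Y"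
  and tf_diff_left: "tf (X - Y) Z = tf X Z - tf Y Z"
  and tf_diff_right: "tf Z (X - Y) = tf Z X - tf Z Y"
  and tf_minus_left: "tf (- X) Z = - tf X Z"
  and tf_minus_right: "tf Z (- X) = - tf Z X"
  and tf_msmul_left: "tf (msmul c X) Z = c * tf X Z"
  and tf_msmul_right: "tf Z (msmul c X) = c * tf Z X"
  and tf_zero_right [simp]: "tf Z 0 = 0" and tf_zero_left [simp]: "tf 0 Z = 0"
  by (simp_all add: tf_def mm_ring mtr_add mtr_diff mtr_minus mtr_msmul qsmul_def)

lemmas tf_lin = tf_add_left tf_add_right tf_diff_left tf_diff_right tf_minus_left tf_minus_right
  tf_msmul_left tf_msmul_right

text \<open>Invariance of the trace form; it moves the bracket onto the fixed matrix and frees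
  \<open>Y\<close>, so that nondegeneracy can be applied.\<close>

lemma tf_bracket: "tf A (X \<star> Y - Y \<star> X) = tf (A \<star> X - X \<star> A) Y"
proof -
  have "mtr (A \<star> (Y \<star> X)) = mtr (X \<star> A \<star> Y)" using mtr_comm[of \<delta> "A \<star> Y" X] by (simp add: mm_assoc)
  then show ?thesis by (simp add: tf_def mm_ring mtr_diff)
qed

lemma tf_cong: assumes "cg k X X'" shows "\<pi> ^ k dvd tf X Y - tf X' Y"
  using mcong_mtr[OF mcong_mult_right[OF assms, of \<delta> Y]] by (simp add: tf_def qcong_def)

lemma tf_cong_right: assumes "cg k X X'" shows "\<pi> ^ k dvd tf Y X - tf Y X'"
  using tf_cong[OF assms] by (simp add: tf_sym[of Y])

lemma tf_dvd: "cg k X 0 \<Longrightarrow> \<pi> ^ k dvd tf X Y"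
  using tf_cong[of k X 0 Y] by simp

lemma g0_add: "X \<in> g0 \<Longrightarrow> Y \<in> g0 \<Longrightarrow> X + Y \<in> g0"
  and g0_diff: "X \<in> g0 \<Longrightarrow> Y \<in> g0 \<Longrightarrow> X - Y \<in> g0"
  and g0_minus: "X \<in> g0 \<Longrightarrow> - X \<in> g0"
  and g0_0: "0 \<in> g0"
  and g0_msmul: "X \<in> g0 \<Longrightarrow> msmul c X \<in> g0"
  and g0_bracket: "X \<in> g0 \<Longrightarrow> Y \<in> g0 \<Longrightarrow> X \<star> Y - Y \<star> X \<in> g0"
  by (auto simp: g0_def ah_add ah_diff ah_minus ah_0 ah_msmul ah_bracket mtr_add mtr_diff mtr_minus
      mtr_msmul mtr_comm qsmul_def zero_prod_def)

lemma g0_sq: assumes "X \<in> g0" shows "X \<star> X = msmul (hf * tf X X) mI"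
proof -
  have "X \<star> X = msmul hf (X \<star> X + X \<star> X)" by (simp add: msmul_half)
  then show ?thesis using g0_anticomm[OF assms assms] by simp
qed

lemma mI_cong_0_iff: "cg k (msmul c mI) 0 \<longleftrightarrow> \<pi> ^ k dvd c"
  by (simp add: mcong_iff_dvd m2_defs)

lemma g0_form_nondeg:
  assumes X: "X \<in> g0" and m: "m \<le> l" and triv: "\<And>Y. Y \<in> g0 \<Longrightarrow> \<psi> (\<pi> ^ m * tf X Y) = 1"
  shows "cg (l - m) X 0"
proof -
  obtain p q s where Xc: "X = G0 p q s" using g0_coord[OF X] by blast
  have "\<pi> ^ (l - m) dvd 2 * p"
    by (rule psi_nondeg[OF m]) (use triv[OF G0_g0[of _ 0 0]] in \<open>simp add: Xc tf_G0 mult.assoc\<close>)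
  moreover have "\<pi> ^ (l - m) dvd es * q"
    by (rule psi_nondeg[OF m]) (use triv[OF G0_g0[of 0 0]] in \<open>simp add: Xc tf_G0 mult.assoc\<close>)
  moreover have "\<pi> ^ (l - m) dvd es * s"
    by (rule psi_nondeg[OF m]) (use triv[OF G0_g0[of 0 _ 0]] in \<open>simp add: Xc tf_G0 mult.assoc\<close>)
  ultimately have "\<pi> ^ (l - m) dvd p" "\<pi> ^ (l - m) dvd q" "\<pi> ^ (l - m) dvd s"
    using pow_dvd_unit_mult pi_2 es_unit by blast+
  then show ?thesis by (simp add: Xc mcong_iff_dvd m2_defs G0_def)
qed

lemma g0_div:
  assumes "w \<in> g0" "cg k w 0" shows "\<exists>z\<in>g0. w = msmul (\<pi> ^ k) z"
proof -
  obtain z where z: "inM G z" "w = 0 + msmul (\<pi> ^ k) z"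
    using mcong_iff_inM[OF g0D(3)[OF assms(1)] inM_0 assms(2)] by blast
  then have wz: "w = msmul (\<pi> ^ k) z" by simp
  have "mstar z = - z" if "G = GU"
  proof -
    have "msmul (\<pi> ^ k) (mstar z) = msmul (\<pi> ^ k) (- z)"
      using ahD(2)[OF g0D(1)[OF assms(1)] that] unfolding wz mstar_msmul msmul_minus .
    then show ?thesis unfolding msmul_pow_cancel .
  qed
  then have "ah z" unfolding ah_def using z(1) by simp
  moreover have "mtr z = 0"
    using g0D(2)[OF assms(1)] pi_nz unfolding wz mtr_msmul by (simp add: qsmul_def prod_eq_iff zero_prod_def)
  ultimately show ?thesis using wz by (auto simp: g0_def)
qed

lemma ah_scalar_part:
  assumes Y: "ah Y"
  shows "\<exists>z. inR G z \<and> ah (qsc z) \<and> Y - qsc z \<in> g0"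
proof -
  define z where "z = qsmul hf (mtr Y)"
  have zz: "z + z = mtr Y" unfolding z_def by (rule prod_eqI) (simp_all add: qsmul_def hf_add)
  have zR: "inR G z" using ahD(1)[OF Y] by (auto simp: z_def inR_def inM_def mtr_def qadd_def qsmul_def)
  have "mstar (qsc z) = - qsc z" if "G = GU"
  proof -
    have "qconj (mtr Y) = - mtr Y"
      using mtr_mstar[of Y] ahD(2)[OF Y that] by (simp add: mtr_minus)
    then have "qconj z = - z" unfolding z_def by (auto simp: qconj_def qsmul_def prod_eq_iff)
    then show ?thesis by (simp add: qsc_mstar qsc_minus)
  qed
  then have zah: "ah (qsc z)" unfolding ah_def using inM_qsc[OF zR] by simp
  have "Y - qsc z \<in> g0" using zz ah_diff[OF Y zah] by (simp add: g0_def mtr_diff mtr_qsc)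
  then show ?thesis using zR zah by blast
qed

lemma lie_normal_form:
  assumes A: "A \<in> lie G \<pi> k"
  shows "\<exists>a N. N \<in> g0 \<and> cg k A (qsc a + N)"
proof -
  have AM: "inM G A" using A by (simp add: lie_def)
  have A0: "ah (antisym A)" "cg k (antisym A) A"
    using antisym_ah[OF AM] antisym_cong A by (auto simp: lie_def plus_m2_def zero_m2_def)
  obtain a where "antisym A - qsc a \<in> g0" using ah_scalar_part[OF A0(1)] by blast
  moreover have "cg k A (qsc a + (antisym A - qsc a))" using mcong_sym[OF A0(2)] by simp
  ultimately show ?thesis by blast
qed

text \<open>Conjugation preserves traces and squares. Comparing traces, with 2 a unit, identifies
  the scalar parts modulo \<open>\<pi> ^ r\<close>; hence \<open>N\<close> is conjugate to
  \<open>G0 0 \<sigma> 1\<close> there, and \<open>D\<close> is congruent to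
  \<open>es * \<sigma>\<close>. Both conclusions are then read modulo \<pi>.\<close>

lemma tt_cus_normal_form:
  assumes A: "cg r A (qsc a + N)" "N \<in> g0" "N \<star> N = msmul D mI" and tt: "tt_cus G \<delta> \<pi> r A"
  shows "\<not> \<pi> dvd y * y - D" "G = GU \<Longrightarrow> \<exists>s. \<pi> dvd D - \<delta> * (s * s)"
proof -
  obtain g x \<sigma> z where g: "g \<in> Gset G \<delta> \<pi> r" and z: "\<pi> ^ r dvd \<sigma> * z - 1"
    and GLs: "G = GL \<Longrightarrow> \<not> (\<exists>y. \<pi> ^ r dvd y * y - \<sigma>)" and GUs: "G = GU \<Longrightarrow> \<exists>y. \<pi> ^ r dvd y * y - \<sigma>"
    and conj: "cg r (g \<star> A \<star> minv G \<delta> \<pi> r g) (M2 x (qsmul \<sigma> (eps G)) (eps G) x)"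
    using tt unfolding tt_cus_def by blast
  let ?h = "minv G \<delta> \<pi> r g"
  note gd = GsetD[OF g]
  define N' where "N' = G0 0 \<sigma> 1"
  have xN: "M2 x (qsmul \<sigma> (eps G)) (eps G) x = qsc x + N'"
    by (rule m2_eqI) (simp_all add: N'_def G0_def qsc_def m2_defs)
  have N'2: "N' \<star> N' = msmul (es * \<sigma>) mI"
    unfolding N'_def G0_mult by (rule m2_eqI) (simp_all add: m2_defs)
  have hg: "cg r (Y \<star> (?h \<star> g)) Y" for Y using mcong_mult_left[OF gd(5), of \<delta> Y] by simp
  have gh: "cg r (Y \<star> (g \<star> ?h)) Y" for Y using mcong_mult_left[OF gd(4), of \<delta> Y] by simp
  have c1: "cg r (g \<star> (qsc a + N) \<star> ?h) (qsc x + N')"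
    using mcong_trans[OF mcong_mult_right[OF mcong_mult_left[OF mcong_sym[OF A(1)]]] conj[unfolded xN]] .
  have e1: "g \<star> (qsc a + N) \<star> ?h = qsc a \<star> (g \<star> ?h) + g \<star> N \<star> ?h"
    by (simp add: mm_ring qsc_comm)
  have c2: "cg r (qsc a + g \<star> N \<star> ?h) (qsc x + N')"
    using mcong_trans[OF mcong_sym[OF mcong_add[OF gh[of "qsc a"] mcong_refl]] c1[unfolded e1]] .
  have trN: "qcong \<pi> r (mtr (g \<star> N \<star> ?h)) 0"
    using mcong_mtr[OF hg[of N]] mtr_comm[of \<delta> g "N \<star> ?h"] g0D(2)[OF A(2)] by (simp add: mm_assoc)
  have tq: "qcong \<pi> r (a + a + mtr (g \<star> N \<star> ?h)) (x + x)"
    using mcong_mtr[OF c2] g0D(2)[OF G0_g0] by (simp add: mtr_add N'_def mtr_qsc)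
  have sub: "\<pi> ^ r dvd u - v" if "\<pi> ^ r dvd u + t - v" "\<pi> ^ r dvd t" for u v t
    using dvd_diff[OF that] by (simp add: algebra_simps)
  have "qcong \<pi> r (a + a) (x + x)"
    using tq trN sub unfolding qcong_def by (simp add: zero_prod_def) blast
  then have "\<pi> ^ r dvd 2 * (fst a - fst x)" "\<pi> ^ r dvd 2 * (snd a - snd x)"
    by (simp_all add: qcong_def algebra_simps)
  then have "\<pi> ^ r dvd fst a - fst x" "\<pi> ^ r dvd snd a - snd x" using pow_dvd_unit_mult[OF pi_2] by blast+
  then have ax: "cg r (qsc a) (qsc x)" by (simp add: mcong_def qcong_def qsc_def)
  have c3: "cg r (g \<star> N \<star> ?h) N'"
  proof -
    have "cg r (qsc a + g \<star> N \<star> ?h - qsc a) (qsc x + N' - qsc x)" by (intro mcong_sub c2 ax)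
    then show ?thesis by simp
  qed
  have "cg r (g \<star> N \<star> ?h \<star> (g \<star> N \<star> ?h)) (msmul (es * \<sigma>) mI)"
    using mcong_mult[OF c3 c3, of \<delta>] N'2 by simp
  moreover have "cg r (g \<star> N \<star> ?h \<star> (g \<star> N \<star> ?h)) (msmul D mI)"
  proof -
    have "cg r (g \<star> N \<star> ?h \<star> (g \<star> (N \<star> ?h))) (g \<star> N \<star> (N \<star> ?h))"
      by (rule mcong_middle[OF gd(5)])
    moreover have "g \<star> N \<star> (N \<star> ?h) = msmul D mI \<star> (g \<star> ?h)"
    proof -
      have "g \<star> N \<star> (N \<star> ?h) = g \<star> (N \<star> N) \<star> ?h" by (simp add: mm_assoc)
      then show ?thesis by (simp add: A(3) mm_ring)
    qed
    ultimately show ?thesis using gh mcong_trans by (metis mm_assoc)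
  qed
  ultimately have "cg r (msmul D mI) (msmul (es * \<sigma>) mI)" using mcong_sym mcong_trans by blast
  then have "cg r (msmul (D - es * \<sigma>) mI) 0" by (subst (asm) mcong_diff) (simp add: msmul_diff_left)
  then have Dr: "\<pi> ^ r dvd D - es * \<sigma>" by (simp add: mI_cong_0_iff)
  have pr: "\<pi> dvd \<pi> ^ r" using r1 by (simp add: dvd_power)
  have D1: "\<pi> dvd D - es * \<sigma>" using Dr pr dvd_trans by blast
  have \<sigma>u: "\<not> \<pi> dvd \<sigma>"
  proof
    assume "\<pi> dvd \<sigma>"
    moreover have "\<pi> dvd \<sigma> * z - 1" using z pr dvd_trans by blast
    ultimately have "\<pi> dvd \<sigma> * z - (\<sigma> * z - 1)" by (metis dvd_diff dvd_mult2)
    then show False using pi_nunit by simp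
  qed
  show GUD: "\<exists>s. \<pi> dvd D - \<delta> * (s * s)" if GU: "G = GU"
  proof -
    obtain s where "\<pi> ^ r dvd s * s - \<sigma>" using GUs[OF GU] by blast
    then have s1: "\<pi> dvd s * s - \<sigma>" using pr dvd_trans by blast
    have "\<pi> dvd D - \<delta> * \<sigma> - \<delta> * (s * s - \<sigma>)"
      using dvd_diff[OF D1[unfolded es_GU[OF GU]] dvd_mult[OF s1, of \<delta>]] by simp
    then show ?thesis by (auto simp: algebra_simps)
  qed
  show "\<not> \<pi> dvd y * y - D"
  proof
    assume y: "\<pi> dvd y * y - D"
    have y1: "\<pi> dvd y * y - es * \<sigma>" using dvd_add[OF y D1] by simp
    show False
    proof (cases G)
      case GL
      have "\<pi> dvd y * y - \<sigma>" using y1 unfolding es_GL[OF GL] by simp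
      \<comment> \<open>\<open>tt_cus\<close> excludes square roots modulo \<open>\<pi> ^ r\<close>;
        Hensel extends this to square roots modulo \<pi>.\<close>
      then obtain w where "w * w = \<sigma>" using hensel[OF \<sigma>u] by blast
      then show False using GLs[OF GL] by (metis diff_self dvd_0_right)
    next
      case GU
      obtain s where s: "\<pi> ^ r dvd s * s - \<sigma>" using GUs[OF GU] by blast
      then have s1: "\<pi> dvd s * s - \<sigma>" using pr dvd_trans by blast
      have "\<not> \<pi> dvd s"
      proof
        assume "\<pi> dvd s"
        then have "\<pi> dvd s * s - (s * s - \<sigma>)" using s1 by (metis dvd_diff dvd_mult)
        then show False using \<sigma>u by simp
      qed
      \<comment> \<open>Dividing \<open>y\<close> by \<open>s\<close> would give a square root of
        \<delta> modulo \<pi>.\<close>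
      then obtain w where w: "s * w = 1" using unit_ex by blast
      have "\<pi> dvd y * y - \<delta> * \<sigma> - \<delta> * (s * s - \<sigma>)"
        using dvd_diff[OF y1[unfolded es_GU[OF GU]] dvd_mult[OF s1, of \<delta>]] by simp
      then have "\<pi> dvd y * y - \<delta> * (s * s)" by (simp add: algebra_simps)
      then have "\<pi> dvd (y * y - \<delta> * (s * s)) * (w * w)" by (rule dvd_mult2)
      moreover have "(y * y - \<delta> * (s * s)) * (w * w) = (y * w) * (y * w) - \<delta> * ((s * w) * (s * w))"
        by (simp add: algebra_simps)
      ultimately show False using delta_nonsquare[of "y * w"] w by simp
    qed
  qed
qed

end

section \<open>The commutative algebra of a cuspidal element\<close>

context setting
begin

definition qs :: "'a qe \<Rightarrow> 'a m2 \<Rightarrow> 'a m2" where "qs x A = qsc x \<star> A"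

lemma qs_mult_left: "qs x A \<star> B = qs x (A \<star> B)"
  and qs_mult_right: "A \<star> qs x B = qs x (A \<star> B)"
  and qs_qs: "qs x (qs y A) = qs (qmul \<delta> x y) A"
  and qs_add: "qs x (A + B) = qs x A + qs x B"
  and qs_diff: "qs x (A - B) = qs x A - qs x B"
  and qs_minus: "qs x (- A) = - qs x A"
  and qs_msmul: "qs x (msmul c A) = msmul c (qs x A)"
  and qs_add_left: "qs (x + y) A = qs x A + qs y A"
  and qs_diff_left: "qs (x - y) A = qs x A - qs y A"
  and qs_minus_left: "qs (- x) A = - qs x A"
  and qs_real: "qs (c, 0) A = msmul c A"
  and qs_0: "qs x 0 = 0"
  and qs_qsmul: "qs (qsmul c x) A = msmul c (qs x A)"
proof -
  have "A \<star> (qsc x \<star> B) = qsc x \<star> (A \<star> B)"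
    using qsc_comm[of \<delta> x A] by (simp add: mm_assoc[symmetric])
  then show "A \<star> qs x B = qs x (A \<star> B)" by (simp add: qs_def)
  show "qs x (qs y A) = qs (qmul \<delta> x y) A" by (simp add: qs_def mm_assoc[symmetric] qsc_mult)
  show "qs (c, 0) A = msmul c A" by (simp add: qs_def qsc_c msmul_mult_left)
qed (simp_all add: qs_def mm_ring qsc_add[symmetric] qsc_diff[symmetric] qsc_minus[symmetric] qsc_msmul[symmetric])

lemmas qs_ring = qs_mult_left qs_mult_right qs_qs qs_add qs_diff qs_minus qs_msmul

lemma mstar_qs: "mstar (qs x A) = qs (qconj x) (mstar A)"
  by (simp add: qs_def mstar_mult qsc_mstar qsc_comm)

lemma mtr_qs: "mtr (qs x A) = qmul \<delta> x (mtr A)"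
  unfolding qs_def by (rule prod_eqI) (simp_all add: m2_defs qsc_def algebra_simps)

lemma inM_qs: "inR G x \<Longrightarrow> inM G A \<Longrightarrow> inM G (qs x A)"
  unfolding qs_def by (intro inM_mult inM_qsc)

lemma mcong_qs: "cg k A B \<Longrightarrow> cg k (qs x A) (qs x B)"
  unfolding qs_def by (rule mcong_mult_left)

lemma qcong_0_qs: "qcong \<pi> k x 0 \<Longrightarrow> cg k (qs x A) 0"
proof -
  assume "qcong \<pi> k x 0"
  then have "cg k (qsc x) 0" by (simp add: qcong_def mcong_iff_dvd qsc_def m2_defs zero_prod_def)
  then show ?thesis unfolding qs_def using mcong_mult_right[of \<pi> k "qsc x" 0 \<delta> A] by simp
qed

lemma qmul_conj: "qmul \<delta> (qconj y) y = (fst y * fst y - \<delta> * (snd y * snd y), 0)"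
  by (simp add: qmul_def qconj_def algebra_simps)

text \<open>Otherwise the quotient of \<open>x\<close> by \<open>y\<close> would be a square root of
  \<open>D\<close> modulo \<pi>.\<close>

lemma nonsquare_norm:
  assumes "\<And>y. \<not> \<pi> dvd y * y - D" "\<pi> dvd x * x - D * (y * y)"
  shows "\<pi> dvd x" "\<pi> dvd y"
proof -
  show y: "\<pi> dvd y"
  proof (rule ccontr)
    assume "\<not> \<pi> dvd y"
    then obtain w where w: "y * w = 1" using unit_ex by blast
    have "\<pi> dvd (x * x - D * (y * y)) * (w * w)" using assms(2) by (rule dvd_mult2)
    moreover have "(x * x - D * (y * y)) * (w * w) = (x * w) * (x * w) - D * ((y * w) * (y * w))"
      by (simp add: algebra_simps)
    ultimately show False using assms(1)[of "x * w"] w by simp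
  qed
  have "\<pi> dvd (x * x - D * (y * y)) + D * (y * y)" using assms(2) y by (intro dvd_add) auto
  then show "\<pi> dvd x" using pi_prime[of x x] by simp
qed

text \<open>An element of the extension that is nonzero modulo \<pi> has unit norm, because \<delta>
  is not a square modulo \<pi>. Multiplying by the conjugate reduces to a scalar of the base
  ring.\<close>

lemma qs_cancel:
  assumes "\<not> qcong \<pi> 1 y 0" "cg k (qs y A) 0"
  shows "cg k A 0"
proof -
  let ?n = "fst y * fst y - \<delta> * (snd y * snd y)"
  have "\<not> \<pi> dvd ?n"
  proof
    assume "\<pi> dvd ?n"
    then have "\<pi> dvd fst y" "\<pi> dvd snd y" using nonsquare_norm[OF delta_nonsquare] by blast+
    then show False using assms(1) by (simp add: qcong_def zero_prod_def)
  qed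
  moreover have "cg k (msmul ?n A) (msmul ?n 0)"
    using mcong_qs[OF assms(2), of "qconj y"] by (simp add: qs_qs qmul_conj qs_real qs_0)
  ultimately show ?thesis by (rule mcong_unit_cancel)
qed

lemma mI_not_cong_0: "1 \<le> k \<Longrightarrow> \<not> cg k mI 0"
  using mI_cong_0_iff[of k 1] pi_nunit dvd_trans[of \<pi> "\<pi> ^ k" 1] by (auto simp: dvd_power)

end

locale cusp = setting +
  fixes N :: "'a m2" and D :: 'a
  assumes N: "N \<in> g0" and NN: "N \<star> N = msmul D mI" and nonsq: "\<And>y. \<not> \<pi> dvd y * y - D"
begin

lemma D_unit: "\<not> \<pi> dvd D"
  using nonsq[of 0] by simp

definition alg :: "'a qe \<Rightarrow> 'a qe \<Rightarrow> 'a m2" where "alg x y = qs x mI + qs y N"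

text \<open>The algebra generated by \<open>N\<close>, over the base ring for \<open>GL\<close> and
  over the extension for \<open>GU\<close>.\<close>

definition Alg :: "'a m2 set" where "Alg = {alg x y | x y. inR G x \<and> inR G y}"

lemma qmul_comm: "qmul \<delta> x y = qmul \<delta> y x"
  by (simp add: qmul_def mult_ac add.commute)

lemma alg_mult: "alg x y \<star> alg x' y' = alg (qmul \<delta> x x' + qsmul D (qmul \<delta> y y')) (qmul \<delta> x y' + qmul \<delta> y x')"
  by (simp add: alg_def mm_ring qs_ring NN qs_add_left qs_qsmul qmul_comm[of x'] qmul_comm[of y'])

lemma alg_add: "alg x y + alg x' y' = alg (x + x') (y + y')"
  and alg_diff: "alg x y - alg x' y' = alg (x - x') (y - y')"
  and alg_msmul: "msmul c (alg x y) = alg (qsmul c x) (qsmul c y)"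
  by (simp_all add: alg_def qs_add_left qs_diff_left qs_qsmul msmul_add)

lemma inR_closed: "inR G x \<Longrightarrow> inR G y \<Longrightarrow> inR G (x + y)" "inR G x \<Longrightarrow> inR G y \<Longrightarrow> inR G (x - y)"
  "inR G x \<Longrightarrow> inR G y \<Longrightarrow> inR G (qmul \<delta> x y)" "inR G x \<Longrightarrow> inR G (qsmul c x)" "inR G x \<Longrightarrow> inR G (qconj x)"
  "inR G x \<Longrightarrow> inR G (- x)"
  by (auto simp: inR_def qmul_def qsmul_def qconj_def)

lemma AlgI: "inR G x \<Longrightarrow> inR G y \<Longrightarrow> alg x y \<in> Alg"
  unfolding Alg_def by blast

lemma AlgE: assumes "c \<in> Alg" obtains x y where "inR G x" "inR G y" "c = alg x y"
  using assms unfolding Alg_def by blast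

lemma Alg_mult: "c \<in> Alg \<Longrightarrow> d \<in> Alg \<Longrightarrow> c \<star> d \<in> Alg"
  by (elim AlgE) (auto simp: alg_mult intro!: AlgI inR_closed)

lemma Alg_add: "c \<in> Alg \<Longrightarrow> d \<in> Alg \<Longrightarrow> c + d \<in> Alg"
  and Alg_diff: "c \<in> Alg \<Longrightarrow> d \<in> Alg \<Longrightarrow> c - d \<in> Alg"
  and Alg_msmul: "c \<in> Alg \<Longrightarrow> msmul a c \<in> Alg"
  by (elim AlgE; auto simp: alg_add alg_diff alg_msmul intro!: AlgI inR_closed)+

lemma Alg_qsc: "inR G x \<Longrightarrow> qsc x \<in> Alg"
proof -
  assume "inR G x"
  then have "alg x 0 \<in> Alg" by (intro AlgI) (auto simp: inR_def)
  then show ?thesis by (simp add: alg_def qs_def qsc_0)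
qed

lemma Alg_mI: "mI \<in> Alg"
  using Alg_qsc[of "(1, 0)"] by (simp add: qsc_1 inR_def)

lemma Alg_N: "N \<in> Alg"
proof -
  have "alg 0 (1, 0) \<in> Alg" by (intro AlgI) (auto simp: inR_def)
  then show ?thesis by (simp add: alg_def qs_real) (simp add: qs_def qsc_0)
qed

lemma Alg_qs: "inR G x \<Longrightarrow> c \<in> Alg \<Longrightarrow> qs x c \<in> Alg"
  unfolding qs_def by (intro Alg_mult Alg_qsc)

lemma Alg_inM: "c \<in> Alg \<Longrightarrow> inM G c"
  by (elim AlgE) (auto simp: alg_def intro!: inM_add inM_qs g0D(3)[OF N])

lemma Alg_star: assumes "G = GU" "c \<in> Alg" shows "mstar c \<in> Alg"
proof -
  obtain x y where c: "inR G x" "inR G y" "c = alg x y" using assms(2) by (rule AlgE)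
  have "mstar c = alg (qconj x) (- qconj y)"
    unfolding c alg_def mstar_add mstar_qs ahD(2)[OF g0D(1)[OF N] assms(1)]
    by (simp add: qs_minus qs_minus_left)
  then show ?thesis using c by (auto intro!: AlgI inR_closed)
qed

lemma Alg_comm: "c \<in> Alg \<Longrightarrow> d \<in> Alg \<Longrightarrow> c \<star> d = d \<star> c"
proof (elim AlgE)
  fix x y x' y' assume "c = alg x y" "d = alg x' y'"
  then show "c \<star> d = d \<star> c"
    using qmul_comm[of x x'] qmul_comm[of y y'] qmul_comm[of x y'] qmul_comm[of y x']
    by (simp add: alg_mult add.commute)
qed

lemma Alg_commN: "c \<in> Alg \<Longrightarrow> c \<star> N = N \<star> c"
  using Alg_comm Alg_N by blast

text \<open>Divided by \<open>2 * D\<close>, the left side is the mean of \<open>g\<close> and its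
  conjugate by \<open>N\<close>, that is, the projection of \<open>g\<close> onto the algebra
  generated by \<open>N\<close>; traces give its coordinates.\<close>

lemma N_decomp: "msmul D g + N \<star> g \<star> N = alg (qsmul D (mtr g)) (mtr (g \<star> N))"
proof -
  obtain p q s where Nc: "N = G0 p q s" using g0_coord[OF N] by blast
  have "fst (e11 (N \<star> N)) = D" unfolding NN by (simp add: m2_defs)
  then have Dc: "D = p * p + es * (q * s)" unfolding Nc G0_mult by simp
  show ?thesis
    unfolding alg_def qs_def unfolding Dc Nc G0_def es_def eps_def
    by (cases G; rule m2_eqI; simp add: m2_defs qsc_def algebra_simps)
qed

definition C :: "'a m2 set" where "C = Alg \<inter> Gl"

text \<open>The inverse of \<open>a + b N\<close> is \<open>a - b N\<close> divided by the norm
  \<open>a * a - D * (b * b)\<close>; a nonunit norm would make \<open>a\<close> and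
  \<open>b\<close> divisible by \<pi>.\<close>

lemma alg_norm_GL:
  assumes "G = GL" "c \<in> Alg" "cg 1 (c \<star> B) mI"
  shows "\<exists>c'\<in>Alg. c' \<star> c = mI"
proof -
  obtain x y where c: "inR G x" "inR G y" "c = alg x y" using assms(2) by (rule AlgE)
  obtain a b where ab: "x = (a, 0)" "y = (b, 0)"
    using c assms(1) by (cases x; cases y) (auto simp: inR_def)
  have c': "c = msmul a mI + msmul b N" unfolding c alg_def ab qs_real ..
  let ?n = "a * a - D * (b * b)"
  have "\<not> \<pi> dvd ?n"
  proof
    assume "\<pi> dvd ?n"
    then have "\<pi> dvd a" "\<pi> dvd b" using nonsquare_norm[OF nonsq] by blast+
    then obtain a' b' where "a = \<pi> * a'" "b = \<pi> * b'" by (meson dvdE)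
    then have "c = msmul (\<pi> ^ 1) (msmul a' mI + msmul b' N)" unfolding c' by (simp add: msmul_add)
    then have "cg 1 c 0" unfolding mcong_0_iff by blast
    then have "cg 1 (c \<star> B) 0" using mcong_mult_right[of \<pi> 1 c 0 \<delta> B] by simp
    then show False using assms(3) mI_not_cong_0[of 1] mcong_sym mcong_trans by blast
  qed
  then obtain v where v: "?n * v = 1" using unit_ex by blast
  let ?c = "msmul v (msmul a mI - msmul b N)"
  have "?c \<star> c = msmul v (msmul (a * a) mI - msmul (b * b) (N \<star> N))"
    unfolding c' by (simp add: mm_ring mult_ac)
  also have "\<dots> = msmul (?n * v) mI"
    unfolding NN by (simp add: msmul_diff_left[symmetric] msmul_diff[symmetric] mult.commute)
  finally have "?c \<star> c = mI" using v by simp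
  moreover have "?c \<in> Alg" by (intro Alg_msmul Alg_diff Alg_mI Alg_N)
  ultimately show ?thesis by blast
qed

text \<open>The factor \<open>1 - d / 2\<close> is the first-order part of
  \<open>(1 + d) ^ (-1/2)\<close> for the defect \<open>d = mstar c \<star> c - mI\<close>. The new
  defect is of second order in \<open>d\<close>, and \<open>m + 1 \<le> 2 m\<close>.\<close>

lemma unitarize_step:
  assumes GU: "G = GU" and c: "c \<in> Alg" and m: "1 \<le> m" and u: "cg m (mstar c \<star> c) mI"
  shows "\<exists>c'\<in>Alg. cg m c' c \<and> cg (m + 1) (mstar c' \<star> c') mI"
proof -
  define d where "d = mstar c \<star> c - mI"
  have dA: "d \<in> Alg" unfolding d_def using c Alg_star[OF GU c] by (intro Alg_diff Alg_mult Alg_mI)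
  have ds: "mstar d = d" unfolding d_def by (simp add: mstar_diff mstar_mult)
  have "cg m d 0" unfolding d_def using u mcong_diff by blast
  then obtain z where z: "d = msmul (\<pi> ^ m) z" using mcong_0_iff by blast
  have dm: "cg m d 0" by fact
  have dd: "cg (m + m) (d \<star> d) 0"
  proof -
    have "d \<star> d = msmul (\<pi> ^ (m + m)) (z \<star> z)" unfolding z by (simp add: mm_ring power_add)
    then show ?thesis by (simp only: mcong_pow_0 order_refl)
  qed
  define c' where "c' = c - msmul hf (c \<star> d)"
  have "c' \<in> Alg" unfolding c'_def by (intro Alg_diff Alg_msmul Alg_mult c dA)
  moreover have "cg m c' c"
  proof -
    have "cg m (c - msmul hf (c \<star> d)) (c - msmul hf (c \<star> 0))"
      by (intro mcong_sub mcong_msmul mcong_mult_left dm mcong_refl)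
    then show ?thesis by (simp add: c'_def)
  qed
  moreover have "cg (m + 1) (mstar c' \<star> c') mI"
  proof -
    have cc: "mstar c \<star> c = mI + d" by (simp add: d_def)
    have ccd: "mstar c \<star> (c \<star> Y) = Y + d \<star> Y" for Y
      using cc by (simp add: mm_assoc[symmetric] mm_add_left)
    have "mstar c' \<star> c' = mstar c \<star> c - msmul hf (mstar c \<star> (c \<star> d)) - msmul hf (d \<star> (mstar c \<star> c))
        + msmul (hf * hf) (d \<star> (mstar c \<star> (c \<star> d)))"
      unfolding c'_def by (simp add: mstar_diff mstar_msmul mstar_mult ds mm_ring)
    also have "\<dots> = mI + (d - msmul hf (d + d)) - msmul hf (d \<star> d + d \<star> d) + msmul (hf * hf) (d \<star> d + d \<star> d \<star> d)"
      unfolding ccd cc by (simp add: mm_ring algebra_simps)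
    also have "\<dots> = mI - d \<star> d + msmul (hf * hf) (d \<star> d + d \<star> d \<star> d)"
      unfolding msmul_half by simp
    finally have e: "mstar c' \<star> c' = mI - d \<star> d + msmul (hf * hf) (d \<star> d + d \<star> d \<star> d)" .
    have "cg (m + m) (mI - d \<star> d + msmul (hf * hf) (d \<star> d + d \<star> d \<star> d)) (mI - 0 + msmul (hf * hf) (0 + 0 \<star> d))"
      by (intro mcong_add mcong_sub mcong_msmul mcong_mult_right dd mcong_refl)
    then have "cg (m + m) (mstar c' \<star> c') mI" unfolding e by simp
    then show ?thesis by (rule mcong_mono) (use m in simp)
  qed
  ultimately show ?thesis by blast
qed

lemma unitarize:
  assumes GU: "G = GU" and c: "c \<in> Alg" and m: "1 \<le> m" and u: "cg m (mstar c \<star> c) mI"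
  shows "\<exists>c'\<in>Alg. cg m c' c \<and> cg (m + n) (mstar c' \<star> c') mI"
proof (induction n)
  case 0
  then show ?case using c u by (intro bexI[of _ c]) auto
next
  case (Suc n)
  then obtain c' where c': "c' \<in> Alg" "cg m c' c" "cg (m + n) (mstar c' \<star> c') mI" by blast
  obtain c'' where "c'' \<in> Alg" "cg (m + n) c'' c'" "cg (m + n + 1) (mstar c'' \<star> c'') mI"
    using unitarize_step[OF GU c'(1) _ c'(3)] m by auto
  then show ?case using mcong_trans[OF mcong_mono[of \<pi> "m + n" c'' c' m] c'(2)] by auto
qed

lemma C_star_inverse:
  assumes "G = GU" "c \<in> Alg" "cg l (mstar c \<star> c) mI"
  shows "c \<in> C"
proof -
  have "c \<star> mstar c = mstar c \<star> c" using Alg_comm[OF assms(2) Alg_star[OF assms(1,2)]] .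
  then have "c \<in> Gl"
    using assms Alg_inM[OF assms(2)] inM_star by (intro GsetI[of c "mstar c"]) auto
  then show ?thesis using assms(2) unfolding C_def by blast
qed

text \<open>For \<open>GL\<close> the element \<open>c\<close> is itself invertible. For
  \<open>GU\<close> it is unitary only modulo \<open>\<pi> ^ m\<close> and is corrected inside
  \<open>Alg\<close> without leaving its class modulo \<open>\<pi> ^ m\<close>.\<close>

lemma alg_lift:
  assumes c: "c \<in> Alg" and m: "1 \<le> m" and GLc: "G = GL \<Longrightarrow> \<exists>B. cg 1 (c \<star> B) mI"
    and GUc: "G = GU \<Longrightarrow> cg m (mstar c \<star> c) mI"
  shows "\<exists>c'\<in>C. cg m c' c"
proof (cases G)
  case GL
  obtain c' where c': "c' \<in> Alg" "c' \<star> c = mI" using alg_norm_GL[OF GL c] GLc[OF GL] by blast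
  then have "c \<star> c' = mI" using Alg_comm[OF c'(1) c] by simp
  then have "c \<in> Gl" using c' Alg_inM[OF c] Alg_inM[OF c'(1)] GL by (intro GsetI[of c c']) auto
  then have "c \<in> C" using c unfolding C_def by blast
  then show ?thesis by (intro bexI[of _ c]) simp_all
next
  case GU
  obtain c' where c': "c' \<in> Alg" "cg m c' c" "cg (m + l) (mstar c' \<star> c') mI"
    using unitarize[OF GU c m GUc[OF GU]] by blast
  have "c' \<in> C" by (rule C_star_inverse[OF GU c'(1) mcong_mono[OF c'(3)]]) simp
  then show ?thesis using c' by blast
qed

lemma C_inverse:
  assumes c: "c \<in> C"
  shows "\<exists>c'. c' \<in> C \<and> cg l (c' \<star> c) mI \<and> cg l (c \<star> c') mI \<and> (G = GU \<longrightarrow> c' = mstar c)"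
proof (cases G)
  case GL
  have cA: "c \<in> Alg" "c \<in> Gl" using c by (auto simp: C_def)
  have "cg 1 (c \<star> minv G \<delta> \<pi> l c) mI" using mcong_mono[OF GsetD(4)[OF cA(2)]] l by simp
  then obtain c' where c': "c' \<in> Alg" "c' \<star> c = mI" using alg_norm_GL[OF GL cA(1)] by blast
  then have cc: "c \<star> c' = mI" using Alg_comm[OF c'(1) cA(1)] by simp
  then have "c' \<in> Gl" using c' Alg_inM[OF cA(1)] Alg_inM[OF c'(1)] GL by (intro GsetI[of c' c]) auto
  then have "c' \<in> C" using c' unfolding C_def by blast
  then show ?thesis using c' cc GL by (intro exI[of _ c']) simp
next
  case GU
  have cA: "c \<in> Alg" "c \<in> Gl" using c by (auto simp: C_def)
  have u: "cg l (mstar c \<star> c) mI" by (rule GsetD(2)[OF cA(2) GU])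
  have e: "c \<star> mstar c = mstar c \<star> c" using Alg_comm[OF cA(1) Alg_star[OF GU cA(1)]] .
  have "mstar c \<in> C" by (rule C_star_inverse[OF GU Alg_star[OF GU cA(1)]]) (use u e in simp)
  then show ?thesis using u e by auto
qed

text \<open>In the unitary case the inverse modulo \<open>\<pi>\<^sup>l\<close> is the exact adjoint, so that conjugation maps
  anti-hermitian lifts to anti-hermitian lifts.\<close>
definition ct :: "'a m2 \<Rightarrow> 'a m2" where
  "ct c = (SOME c'. c' \<in> C \<and> cg l (c' \<star> c) mI \<and> cg l (c \<star> c') mI \<and> (G = GU \<longrightarrow> c' = mstar c))"

lemma ct: assumes "c \<in> C"
  shows "ct c \<in> C" "cg l (ct c \<star> c) mI" "cg l (c \<star> ct c) mI" "G = GU \<Longrightarrow> ct c = mstar c"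
proof -
  have "ct c \<in> C \<and> cg l (ct c \<star> c) mI \<and> cg l (c \<star> ct c) mI \<and> (G = GU \<longrightarrow> ct c = mstar c)"
    unfolding ct_def by (rule someI_ex[OF C_inverse[OF assms]])
  then show "ct c \<in> C" "cg l (ct c \<star> c) mI" "cg l (c \<star> ct c) mI" "G = GU \<Longrightarrow> ct c = mstar c" by auto
qed

lemma C_D: "c \<in> C \<Longrightarrow> c \<in> Alg" "c \<in> C \<Longrightarrow> c \<in> Gl"
  by (auto simp: C_def)

text \<open>Since \<open>g\<close> commutes with \<open>N\<close> modulo \<open>\<pi> ^ r\<close>,
  it agrees there with its projection \<open>c0\<close> onto \<open>Alg\<close>. A lift of
  \<open>c0\<close> to \<open>C\<close> is split off, leaving a factor in
  \<open>K\<^sup>r\<close>.\<close>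

lemma stab_decomp:
  assumes g: "g \<in> Gl" and comm: "cg r (g \<star> N) (N \<star> g)"
  shows "\<exists>c\<in>C. \<exists>k\<in>Kset G \<delta> \<pi> l r. cg l g (c \<star> k)"
proof -
  obtain v where v: "(2 * D) * v = 1" using unit_ex[of "2 * D"] pi_prime pi_2 D_unit by blast
  define c0 where "c0 = msmul v (alg (qsmul D (mtr g)) (mtr (g \<star> N)))"
  have gM: "inM G g" by (rule GsetD(1)[OF g])
  have trR: "inR G (mtr X)" if "inM G X" for X using that by (auto simp: inR_def inM_def mtr_def qadd_def)
  have c0A: "c0 \<in> Alg" unfolding c0_def
    by (intro Alg_msmul AlgI inR_closed trR inM_mult gM g0D(3)[OF N])
  have "cg r (msmul D g + N \<star> g \<star> N) (msmul D g + g \<star> N \<star> N)"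
    by (intro mcong_add mcong_refl mcong_mult_right mcong_sym[OF comm])
  also have "msmul D g + g \<star> N \<star> N = msmul (2 * D) g"
    by (simp add: mm_assoc NN msmul_mult_right msmul_add_left[symmetric])
  finally have "cg r c0 (msmul v (msmul (2 * D) g))"
    unfolding c0_def N_decomp[symmetric] by (rule mcong_msmul)
  then have c0g: "cg r c0 g" using v by (simp add: mult.commute)
  have "\<exists>c\<in>C. cg r c c0"
  proof (rule alg_lift[OF c0A r1])
    have "cg 1 (c0 \<star> minv G \<delta> \<pi> l g) (g \<star> minv G \<delta> \<pi> l g)"
      by (intro mcong_mult_right mcong_mono[OF c0g r1])
    then show "\<exists>B. cg 1 (c0 \<star> B) mI" using mcong_trans[OF _ mcong_mono[OF GsetD(4)[OF g]]] l by fastforce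
    show "cg r (mstar c0 \<star> c0) mI" if "G = GU"
      using mcong_trans[OF mcong_mult[OF mcong_star[OF c0g] c0g] mcong_mono[OF GsetD(2)[OF g that] l2l(3)]] .
  qed
  then obtain c where c: "c \<in> C" "cg r c c0" by blast
  have cg: "cg r c g" by (rule mcong_trans[OF c(2) c0g])
  define k where "k = ct c \<star> g"
  have "k \<in> Gl" unfolding k_def by (rule Gset_mult[OF C_D(2)[OF ct(1)[OF c(1)]] g])
  moreover have "cg r k mI"
    unfolding k_def using mcong_trans[OF mcong_mult_left[OF mcong_sym[OF cg]] mcong_mono[OF ct(2)[OF c(1)] l2l(3)]] .
  ultimately have "k \<in> Kset G \<delta> \<pi> l r" by (rule KsetI)
  moreover have "cg l g (c \<star> k)"
    unfolding k_def using mcong_sym[OF mcong_mult_right[OF ct(3)[OF c(1)], of \<delta> g]] by (simp add: mm_assoc)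
  ultimately show ?thesis using c(1) by blast
qed

text \<open>The orthogonal complement of \<open>N\<close> in \<open>g0\<close>; equivalently, the
  elements of \<open>g0\<close> that anticommute with \<open>N\<close>.\<close>

definition W :: "'a m2 set" where "W = {w \<in> g0. tf w N = 0}"

lemma WD: "w \<in> W \<Longrightarrow> w \<in> g0" "w \<in> W \<Longrightarrow> tf w N = 0"
  by (auto simp: W_def)

lemma W_anti: assumes "w \<in> W" shows "w \<star> N = - (N \<star> w)"
  using g0_anticomm[OF WD(1)[OF assms] N] WD(2)[OF assms] by (simp add: eq_neg_iff_add_eq_0)

lemma WI: assumes "w \<in> g0" "w \<star> N + N \<star> w = 0" shows "w \<in> W"
proof -
  have "msmul (tf w N) mI = 0" using g0_anticomm[OF assms(1) N] assms(2) by simp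
  then have "fst (e11 (msmul (tf w N) mI)) = 0" by (simp add: m2_defs)
  then show ?thesis using assms(1) by (simp add: W_def m2_defs)
qed

lemma W_closed: "0 \<in> W" "v \<in> W \<Longrightarrow> w \<in> W \<Longrightarrow> v + w \<in> W" "v \<in> W \<Longrightarrow> - v \<in> W" "v \<in> W \<Longrightarrow> msmul a v \<in> W"
  "v \<in> W \<Longrightarrow> w \<in> W \<Longrightarrow> v - w \<in> W"
  by (auto simp: W_def tf_lin intro: g0_add g0_0 g0_minus g0_msmul g0_diff)

definition act :: "'a m2 \<Rightarrow> 'a m2 \<Rightarrow> 'a m2" where "act c w = c \<star> w \<star> ct c"

lemma act_W: assumes c: "c \<in> C" and w: "w \<in> W" shows "act c w \<in> W"
proof (rule WI)
  note t = ct[OF c]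
  note A = C_D(1)[OF c] C_D(1)[OF t(1)]
  have "mstar (act c w) = - act c w" if "G = GU"
    unfolding act_def t(4)[OF that] using ahD(2)[OF g0D(1)[OF WD(1)[OF w]] that] by (simp add: mstar_mult mm_ring)
  moreover have "inM G (act c w)"
    unfolding act_def by (intro inM_mult Alg_inM A g0D(3) WD(1) w)
  moreover have "mtr (act c w) = 0"
  proof -
    \<comment> \<open>\<open>ct c \<star> c\<close> is the identity only modulo
      \<open>\<pi> ^ l\<close>, but it lies in \<open>Alg\<close>, and \<open>w\<close> is
      orthogonal to all of \<open>Alg\<close>, so the trace is exactly zero.\<close>
    obtain x y where xy: "ct c \<star> c = alg x y" using Alg_mult[OF A(2,1)] by (auto elim: AlgE)
    have "mtr (act c w) = mtr (alg x y \<star> w)"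
      unfolding act_def xy[symmetric] using mtr_comm[of \<delta> "c \<star> w" "ct c"] by (simp add: mm_assoc)
    also have "\<dots> = 0"
      using g0D(2)[OF WD(1)[OF w]] mtr_g0[OF N WD(1)[OF w]] WD(2)[OF w]
      by (simp add: alg_def mm_add_left qs_mult_left mtr_add mtr_qs tf_sym[of N] qmul_def zero_prod_def)
    finally show ?thesis .
  qed
  ultimately show "act c w \<in> g0" unfolding g0_def ah_def by simp
  have "act c w \<star> N + N \<star> act c w = c \<star> (w \<star> N + N \<star> w) \<star> ct c"
  proof -
    have "act c w \<star> N = c \<star> w \<star> N \<star> ct c" unfolding act_def using Alg_commN[OF A(2)] by (simp add: mm_assoc)
    moreover have "N \<star> act c w = c \<star> (N \<star> w) \<star> ct c"
      unfolding act_def using Alg_commN[OF A(1)] by (simp add: mm_assoc[symmetric])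
    ultimately show ?thesis by (simp add: mm_ring)
  qed
  then show "act c w \<star> N + N \<star> act c w = 0" using W_anti[OF w] by simp
qed

lemma act_commute: assumes "c \<in> C" shows "cg l (act c w \<star> c) (c \<star> w)"
  unfolding act_def using mcong_mult_left[OF ct(2)[OF assms], of \<delta> "c \<star> w"] by (simp add: mm_assoc)

lemma act_lin: "act c (v + w) = act c v + act c w" "act c (- v) = - act c v" "act c (v - w) = act c v - act c w"
  "act c (msmul a v) = msmul a (act c v)" "act c 0 = 0"
  by (simp_all add: act_def mm_ring)

lemma act_cong: "cg k v w \<Longrightarrow> cg k (act c v) (act c w)"
  unfolding act_def by (intro mcong_mult_left mcong_mult_right)

lemma cancel_right: assumes "c \<in> C" "k \<le> l" "cg k (X \<star> c) (Y \<star> c)" shows "cg k X Y"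
proof -
  have 1: "cg k (Z \<star> c \<star> ct c) Z" for Z
    using mcong_mult_left[OF mcong_mono[OF ct(3)[OF assms(1)] assms(2)], of \<delta> Z] by (simp add: mm_assoc)
  have "cg k (X \<star> c \<star> ct c) (Y \<star> c \<star> ct c)" by (rule mcong_mult_right[OF assms(3)])
  then show ?thesis using 1 mcong_sym mcong_trans by blast
qed

lemma cancel_left: assumes "c \<in> C" "k \<le> l" "cg k (c \<star> X) (c \<star> Y)" shows "cg k X Y"
proof -
  have 1: "cg k (ct c \<star> (c \<star> Z)) Z" for Z
    using mcong_mult_right[OF mcong_mono[OF ct(2)[OF assms(1)] assms(2)], of \<delta> Z] by (simp add: mm_assoc)
  have "cg k (ct c \<star> (c \<star> X)) (ct c \<star> (c \<star> Y))" by (rule mcong_mult_left[OF assms(3)])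
  then show ?thesis using 1 mcong_sym mcong_trans by blast
qed

lemma act_inj: assumes c: "c \<in> C" and k: "k \<le> l" and a: "cg k (act c v) (act c w)" shows "cg k v w"
proof (rule cancel_left[OF c k])
  have 1: "cg k (act c u \<star> c) (c \<star> u)" for u by (rule mcong_mono[OF act_commute[OF c] k])
  show "cg k (c \<star> v) (c \<star> w)"
    using mcong_trans[OF mcong_sym[OF 1] mcong_trans[OF mcong_mult_right[OF a] 1]] .
qed

text \<open>Scalars are central and \<open>N\<close> anticommutes with \<open>W\<close>, so only the
  \<open>N\<close>-coordinate contributes.\<close>

lemma alg_bracket_W: assumes "w \<in> W" shows "alg x y \<star> w - w \<star> alg x y = msmul 2 (qs y (N \<star> w))"
proof -
  have "alg x y \<star> w - w \<star> alg x y = qs y (N \<star> w) - qs y (w \<star> N)"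
    by (simp add: alg_def mm_ring qs_ring)
  also have "\<dots> = qs y (N \<star> w) + qs y (N \<star> w)" using W_anti[OF assms] by (simp add: qs_minus)
  also have "\<dots> = msmul (1 + 1) (qs y (N \<star> w))" by (simp only: msmul_add_left msmul_1)
  finally show ?thesis by simp
qed

lemma act_trivial:
  assumes c: "c \<in> C" "c = alg x y" "qcong \<pi> 1 y 0" and w: "w \<in> W"
  shows "cg 1 (act c w) w"
proof (rule cancel_right[OF c(1)])
  have "cg 1 (c \<star> w - w \<star> c) (msmul 2 0)"
    unfolding c(2) alg_bracket_W[OF w] by (intro mcong_msmul qcong_0_qs c(3))
  then have "cg 1 (c \<star> w - w \<star> c) 0" by (simp only: msmul_zero)
  then have "cg 1 (c \<star> w) (w \<star> c)" using mcong_diff by blast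
  moreover have "cg 1 (act c w \<star> c) (c \<star> w)" using mcong_mono[OF act_commute[OF c(1)]] l by simp
  ultimately show "cg 1 (act c w \<star> c) (w \<star> c)" using mcong_trans by blast
qed (use l in simp)

text \<open>A fixed \<open>w\<close> makes the commutator \<open>2 y N w\<close> vanish modulo
  \<pi>, and \<open>2\<close>, \<open>y\<close> and \<open>N\<close> are all invertible
  there.\<close>

lemma act_fixfree:
  assumes c: "c \<in> C" "c = alg x y" "\<not> qcong \<pi> 1 y 0" and w: "w \<in> W" and fx: "cg 1 (act c w) w"
  shows "cg 1 w 0"
proof -
  have "cg 1 (act c w \<star> c) (c \<star> w)" using mcong_mono[OF act_commute[OF c(1)]] l by simp
  then have "cg 1 (c \<star> w) (w \<star> c)" using mcong_mult_right[OF fx] mcong_sym mcong_trans by blast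
  then have "cg 1 (c \<star> w - w \<star> c) 0" using mcong_diff by blast
  then have "cg 1 (msmul 2 (qs y (N \<star> w))) (msmul 2 0)"
    unfolding c(2) alg_bracket_W[OF w] by simp
  then have "cg 1 (qs y (N \<star> w)) 0" by (rule mcong_unit_cancel[OF pi_2])
  then have "cg 1 (N \<star> w) 0" by (rule qs_cancel[OF c(3)])
  then have "cg 1 (N \<star> (N \<star> w)) (N \<star> 0)" by (rule mcong_mult_left)
  then have "cg 1 (msmul D w) (msmul D 0)" by (simp add: mm_assoc[symmetric] NN msmul_mult_left)
  then show ?thesis by (rule mcong_unit_cancel[OF D_unit])
qed

text \<open>By the orthogonality relation, half of \<open>tf w w\<close> times
  \<open>s1 * s1\<close>, and likewise times \<open>q1 * q1\<close>, is a value of the norm form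
  \<open>x * x - D * (y * y)\<close>, which is anisotropic modulo \<pi>.\<close>

lemma W_anisotropic:
  assumes w: "w \<in> W" and nz: "\<not> cg 1 w 0"
  shows "\<not> \<pi> dvd tf w w"
proof
  assume iso: "\<pi> dvd tf w w"
  obtain p1 q1 s1 where Nc: "N = G0 p1 q1 s1" using g0_coord[OF N] by blast
  obtain p q s where wc: "w = G0 p q s" using g0_coord[OF WD(1)[OF w]] by blast
  have "fst (e11 (N \<star> N)) = D" unfolding NN by (simp add: m2_defs)
  then have Dc: "D = p1 * p1 + es * (q1 * s1)" unfolding Nc G0_mult by simp
  have orth: "2 * (p * p1) + es * (q * s1 + s * q1) = 0" using WD(2)[OF w] unfolding Nc wc tf_G0 .
  have "\<pi> dvd 2 * (p * p + es * (q * s))" using iso unfolding wc tf_G0 by (simp add: algebra_simps)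
  then have iso': "\<pi> dvd p * p + es * (q * s)" using pi_prime pi_2 by blast
  have s: "\<pi> dvd s"
  proof -
    have "(p * s1 - p1 * s) * (p * s1 - p1 * s) - D * (s * s) =
       (p * p + es * (q * s)) * (s1 * s1) - (2 * (p * p1) + es * (q * s1 + s * q1)) * (s * s1)"
      unfolding Dc by (simp add: algebra_simps)
    then have "\<pi> dvd (p * s1 - p1 * s) * (p * s1 - p1 * s) - D * (s * s)" using iso' orth by simp
    then show ?thesis by (rule nonsquare_norm(2)[OF nonsq])
  qed
  have q: "\<pi> dvd q"
  proof -
    have "(p * q1 - p1 * q) * (p * q1 - p1 * q) - D * (q * q) =
       (p * p + es * (q * s)) * (q1 * q1) - (2 * (p * p1) + es * (q * s1 + s * q1)) * (q * q1)"
      unfolding Dc by (simp add: algebra_simps)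
    then have "\<pi> dvd (p * q1 - p1 * q) * (p * q1 - p1 * q) - D * (q * q)" using iso' orth by simp
    then show ?thesis by (rule nonsquare_norm(2)[OF nonsq])
  qed
  have "\<pi> dvd p * p + es * (q * s) - es * (q * s)" using iso' q by (intro dvd_diff) auto
  then have "\<pi> dvd p" using pi_prime[of p p] by simp
  then have "cg 1 w 0" using q s unfolding wc by (simp add: mcong_iff_dvd m2_defs G0_def)
  then show False using nz by simp
qed

end

section \<open>Truncated exponentials\<close>

context setting
begin

lemma finite_m2: "\<exists>F. finite F \<and> (\<forall>A. \<exists>B\<in>F. cg k B A)"
proof -
  obtain F0 where F0: "finite F0" "\<And>x. \<exists>y\<in>F0. \<pi> ^ k dvd x - y" using finite_residues by blast
  define P where "P = F0 \<times> F0"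
  define F where "F = (\<lambda>(a, b, c, d). M2 a b c d) ` (P \<times> P \<times> P \<times> P)"
  have q: "\<exists>y\<in>P. qcong \<pi> k y x" for x
  proof -
    obtain u v where "u \<in> F0" "\<pi> ^ k dvd fst x - u" "v \<in> F0" "\<pi> ^ k dvd snd x - v" using F0(2) by meson
    then show ?thesis unfolding P_def qcong_def
      by (intro bexI[of _ "(u, v)"]) (auto, (metis dvd_minus_iff minus_diff_eq)+)
  qed
  have "\<exists>B\<in>F. cg k B A" for A
  proof -
    obtain a b c d where "a \<in> P" "qcong \<pi> k a (e11 A)" "b \<in> P" "qcong \<pi> k b (e12 A)"
      "c \<in> P" "qcong \<pi> k c (e21 A)" "d \<in> P" "qcong \<pi> k d (e22 A)" using q by meson
    then show ?thesis unfolding F_def mcong_def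
      by (intro bexI[of _ "M2 a b c d"]) (auto intro!: image_eqI[of _ _ "(a, b, c, d)"])
  qed
  moreover have "finite F" unfolding F_def P_def using F0(1) by simp
  ultimately show ?thesis by blast
qed

lemma transversal_m2: "\<exists>Q. transversal (cg k) H Q"
proof -
  obtain F where "finite F" "\<And>A. \<exists>B\<in>F. cg k B A" using finite_m2 by blast
  then show ?thesis by (intro transversal_exists[OF mcong_equivp]) auto
qed

text \<open>For \<open>{N}\<close> this will be a stabilizer, for \<open>{N1, N2}\<close> the
  intersection of two.\<close>

definition cents :: "'a m2 set \<Rightarrow> 'a m2 set" where
  "cents Ms = {g \<in> Gl. \<forall>M\<in>Ms. cg r (g \<star> M) (M \<star> g)}"

lemma cents_pgroup: "pgroup (cents Ms) mm mI (cg l)"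
proof
  show "equivp (cg l)" by (rule mcong_equivp)
  show "\<exists>Q. transversal (cg l) (cents Ms) Q" by (rule transversal_m2)
  show "mI \<in> cents Ms" by (auto simp: cents_def Gset_one)
  show "A \<star> B \<star> C = A \<star> (B \<star> C)" for A B C by (rule mm_assoc)
  show "cg l (A \<star> C) (B \<star> D)" if "cg l A B" "cg l C D" for A B C D using that by (rule mcong_mult)
  show "a \<star> b \<in> cents Ms" if "a \<in> cents Ms" "b \<in> cents Ms" for a b
  proof -
    have "cg r (a \<star> b \<star> M) (M \<star> (a \<star> b))" if M: "M \<in> Ms" for M
    proof -
      have 1: "cg r (a \<star> (b \<star> M)) (a \<star> (M \<star> b))" "cg r (a \<star> M \<star> b) (M \<star> a \<star> b)"
        by (rule mcong_mult_left, use \<open>b \<in> cents Ms\<close> M in \<open>simp add: cents_def\<close>,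
            rule mcong_mult_right, use \<open>a \<in> cents Ms\<close> M in \<open>simp add: cents_def\<close>)
      then show ?thesis using mcong_trans[OF 1(1)] by (simp add: mm_assoc)
    qed
    then show ?thesis using that Gset_mult by (simp add: cents_def)
  qed
  show "\<exists>b\<in>cents Ms. cg l (a \<star> b) mI \<and> cg l (b \<star> a) mI" if a: "a \<in> cents Ms" for a
  proof -
    have aG: "a \<in> Gl" using a by (simp add: cents_def)
    let ?b = "minv G \<delta> \<pi> l a"
    note d = GsetD[OF aG]
    have "cg r (?b \<star> M) (M \<star> ?b)" if M: "M \<in> Ms" for M
    proof -
      have d': "cg r (a \<star> ?b) mI" "cg r (?b \<star> a) mI" using mcong_mono[OF d(4) l2l(3)] mcong_mono[OF d(5) l2l(3)] by auto
      have "cg r (a \<star> M) (M \<star> a)" using a M by (simp add: cents_def)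
      from mcong_mult_right[OF mcong_mult_left[OF mcong_sym[OF this], of \<delta> ?b], of \<delta> ?b]
      have 1: "cg r (?b \<star> M \<star> (a \<star> ?b)) (?b \<star> a \<star> (M \<star> ?b))" by (simp add: mm_assoc)
      have 2: "cg r (?b \<star> M \<star> (a \<star> ?b)) (?b \<star> M)" using mcong_mult_left[OF d'(1), of \<delta> "?b \<star> M"] by simp
      have 3: "cg r (?b \<star> a \<star> (M \<star> ?b)) (M \<star> ?b)" using mcong_mult_right[OF d'(2), of \<delta> "M \<star> ?b"] by simp
      show ?thesis by (rule mcong_trans[OF mcong_sym[OF 2] mcong_trans[OF 1 3]])
    qed
    then show ?thesis using Gset_minv[OF aG] d by (intro bexI[of _ ?b]) (auto simp: cents_def)
  qed
qed simp_all

lemma cents_near_one: "g \<in> Gl \<Longrightarrow> cg r g mI \<Longrightarrow> g \<in> cents Ms"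
proof -
  assume g: "g \<in> Gl" "cg r g mI"
  have "cg r (g \<star> M) (M \<star> g)" for M
  proof (rule mcong_trans[OF _ mcong_sym])
    show "cg r (g \<star> M) M" using mcong_mult_right[OF g(2), of \<delta> M] by simp
    show "cg r (M \<star> g) M" using mcong_mult_left[OF g(2), of \<delta> M] by simp
  qed
  then show ?thesis using g by (simp add: cents_def)
qed

text \<open>The exponential of \<open>\<pi> ^ r X\<close>, cut after the quadratic term. Unlike
  \<open>1 + \<pi> ^ r X\<close> it takes \<open>- X\<close> to an inverse modulo
  \<open>\<pi> ^ l\<close> for \<open>l = 2 r + 1\<close>, hence anti-hermitian matrices to unitary
  ones: the remaining error is divisible by \<open>\<pi> ^ (3 r)\<close>, and
  \<open>3 r \<ge> l\<close>.\<close>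

definition ex :: "'a m2 \<Rightarrow> 'a m2" where
  "ex X = mI + msmul (\<pi> ^ r) X + msmul (hf * \<pi> ^ (r + r)) (X \<star> X)"

lemma ex_0: "ex 0 = mI" by (simp add: ex_def)

lemma ex_near_one: "cg r (ex X) mI"
proof -
  have "cg r (ex X) (mI + 0 + 0)"
    unfolding ex_def by (intro mcong_add mcong_refl mcong_pow_0 mcong_pow_0') simp_all
  then show ?thesis by simp
qed

lemma mstar_ex: "mstar (ex X) = ex (mstar X)"
  by (simp add: ex_def mstar_add mstar_msmul mstar_mult)

lemma inM_ex: "inM G X \<Longrightarrow> inM G (ex X)"
  unfolding ex_def by (intro inM_intros)

lemma odd_l: assumes "odd l" shows "l = r + r + 1" "l2 = r + 1" "l \<le> r + r + r" "l \<le> r + r + (r + r)"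
proof -
  show e: "l = r + r + 1" using assms by presburger
  then show "l2 = r + 1" "l \<le> r + r + r" "l \<le> r + r + (r + r)" using r1 by linarith+
qed

text \<open>The Baker-Campbell-Hausdorff formula to second order. \<open>Z\<close> collects the
  terms from \<open>\<pi> ^ (3 r)\<close> on, which vanish modulo \<open>\<pi> ^ l\<close>.\<close>

lemma bch:
  assumes "odd l"
  shows "cg l (ex X \<star> ex Y) (ex (X + Y) + msmul (hf * \<pi> ^ (r + r)) (X \<star> Y - Y \<star> X))"
proof -
  define P where "P = \<pi> ^ r"
  have P2: "\<pi> ^ (r + r) = P * P" and P3: "\<pi> ^ (r + r + r) = P * P * P" unfolding P_def by (simp_all add: power_add)
  define Z where "Z = msmul hf (X \<star> (Y \<star> Y)) + msmul hf (X \<star> (X \<star> Y)) + msmul (hf * hf * P) (X \<star> (X \<star> (Y \<star> Y)))"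
  \<comment> \<open>The cross term \<open>\<pi> ^ (2 r) X Y\<close> is written as two halves, one
    for the square of \<open>X + Y\<close> and one for the bracket.\<close>
  have split: "msmul (P * P) T = msmul (hf * (P * P)) T + msmul (hf * (P * P)) T" for T
    by (simp only: msmul_add_left[symmetric] hf_add)
  have "ex X \<star> ex Y = mI + msmul P X + msmul P Y + msmul (hf * (P * P)) (X \<star> X) + msmul (hf * (P * P)) (Y \<star> Y)
      + msmul (P * P) (X \<star> Y) + msmul (P * P * P) Z"
    unfolding ex_def P2 P_def[symmetric] Z_def by (simp add: mm_ring mult_ac)
  also have "\<dots> = ex (X + Y) + msmul (hf * \<pi> ^ (r + r)) (X \<star> Y - Y \<star> X) + msmul (\<pi> ^ (r + r + r)) Z"
    unfolding ex_def P2 P3 P_def[symmetric] split by (simp add: mm_ring)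
  finally have e: "ex X \<star> ex Y = ex (X + Y) + msmul (hf * \<pi> ^ (r + r)) (X \<star> Y - Y \<star> X) + msmul (\<pi> ^ (r + r + r)) Z" .
  have "cg l (ex (X + Y) + msmul (hf * \<pi> ^ (r + r)) (X \<star> Y - Y \<star> X) + msmul (\<pi> ^ (r + r + r)) Z)
     (ex (X + Y) + msmul (hf * \<pi> ^ (r + r)) (X \<star> Y - Y \<star> X) + 0)"
    by (intro mcong_add mcong_refl mcong_pow_0 odd_l assms)
  then show ?thesis unfolding e by simp
qed

lemma ex_inverse: assumes "odd l" shows "cg l (ex X \<star> ex (- X)) mI"
  using bch[OF assms, of X "- X"] by (simp add: ex_0 mm_ring)

lemma ex_Gl: assumes "odd l" "ah X" shows "ex X \<in> Gl"
proof (rule GsetI)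
  show "cg l (ex X \<star> ex (- X)) mI" by (rule ex_inverse[OF assms(1)])
  show i: "cg l (ex (- X) \<star> ex X) mI" using ex_inverse[OF assms(1), of "- X"] by simp
  show "cg l (mstar (ex X) \<star> ex X) mI" if "G = GU"
    using i unfolding mstar_ex ahD(2)[OF assms(2) that] .
  show "inM G (ex X)" "inM G (ex (- X))" using ahD(1)[OF assms(2)] by (auto intro: inM_ex inM_minus)
qed

lemma ex_cong: assumes "odd l" "cg l2 X Y" shows "cg l (ex X) (ex Y)"
proof -
  have "cg (r + l2) (msmul (\<pi> ^ r) X) (msmul (\<pi> ^ r) Y)" by (rule mcong_scaled[OF assms(2)])
  then have 1: "cg l (msmul (\<pi> ^ r) X) (msmul (\<pi> ^ r) Y)" using l2r by (simp add: add.commute)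
  have "cg (r + r + l2) (msmul (\<pi> ^ (r + r)) (X \<star> X)) (msmul (\<pi> ^ (r + r)) (Y \<star> Y))"
    by (intro mcong_scaled mcong_mult assms)
  then have "cg l (msmul (\<pi> ^ (r + r)) (X \<star> X)) (msmul (\<pi> ^ (r + r)) (Y \<star> Y))"
    by (rule mcong_mono) (use l2r in simp)
  then have "cg l (msmul hf (msmul (\<pi> ^ (r + r)) (X \<star> X))) (msmul hf (msmul (\<pi> ^ (r + r)) (Y \<star> Y)))"
    by (rule mcong_msmul)
  then show ?thesis unfolding ex_def using 1 by (intro mcong_add mcong_refl) auto
qed

lemma ex_conj: assumes "cg l (X' \<star> c) (c \<star> X)" shows "cg l (c \<star> ex X) (ex X' \<star> c)"
proof -
  have 1: "cg l (X' \<star> X' \<star> c) (X' \<star> (c \<star> X))"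
    unfolding mm_assoc by (rule mcong_mult_left[OF assms])
  have 3: "cg l (X' \<star> (c \<star> X)) (c \<star> (X \<star> X))"
    unfolding mm_assoc[symmetric] by (rule mcong_mult_right[OF assms])
  have 2: "cg l (X' \<star> X' \<star> c) (c \<star> (X \<star> X))" by (rule mcong_trans[OF 1 3])
  have "cg l (c + msmul (\<pi> ^ r) (X' \<star> c) + msmul (hf * \<pi> ^ (r + r)) (X' \<star> X' \<star> c))
     (c + msmul (\<pi> ^ r) (c \<star> X) + msmul (hf * \<pi> ^ (r + r)) (c \<star> (X \<star> X)))"
    by (intro mcong_add mcong_refl mcong_msmul assms 2)
  then show ?thesis unfolding ex_def by (intro mcong_sym[of \<pi> l "_ \<star> c"]) (simp add: mm_ring)
qed

text \<open>Two rounds: modulo \<open>\<pi> ^ (2 r)\<close> the quadratic terms drop out, which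
  gives \<open>X = Y\<close> modulo \<open>\<pi> ^ r\<close>; then the quadratic terms agree modulo
  \<open>\<pi> ^ (3 r)\<close>, hence modulo \<open>\<pi> ^ l\<close>, and cancel.\<close>

lemma ex_inj: assumes o: "odd l" and e: "cg l (ex X) (ex Y)" shows "cg l2 X Y"
proof -
  have D: "ex X - ex Y = msmul (\<pi> ^ r) (X - Y) + msmul (hf * \<pi> ^ (r + r)) (X \<star> X - Y \<star> Y)"
    by (simp add: ex_def mm_ring algebra_simps)
  have e0: "cg l (ex X - ex Y) 0" using e mcong_diff by blast
  have "cg (r + r) (msmul (\<pi> ^ r) (X - Y)) 0"
  proof -
    have "cg (r + r) (ex X - ex Y - msmul (hf * \<pi> ^ (r + r)) (X \<star> X - Y \<star> Y)) (0 - 0)"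
      by (intro mcong_sub mcong_mono[OF e0] mcong_pow_0') simp_all
    then show ?thesis unfolding D by simp
  qed
  then have "cg (r + r) (msmul (\<pi> ^ r) (X - Y)) (msmul (\<pi> ^ r) 0)" by simp
  then have "cg r (X - Y) 0" by (simp only: mcong_scaled_iff)
  then have XY: "cg r X Y" using mcong_diff by blast
  have "cg (r + r + r) (msmul (\<pi> ^ (r + r)) (X \<star> X - Y \<star> Y)) (msmul (\<pi> ^ (r + r)) 0)"
    by (intro mcong_scaled) (use mcong_mult[OF XY XY, of \<delta>] mcong_diff in blast)
  then have "cg l (msmul (\<pi> ^ (r + r)) (X \<star> X - Y \<star> Y)) (msmul (\<pi> ^ (r + r)) 0)"
    by (rule mcong_mono[OF _ odd_l(3)[OF o]])
  then have "cg l (msmul hf (msmul (\<pi> ^ (r + r)) (X \<star> X - Y \<star> Y))) (msmul hf (msmul (\<pi> ^ (r + r)) 0))"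
    by (rule mcong_msmul)
  then have "cg l (ex X - ex Y - msmul (hf * \<pi> ^ (r + r)) (X \<star> X - Y \<star> Y)) (0 - 0)"
    by (intro mcong_sub e0) simp
  then have "cg l (msmul (\<pi> ^ r) (X - Y)) (msmul (\<pi> ^ r) 0)" unfolding D by simp
  then have "cg (r + l2) (msmul (\<pi> ^ r) (X - Y)) (msmul (\<pi> ^ r) 0)" using l2r by (simp add: add.commute)
  then have "cg l2 (X - Y) 0" by (simp only: mcong_scaled_iff)
  then show ?thesis using mcong_diff by blast
qed

lemma Kset_exp:
  assumes o: "odd l" and k: "k \<in> Kset G \<delta> \<pi> l r"
  shows "\<exists>Y. ah Y \<and> cg l k (ex Y)"
proof -
  obtain B where B: "inM G B" "cg l k (mI + msmul (\<pi> ^ r) B)" using k by (auto simp: Kset_def plus_m2_def)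
  have kG: "k \<in> Gl" using k by (simp add: Kset_def)
  \<comment> \<open>The truncated logarithm of \<open>1 + \<pi> ^ r B\<close>, divided by
    \<open>\<pi> ^ r\<close>.\<close>
  define X0 where "X0 = B - msmul (hf * \<pi> ^ r) (B \<star> B)"
  have X0M: "inM G X0" unfolding X0_def by (intro inM_intros B)
  have X0B: "cg r X0 B"
  proof -
    have "cg r X0 (B - 0)" unfolding X0_def by (intro mcong_sub mcong_refl mcong_pow_0') simp
    then show ?thesis by simp
  qed
  have "cg (r + r + r) (msmul (\<pi> ^ (r + r)) (X0 \<star> X0)) (msmul (\<pi> ^ (r + r)) (B \<star> B))"
    by (intro mcong_scaled mcong_mult X0B)
  then have "cg l (msmul (\<pi> ^ (r + r)) (X0 \<star> X0)) (msmul (\<pi> ^ (r + r)) (B \<star> B))"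
    by (rule mcong_mono[OF _ odd_l(3)[OF o]])
  then have 1: "cg l (msmul hf (msmul (\<pi> ^ (r + r)) (X0 \<star> X0))) (msmul hf (msmul (\<pi> ^ (r + r)) (B \<star> B)))"
    by (rule mcong_msmul)
  have "cg l (ex X0) (mI + msmul (\<pi> ^ r) X0 + msmul (hf * \<pi> ^ (r + r)) (B \<star> B))"
    unfolding ex_def using 1 by (intro mcong_add mcong_refl) simp
  also have "mI + msmul (\<pi> ^ r) X0 + msmul (hf * \<pi> ^ (r + r)) (B \<star> B) = mI + msmul (\<pi> ^ r) B"
    unfolding X0_def by (simp add: msmul_diff power_add mult_ac)
  finally have kX0: "cg l (ex X0) k" using mcong_trans[OF _ mcong_sym[OF B(2)]] by blast
  \<comment> \<open>Unitarity of \<open>k\<close> says that \<open>mstar X0\<close> and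
    \<open>- X0\<close> have the same exponential. By injectivity \<open>X0\<close> is
    anti-hermitian modulo \<open>\<pi> ^ l2\<close>, the precision to which \<open>ex\<close>
    depends on its argument.\<close>
  have "cg l2 (X0 + mstar X0) 0" if GU: "G = GU"
  proof -
    have "cg l (ex (mstar X0) \<star> ex X0) mI"
      using mcong_trans[OF mcong_mult[OF mcong_star[OF kX0] kX0] GsetD(2)[OF kG GU]] unfolding mstar_ex .
    from mcong_mult_right[OF this, of \<delta> "ex (- X0)"]
    have 2: "cg l (ex (mstar X0) \<star> (ex X0 \<star> ex (- X0))) (ex (- X0))" by (simp add: mm_assoc)
    have 3: "cg l (ex (mstar X0) \<star> (ex X0 \<star> ex (- X0))) (ex (mstar X0))"
      using mcong_mult_left[OF ex_inverse[OF o, of X0], of \<delta> "ex (mstar X0)"] by simp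
    have "cg l (ex (mstar X0)) (ex (- X0))" by (rule mcong_trans[OF mcong_sym[OF 3] 2])
    then have "cg l2 (mstar X0) (- X0)" by (rule ex_inj[OF o])
    then show ?thesis using mcong_diff[of \<pi> l2 "mstar X0" "- X0"] by (simp add: add.commute)
  qed
  then have "cg l2 (antisym X0) X0" by (rule antisym_cong)
  then have "cg l (ex (antisym X0)) k" using ex_cong[OF o] kX0 mcong_trans by blast
  then show ?thesis using antisym_ah[OF X0M] mcong_sym by blast
qed

end

section \<open>Representations above a cuspidal character\<close>

context cusp
begin

sublocale pg: pgroup "cents {N}" mm mI "cg l"
  by (rule cents_pgroup)

lemma C_cents: "c \<in> C \<Longrightarrow> c \<in> cents {N}"
  using Alg_commN[OF C_D(1)] C_D(2) by (simp add: cents_def)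

lemma W_div: assumes "w \<in> W" "cg 1 w 0" shows "\<exists>z\<in>W. w = msmul \<pi> z"
proof -
  obtain z where z: "z \<in> g0" "w = msmul (\<pi> ^ 1) z" using g0_div[OF WD(1)[OF assms(1)] assms(2)] by blast
  have "tf z N = 0" using WD(2)[OF assms(1)] pi_nz unfolding z(2) tf_msmul_left by simp
  then show ?thesis using z by (intro bexI[of _ z]) (auto simp: W_def)
qed

lemma ah_decomp: assumes "ah Y" shows "\<exists>u w. Y = u + w \<and> u \<in> Alg \<and> ah u \<and> w \<in> W"
proof -
  obtain z where zR: "inR G z" and zah: "ah (qsc z)" and Y0: "Y - qsc z \<in> g0"
    using ah_scalar_part[OF assms] by blast
  obtain v where v: "(2 * D) * v = 1" using unit_ex[of "2 * D"] pi_prime pi_2 D_unit by blast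
  \<comment> \<open>The coefficient of the projection to \<open>N\<close>, as
    \<open>tf N N = 2 * D\<close>.\<close>
  define y where "y = tf (Y - qsc z) N * v"
  have "tf N N = 2 * D" unfolding tf_def NN by (simp add: m2_defs)
  then have "tf (Y - qsc z - msmul y N) N = tf (Y - qsc z) N - tf (Y - qsc z) N * v * (2 * D)"
    unfolding tf_diff_left[of "Y - qsc z"] tf_msmul_left y_def by simp
  also have "\<dots> = tf (Y - qsc z) N - tf (Y - qsc z) N * ((2 * D) * v)" by (simp only: mult_ac)
  finally have "tf (Y - qsc z - msmul y N) N = 0" unfolding v by simp
  then have "Y - qsc z - msmul y N \<in> W" using Y0 N by (simp add: W_def g0_diff g0_msmul)
  moreover have "qsc z + msmul y N \<in> Alg" by (intro Alg_add Alg_qsc Alg_msmul Alg_N zR)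
  moreover have "ah (qsc z + msmul y N)" by (intro ah_add zah ah_msmul g0D(1) N)
  ultimately show ?thesis by (intro exI[of _ "qsc z + msmul y N"] exI[of _ "Y - qsc z - msmul y N"]) simp
qed

lemma ex_C: assumes "odd l" "u \<in> Alg" "ah u" shows "ex u \<in> C"
proof -
  have "ex u \<in> Alg" unfolding ex_def by (intro Alg_add Alg_msmul Alg_mult Alg_mI assms)
  then show ?thesis using ex_Gl[OF assms(1,3)] unfolding C_def by blast
qed

lemma N_W_N: assumes "v \<in> W" shows "N \<star> (v \<star> N) = - (v \<star> N \<star> N)"
proof -
  have "N \<star> v = - (v \<star> N)" using W_anti[OF assms] by simp
  then show ?thesis by (simp only: mm_assoc[symmetric] mm_minus_left)
qed

lemma WN_W: assumes "v \<in> W" shows "v \<star> N \<in> W"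
proof (rule WI)
  have "v \<star> N - N \<star> v = v \<star> N + v \<star> N" using W_anti[OF assms] by simp
  then have "v \<star> N = msmul hf (v \<star> N - N \<star> v)" by (simp only: msmul_half)
  then show "v \<star> N \<in> g0" using g0_msmul[OF g0_bracket[OF WD(1)[OF assms] N]] by metis
  show "v \<star> N \<star> N + N \<star> (v \<star> N) = 0" unfolding N_W_N[OF assms] by simp
qed

text \<open>The half comes from the half bracket in \<open>bch\<close>; the square of \<beta> is the
  commutator of the operators \<open>E\<close>.\<close>

definition \<beta> :: "'a m2 \<Rightarrow> 'a m2 \<Rightarrow> complex" where
  "\<beta> v w = \<psi> (hf * \<pi> ^ (r + r) * tf N (v \<star> w - w \<star> v))"

lemma \<beta>_sq: "(\<beta> v w)\<^sup>2 = \<psi> (\<pi> ^ (r + r) * tf N (v \<star> w - w \<star> v))"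
  unfolding \<beta>_def power2_eq_square psi_add[symmetric] by (simp add: mult.assoc hf_add)

lemma \<beta>_nondeg:
  assumes o: "odd l" and v: "v \<in> W" "\<not> cg 1 v 0"
  shows "\<exists>k\<in>W. (\<beta> k v)\<^sup>2 \<noteq> 1"
proof (rule ccontr)
  assume "\<not> ?thesis"
  then have triv: "\<And>k. k \<in> W \<Longrightarrow> (\<beta> k v)\<^sup>2 = 1" by blast
  \<comment> \<open>The test direction \<open>v N\<close> turns the pairing with \<open>v\<close>
    into the quadratic form \<open>tf v v\<close>, a unit by anisotropy.\<close>
  have e: "tf N (v \<star> N \<star> v - v \<star> (v \<star> N)) = - (2 * D) * tf v v"
  proof -
    have "N \<star> (v \<star> N) - v \<star> N \<star> N = msmul (- (2 * D)) v"
    proof -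
      have "v \<star> N \<star> N = msmul D v" by (simp add: mm_assoc NN msmul_mult_right)
      then have "N \<star> (v \<star> N) - v \<star> N \<star> N = - msmul D v - msmul D v" using N_W_N[OF v(1)] by simp
      also have "\<dots> = msmul (- D - D) v" by (simp only: msmul_diff_left msmul_minus_left)
      finally show ?thesis by simp
    qed
    then show ?thesis unfolding tf_bracket by (simp add: tf_msmul_left)
  qed
  have "\<pi> ^ (l - (r + r)) dvd - (2 * D) * tf v v"
  proof (rule psi_nondeg)
    fix z
    have "(\<beta> (msmul z (v \<star> N)) v)\<^sup>2 = 1" by (intro triv W_closed WN_W v)
    moreover have "msmul z (v \<star> N) \<star> v - v \<star> msmul z (v \<star> N) = msmul z (v \<star> N \<star> v - v \<star> (v \<star> N))"
      by (simp only: msmul_mult_left msmul_mult_right msmul_diff)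
    ultimately show "\<psi> (\<pi> ^ (r + r) * (- (2 * D) * tf v v * z)) = 1"
      unfolding \<beta>_sq by (simp only: tf_msmul_right e mult.commute mult.left_commute mult.assoc)
  qed (use odd_l[OF o] in simp)
  moreover have "l - (r + r) = 1" using odd_l(1)[OF o] by linarith
  ultimately have "\<pi> dvd 2 * D * tf v v" by simp
  then show False using W_anisotropic[OF v] pi_prime pi_2 D_unit by blast
qed

end

locale crep = cusp +
  fixes a :: "'a qe" and A :: "'a m2" and n :: nat and \<phi> :: "'a m2 \<Rightarrow> complex mat"
  assumes A: "A \<in> lie G \<pi> r" and An: "cg r A (qsc a + N)"
    and irr: "irreducible_rep G \<delta> \<pi> l (Stab G \<delta> \<pi> \<psi> l A) n \<phi>"
    and con: "contains_char (Kset G \<delta> \<pi> l l2) n \<phi> (psiA G \<delta> \<pi> \<psi> l A)"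
begin

lemma S_eq: "Stab G \<delta> \<pi> \<psi> l A = cents {N}"
proof -
  have "cg r (g \<star> A) (A \<star> g) \<longleftrightarrow> cg r (g \<star> N) (N \<star> g)" for g
  proof -
    have 1: "cg r (g \<star> A) (g \<star> (qsc a + N))" by (rule mcong_mult_left[OF An])
    have 2: "cg r (A \<star> g) ((qsc a + N) \<star> g)" by (rule mcong_mult_right[OF An])
    have "cg r (g \<star> A) (A \<star> g) \<longleftrightarrow> cg r (g \<star> (qsc a + N)) ((qsc a + N) \<star> g)"
      using mcong_trans[OF mcong_trans[OF mcong_sym[OF 1]] 2] mcong_trans[OF 1 mcong_trans[OF _ mcong_sym[OF 2]]] by blast
    moreover have "g \<star> (qsc a + N) - (qsc a + N) \<star> g = g \<star> N - N \<star> g" by (simp add: mm_ring qsc_comm)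
    ultimately show ?thesis using mcong_diff[of \<pi> r "g \<star> (qsc a + N)"] mcong_diff[of \<pi> r "g \<star> N"] by simp
  qed
  then show ?thesis using Stab_iff[OF A] by (auto simp: cents_def)
qed

definition \<Phi> :: "'a m2 \<Rightarrow> fm" where "\<Phi> g = em (\<phi> g)"

lemma rep: "is_rep G \<delta> \<pi> l (cents {N}) n \<phi>" and n0: "0 < n"
  using irr unfolding S_eq irreducible_rep_def by auto

lemma \<phi>c: "g \<in> cents {N} \<Longrightarrow> \<phi> g \<in> carrier_mat n n"
  and \<phi>_cong: "g \<in> cents {N} \<Longrightarrow> h \<in> cents {N} \<Longrightarrow> cg l g h \<Longrightarrow> \<phi> g = \<phi> h"
  and \<phi>_mult: "g \<in> cents {N} \<Longrightarrow> h \<in> cents {N} \<Longrightarrow> \<phi> (g \<star> h) = \<phi> g * \<phi> h"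
  and \<phi>_one: "\<phi> mI = 1\<^sub>m n"
  using rep unfolding is_rep_def by blast+

lemma prep: "pg.prep n \<Phi>"
  unfolding pg.prep_def \<Phi>_def
proof (intro conjI ballI impI)
  show "em (\<phi> g) \<in> blk n n" if "g \<in> cents {N}" for g using \<phi>c[OF that] by (rule em_blk)
  show "em (\<phi> g) = em (\<phi> h)" if "g \<in> cents {N}" "h \<in> cents {N}" "cg l g h" for g h
    using \<phi>_cong[OF that] by simp
  show "em (\<phi> (g \<star> h)) = em (\<phi> g) * em (\<phi> h)" if "g \<in> cents {N}" "h \<in> cents {N}" for g h
    using \<phi>_mult[OF that] em_mult[OF \<phi>c[OF that(1)] \<phi>c[OF that(2)]] by simp
  show "em (\<phi> mI) = idn n" by (simp add: \<phi>_one idn_def)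
qed

lemmas \<Phi>_blk = pg.prepD(1)[OF prep] and \<Phi>_cong = pg.prepD(2)[OF prep] and \<Phi>_mult = pg.prepD(3)[OF prep]
  and \<Phi>_one = pg.prepD(4)[OF prep]

lemma schur\<Phi>:
  assumes "X \<in> blk n n" "\<And>g. g \<in> cents {N} \<Longrightarrow> X * \<Phi> g = \<Phi> g * X"
  shows "\<exists>c. X = sm c (idn n)"
  using irreducible_rep_schur[OF irr] assms unfolding schur_def S_eq \<Phi>_def by blast

text \<open>Clifford theory: the vectors on which the subgroup acts by the character form a nonzero
  subspace, stable because the group fixes the character; irreducibility makes it
  everything.\<close>

lemma Kset_scalar:
  assumes x: "x \<in> Kset G \<delta> \<pi> l l2"
  shows "\<Phi> x = sm (psiA G \<delta> \<pi> \<psi> l A x) (idn n)"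
proof -
  let ?K = "Kset G \<delta> \<pi> l l2" and ?c = "psiA G \<delta> \<pi> \<psi> l A"
  have KS: "x \<in> cents {N}" if "x \<in> ?K" for x
    using cents_near_one[OF KsetD(1)[OF that l2l(2)] mcong_mono[OF KsetD(2)[OF that l2l(2)] rl]] .
  define V where "V = {v \<in> carrier_vec n. \<forall>x\<in>?K. \<phi> x *\<^sub>v v = ?c x \<cdot>\<^sub>v v}"
  have "is_subspace n V"
    unfolding is_subspace_def
  proof (intro conjI ballI allI)
    show "v + w \<in> V" if "v \<in> V" "w \<in> V" for v w
      using that \<phi>c[OF KS] by (auto simp: V_def mult_add_distrib_mat_vec[of _ n n] smult_add_distrib_vec[of v n])
    show "c \<cdot>\<^sub>v v \<in> V" if "v \<in> V" for c v
      using that \<phi>c[OF KS] by (auto simp: V_def mult_mat_vec[of _ n n] smult_smult_assoc mult.commute)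
    have "\<phi> x *\<^sub>v 0\<^sub>v n = ?c x \<cdot>\<^sub>v 0\<^sub>v n" if "x \<in> ?K" for x
      using \<phi>c[OF KS[OF that]] by auto
    then show "0\<^sub>v n \<in> V" by (simp add: V_def)
  qed (auto simp: V_def)
  moreover have "V \<noteq> {0\<^sub>v n}" using con unfolding contains_char_def V_def by blast
  moreover have "\<phi> g *\<^sub>v v \<in> V" if g: "g \<in> cents {N}" and v: "v \<in> V" for g v
  proof -
    have vc: "v \<in> carrier_vec n" using v by (simp add: V_def)
    have "\<phi> x *\<^sub>v (\<phi> g *\<^sub>v v) = ?c x \<cdot>\<^sub>v (\<phi> g *\<^sub>v v)" if x: "x \<in> ?K" for x
    proof -
      have gS: "g \<in> Stab G \<delta> \<pi> \<psi> l A" using g S_eq by simp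
      have gG: "g \<in> Gl" using g by (simp add: cents_def)
      define y where "y = minv G \<delta> \<pi> l g \<star> x \<star> g"
      have xd: "x \<in> Gl" "cg l2 x mI" using KsetD[OF x l2l(2)] by auto
      have yG: "y \<in> Gl" unfolding y_def by (intro Gset_mult Gset_minv gG xd)
      have "cg l2 y (minv G \<delta> \<pi> l g \<star> mI \<star> g)"
        unfolding y_def by (intro mcong_mult_right mcong_mult_left xd)
      then have "cg l2 y mI" using mcong_trans[OF _ mcong_mono[OF GsetD(5)[OF gG] l2l(2)]] by simp
      then have yK: "y \<in> ?K" by (rule KsetI[OF yG])
      have cy: "?c y = ?c x" using gS x unfolding Stab_def y_def by blast
      have "cg l (g \<star> y) (x \<star> g)"
        using mcong_mult_right[OF GsetD(4)[OF gG], of \<delta> "x \<star> g"] by (simp add: y_def mm_assoc)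
      then have "\<phi> (g \<star> y) = \<phi> (x \<star> g)"
        by (rule \<phi>_cong[OF pg.closed[OF g KS[OF yK]] pg.closed[OF KS[OF x] g]])
      then have gy: "\<phi> g * \<phi> y = \<phi> x * \<phi> g" using \<phi>_mult[OF g KS[OF yK]] \<phi>_mult[OF KS[OF x] g] by simp
      have "\<phi> x *\<^sub>v (\<phi> g *\<^sub>v v) = (\<phi> x * \<phi> g) *\<^sub>v v"
        by (rule assoc_mult_mat_vec[OF \<phi>c[OF KS[OF x]] \<phi>c[OF g] vc, symmetric])
      also have "\<dots> = \<phi> g *\<^sub>v (\<phi> y *\<^sub>v v)"
        unfolding gy[symmetric] by (rule assoc_mult_mat_vec[OF \<phi>c[OF g] \<phi>c[OF KS[OF yK]] vc])
      also have "\<phi> y *\<^sub>v v = ?c x \<cdot>\<^sub>v v" using v yK cy by (simp add: V_def)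
      also have "\<phi> g *\<^sub>v (?c x \<cdot>\<^sub>v v) = ?c x \<cdot>\<^sub>v (\<phi> g *\<^sub>v v)" by (rule mult_mat_vec[OF \<phi>c[OF g] vc])
      finally show ?thesis .
    qed
    then show ?thesis using mult_mat_vec_carrier[OF \<phi>c[OF g] vc] by (simp add: V_def)
  qed
  ultimately have "V = carrier_vec n" using irr unfolding irreducible_rep_def S_eq by blast
  then have "\<phi> x = ?c x \<cdot>\<^sub>m 1\<^sub>m n"
    using x by (intro mat_scalar_of_action \<phi>c KS) (auto simp: V_def)
  then show ?thesis by (simp add: \<Phi>_def em_smult idn_def)
qed

text \<open>The scalar part of \<open>A\<close> does not contribute, as \<open>B\<close> is
  traceless. Deeper levels \<open>i\<close> are reduced to \<open>l2\<close> by absorbing a power of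
  \<pi> into \<open>B\<close>.\<close>

lemma \<Phi>_one_plus:
  assumes B: "B \<in> g0" and i: "l2 \<le> i"
  shows "mI + msmul (\<pi> ^ i) B \<in> cents {N}" "\<Phi> (mI + msmul (\<pi> ^ i) B) = sm (\<psi> (\<pi> ^ i * tf N B)) (idn n)"
proof -
  let ?x = "mI + msmul (\<pi> ^ i) B"
  have xG: "?x \<in> Gl" by (rule one_plus_Kset[OF g0D(1)[OF B]]) (use i l2l in linarith)
  have "cg i ?x mI" by (auto simp: mcong_iff)
  then have x1: "cg l2 ?x mI" by (rule mcong_mono[OF _ i])
  have xK: "?x \<in> Kset G \<delta> \<pi> l l2" by (rule KsetI[OF xG x1])
  show "?x \<in> cents {N}" by (rule cents_near_one[OF xG mcong_mono[OF x1 rl]])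
  define B' where "B' = msmul (\<pi> ^ (i - l2)) B"
  have B': "B' \<in> g0" unfolding B'_def by (rule g0_msmul[OF B])
  have "\<pi> ^ i = \<pi> ^ l2 * \<pi> ^ (i - l2)" using i by (metis le_add_diff_inverse power_add)
  then have xB': "?x = mI + msmul (\<pi> ^ l2) B'" and tB': "\<pi> ^ l2 * tf N B' = \<pi> ^ i * tf N B"
    by (simp_all add: B'_def tf_msmul_right)
  have "mtr ((qsc a + N) \<star> B') = (tf N B', 0)"
    using mtr_qs[of a B'] g0D(2)[OF B'] mtr_g0[OF N B']
    by (simp add: mm_add_left mtr_add qs_def) (simp add: qmul_def zero_prod_def)
  then have "psiA G \<delta> \<pi> \<psi> l (qsc a + N) ?x = \<psi> (\<pi> ^ i * tf N B)"
    using psiA_eq[OF g0D(3)[OF B'], of ?x "qsc a + N"] unfolding xB' tB'[symmetric]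
    by (simp add: qsmul_def bigpsi_real)
  then show "\<Phi> ?x = sm (\<psi> (\<pi> ^ i * tf N B)) (idn n)"
    using Kset_scalar[OF xK] psiA_cong[OF An xK] by simp
qed

lemma \<Phi>_C_inverse:
  assumes "c \<in> C" shows "\<Phi> c * \<Phi> (ct c) = idn n" "\<Phi> (ct c) * \<Phi> c = idn n"
proof -
  note t = ct[OF assms]
  have "\<Phi> (c \<star> ct c) = \<Phi> mI" "\<Phi> (ct c \<star> c) = \<Phi> mI"
    by (rule \<Phi>_cong[OF pg.closed[OF C_cents C_cents] pg.one]; (rule assms t))+
  then show "\<Phi> c * \<Phi> (ct c) = idn n" "\<Phi> (ct c) * \<Phi> c = idn n"
    using \<Phi>_mult[OF C_cents[OF assms] C_cents[OF t(1)]] \<Phi>_mult[OF C_cents[OF t(1)] C_cents[OF assms]] \<Phi>_one by simp_all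
qed

lemma \<Phi>_C_comm: assumes "c \<in> C" "d \<in> C" shows "\<Phi> c * \<Phi> d = \<Phi> d * \<Phi> c"
  using \<Phi>_mult[OF C_cents[OF assms(1)] C_cents[OF assms(2)]] \<Phi>_mult[OF C_cents[OF assms(2)] C_cents[OF assms(1)]]
    Alg_comm[OF C_D(1)[OF assms(1)] C_D(1)[OF assms(2)]] by simp

lemma Kset_cents: "k \<in> Kset G \<delta> \<pi> l r \<Longrightarrow> k \<in> cents {N}"
  using cents_near_one KsetD[OF _ l2l(3)] by blast

lemma \<Phi>_decomp:
  assumes "g \<in> cents {N}"
  shows "\<exists>c\<in>C. \<exists>k\<in>Kset G \<delta> \<pi> l r. \<Phi> g = \<Phi> c * \<Phi> k"
proof -
  have "g \<in> Gl" "cg r (g \<star> N) (N \<star> g)" using assms by (simp_all add: cents_def)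
  then obtain c k where ck: "c \<in> C" "k \<in> Kset G \<delta> \<pi> l r" "cg l g (c \<star> k)"
    using stab_decomp by blast
  have "\<Phi> g = \<Phi> (c \<star> k)"
    by (rule \<Phi>_cong[OF assms pg.closed[OF C_cents[OF ck(1)] Kset_cents[OF ck(2)]] ck(3)])
  then show ?thesis using \<Phi>_mult[OF C_cents[OF ck(1)] Kset_cents[OF ck(2)]] ck by auto
qed

text \<open>Here \<open>r = l2\<close>, so \<open>K\<^sup>r\<close> acts by scalars and the image of
  the group is generated by scalars and the commuting \<open>\<Phi> c\<close>; Schur's lemma leaves
  dimension one.\<close>

lemma even_dim: assumes "even l" shows "n = 1"
proof -
  have r: "r = l2" using assms by presburger
  have K: "\<exists>a. \<Phi> k = sm a (idn n)" if "k \<in> Kset G \<delta> \<pi> l r" for k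
    using Kset_scalar that unfolding r[symmetric] by blast
  have Cs: "\<exists>a. \<Phi> c = sm a (idn n)" if c: "c \<in> C" for c
  proof (rule schur\<Phi>[OF \<Phi>_blk[OF C_cents[OF c]]])
    fix g assume "g \<in> cents {N}"
    then obtain d k where dk: "d \<in> C" "k \<in> Kset G \<delta> \<pi> l r" "\<Phi> g = \<Phi> d * \<Phi> k" using \<Phi>_decomp by blast
    obtain a where "\<Phi> k = sm a (idn n)" using K[OF dk(2)] by blast
    then have "\<Phi> g = sm a (\<Phi> d)" using dk(3) blk_right[OF \<Phi>_blk[OF C_cents[OF dk(1)]]] by simp
    then show "\<Phi> c * \<Phi> g = \<Phi> g * \<Phi> c" using \<Phi>_C_comm[OF c dk(1)] by simp
  qed
  \<comment> \<open>A diagonal matrix unit commutes with the scalar image of the group, so it is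
    scalar itself, which forces \<open>n = 1\<close>.\<close>
  have "\<exists>c. eu 0 0 = sm c (idn n)"
  proof (rule schur\<Phi>)
    show e: "eu 0 0 \<in> blk n n" using n0 by (simp add: eu_blk)
    fix g assume "g \<in> cents {N}"
    then obtain d k where dk: "d \<in> C" "k \<in> Kset G \<delta> \<pi> l r" "\<Phi> g = \<Phi> d * \<Phi> k" using \<Phi>_decomp by blast
    obtain a b where "\<Phi> k = sm a (idn n)" "\<Phi> d = sm b (idn n)" using K[OF dk(2)] Cs[OF dk(1)] by blast
    then show "eu 0 0 * \<Phi> g = \<Phi> g * eu 0 0"
      using dk(3) blk_left[OF e] blk_right[OF e] blk_left[OF blk_idn[of n]] by simp
  qed
  then obtain c where c: "eu 0 0 = sm c (idn n)" by blast
  have "ent (eu 0 0) 0 0 = c" "n > 1 \<Longrightarrow> ent (eu 0 0) 1 1 = c" unfolding c using n0 by (simp_all add: ent_sm ent_idn)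
  then have "\<not> n > 1" by (auto simp: ent_eu)
  then show ?thesis using n0 by linarith
qed

definition E :: "'a m2 \<Rightarrow> fm" where "E X = \<Phi> (ex X)"

lemma ex_cents: "odd l \<Longrightarrow> ah X \<Longrightarrow> ex X \<in> cents {N}"
  by (rule cents_near_one[OF ex_Gl ex_near_one])

text \<open>The half bracket in \<open>bch\<close> is moved into a factor \<open>?k\<close> of level
  \<open>2 r \<ge> l2\<close>, which acts by a scalar.\<close>

lemma E_mult:
  assumes o: "odd l" and X: "ah X" and Y: "ah Y"
  shows "E X * E Y = sm (\<beta> X Y) (E (X + Y))"
proof -
  let ?B = "msmul hf (X \<star> Y - Y \<star> X)"
  let ?k = "mI + msmul (\<pi> ^ (r + r)) ?B"
  have B: "?B \<in> g0"
    using ah_msmul[OF ah_bracket[OF X Y]] by (simp add: g0_def mtr_msmul mtr_diff mtr_comm[of _ X Y] qsmul_def zero_prod_def)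
  have i: "l2 \<le> r + r" using odd_l[OF o] r1 by linarith
  note k = \<Phi>_one_plus[OF B i]
  have e: "?k \<star> ex (X + Y) = ex (X + Y) + msmul (hf * \<pi> ^ (r + r)) (X \<star> Y - Y \<star> X)
      + msmul (\<pi> ^ (r + r)) (?B \<star> (ex (X + Y) - mI))"
    by (simp add: mm_ring mult_ac)
  have "cg (r + r + r) (msmul (\<pi> ^ (r + r)) (?B \<star> (ex (X + Y) - mI))) (msmul (\<pi> ^ (r + r)) (?B \<star> (mI - mI)))"
    by (intro mcong_scaled mcong_mult_left mcong_sub ex_near_one mcong_refl)
  then have 1: "cg l (msmul (\<pi> ^ (r + r)) (?B \<star> (ex (X + Y) - mI))) 0"
    using mcong_mono[OF _ odd_l(3)[OF o]] by simp
  have "cg l (?k \<star> ex (X + Y)) (ex (X + Y) + msmul (hf * \<pi> ^ (r + r)) (X \<star> Y - Y \<star> X) + 0)"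
    unfolding e by (intro mcong_add mcong_refl 1)
  then have "cg l (ex X \<star> ex Y) (?k \<star> ex (X + Y))"
    using mcong_trans[OF bch[OF o, of X Y] mcong_sym] by simp
  then have "\<Phi> (ex X \<star> ex Y) = \<Phi> (?k \<star> ex (X + Y))"
    by (intro \<Phi>_cong pg.closed ex_cents o X Y k ah_add)
  then have "\<Phi> (ex X) * \<Phi> (ex Y) = \<Phi> ?k * \<Phi> (ex (X + Y))"
    using \<Phi>_mult[OF ex_cents[OF o X] ex_cents[OF o Y]] \<Phi>_mult[OF k(1) ex_cents[OF o ah_add[OF X Y]]] by simp
  also have "\<dots> = sm (\<psi> (\<pi> ^ (r + r) * tf N ?B)) (\<Phi> (ex (X + Y)))"
    unfolding k(2) using blk_left[OF \<Phi>_blk[OF ex_cents[OF o ah_add[OF X Y]]]] by simp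
  also have "\<pi> ^ (r + r) * tf N ?B = hf * \<pi> ^ (r + r) * tf N (X \<star> Y - Y \<star> X)" by (simp add: tf_msmul_right mult_ac)
  finally show ?thesis by (simp add: E_def \<beta>_def)
qed

lemma \<beta>_dvd: assumes "odd l" "\<pi> dvd tf N (X \<star> Y - Y \<star> X)" shows "\<beta> X Y = 1"
proof -
  have "\<pi> ^ l = \<pi> ^ (r + r) * \<pi>" by (subst odd_l(1)[OF assms(1)]) (simp add: power_add)
  then have "\<pi> ^ l dvd \<pi> ^ (r + r) * tf N (X \<star> Y - Y \<star> X)" using assms(2) by (simp add: mult_dvd_mono)
  then have "\<pi> ^ l dvd hf * (\<pi> ^ (r + r) * tf N (X \<star> Y - Y \<star> X))" by (rule dvd_mult)
  then show ?thesis unfolding \<beta>_def mult.assoc by (rule psi_dvd)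
qed

text \<open>The difference is \<pi> times some \<open>z\<close> in \<open>W\<close>. Its exponential
  is \<open>1 + \<pi> ^ l2 z\<close> modulo \<open>\<pi> ^ l\<close> and acts by
  \<open>\<psi> (\<pi> ^ l2 * tf N z)\<close>, which is 1 because \<open>W\<close> is orthogonal to
  \<open>N\<close>.\<close>

lemma E_per: assumes o: "odd l" and v: "v \<in> W" "w \<in> W" "cg 1 v w" shows "E v = E w"
proof -
  obtain z where z: "z \<in> W" "v - w = msmul \<pi> z"
    using W_div[OF W_closed(5)[OF v(1,2)] iffD1[OF mcong_diff v(3)]] by blast
  have vz: "v = w + msmul \<pi> z" using z(2) by (metis add.commute diff_add_cancel)
  have ah: "ah w" "ah (msmul \<pi> z)" using g0D(1)[OF WD(1)] v(2) z(1) ah_msmul by auto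
  have "\<beta> w (msmul \<pi> z) = 1"
    by (rule \<beta>_dvd[OF o]) (simp add: msmul_mult_left msmul_mult_right msmul_diff[symmetric] tf_msmul_right)
  then have 1: "E w * E (msmul \<pi> z) = E v" using E_mult[OF o ah] vz by simp
  have "E (msmul \<pi> z) = idn n"
  proof -
    note k = \<Phi>_one_plus[OF WD(1)[OF z(1)] order_refl]
    have "ex (msmul \<pi> z) = mI + msmul (\<pi> ^ l2) z + msmul (hf * \<pi> * \<pi> ^ l) (z \<star> z)"
      unfolding ex_def odd_l(2)[OF o]
      by (subst (3) odd_l(1)[OF o]) (simp add: msmul_mult_left msmul_mult_right power_add mult_ac)
    moreover have "cg l (mI + msmul (\<pi> ^ l2) z + msmul (hf * \<pi> * \<pi> ^ l) (z \<star> z)) (mI + msmul (\<pi> ^ l2) z + 0)"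
      by (intro mcong_add mcong_refl mcong_pow_0') simp
    ultimately have "cg l (ex (msmul \<pi> z)) (mI + msmul (\<pi> ^ l2) z)" by simp
    then have "E (msmul \<pi> z) = \<Phi> (mI + msmul (\<pi> ^ l2) z)"
      unfolding E_def by (intro \<Phi>_cong ex_cents o ah k)
    then show ?thesis using k(2) WD(2)[OF z(1)] by (simp add: tf_sym[of N] psi_0)
  qed
  then show ?thesis using 1 blk_right[OF \<Phi>_blk[OF ex_cents[OF o ah(1)]]] by (simp add: E_def)
qed

lemma E_act: assumes o: "odd l" and c: "c \<in> C" and w: "w \<in> W"
  shows "\<Phi> c * E w = E (act c w) * \<Phi> c"
proof -
  have ah: "ah w" "ah (act c w)" using g0D(1)[OF WD(1)] w act_W[OF c w] by auto
  have "\<Phi> (c \<star> ex w) = \<Phi> (ex (act c w) \<star> c)"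
    by (intro \<Phi>_cong pg.closed C_cents ex_cents o c ah ex_conj act_commute)
  then show ?thesis
    using \<Phi>_mult[OF C_cents[OF c] ex_cents[OF o ah(1)]] \<Phi>_mult[OF ex_cents[OF o ah(2)] C_cents[OF c]]
    by (simp add: E_def)
qed

lemma heis_E: assumes o: "odd l" and Q: "transversal (cg 1) W Q" shows "heis n W (cg 1) Q E \<beta>"
proof
  show "cg 1 (a + c) (b + c)" if "cg 1 a b" for a b c using that by (intro mcong_add mcong_refl)
  show "E v \<in> blk n n" if "v \<in> W" for v
    unfolding E_def by (intro \<Phi>_blk ex_cents o g0D(1) WD(1) that)
  show "E 0 = idn n" by (simp add: E_def ex_0 \<Phi>_one)
  show "E v * E w = sm (\<beta> v w) (E (v + w))" if "v \<in> W" "w \<in> W" for v w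
    by (intro E_mult o g0D(1) WD(1) that)
  show "E v = E w" if "v \<in> W" "w \<in> W" "cg 1 v w" for v w by (rule E_per[OF o that])
  show "\<beta> (u + v) w = \<beta> u w * \<beta> v w" for u v w
    unfolding \<beta>_def psi_add[symmetric] by (simp add: mm_ring tf_lin algebra_simps)
  show "\<beta> w (u + v) = \<beta> w u * \<beta> w v" for u v w
    unfolding \<beta>_def psi_add[symmetric] by (simp add: mm_ring tf_lin algebra_simps)
  show "\<beta> v v = 1" for v by (simp add: \<beta>_def psi_0)
  show "\<beta> u w = \<beta> v w" if "cg 1 u v" for u v w
  proof -
    have "cg 1 (u \<star> w - w \<star> u) (v \<star> w - w \<star> v)" by (intro mcong_sub mcong_mult_left mcong_mult_right that)
    then have "\<pi> dvd tf N (u \<star> w - w \<star> u) - tf N (v \<star> w - w \<star> v)" using tf_cong_right[of 1] by simp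
    moreover have "\<pi> ^ l = \<pi> ^ (r + r) * \<pi>" by (subst odd_l(1)[OF o]) (simp add: power_add)
    ultimately have "\<pi> ^ l dvd \<pi> ^ (r + r) * (tf N (u \<star> w - w \<star> u) - tf N (v \<star> w - w \<star> v))" by (simp add: mult_dvd_mono)
    then have "\<pi> ^ l dvd hf * (\<pi> ^ (r + r) * (tf N (u \<star> w - w \<star> u) - tf N (v \<star> w - w \<star> v)))" by (rule dvd_mult)
    then show ?thesis unfolding \<beta>_def by (intro psi_cong) (simp add: right_diff_distrib mult.assoc)
  qed
qed (use n0 W_closed mcong_equivp Q in auto)

lemma complete_E:
  assumes o: "odd l" and Q: "transversal (cg 1) W Q"
  shows "\<exists>\<kappa>. heis.complete n Q E \<kappa>"
proof -
  interpret h: heis n W "cg 1" Q E \<beta> by (rule heis_E[OF o Q])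
  show ?thesis
  proof (rule h.scalar_commutant_complete)
    fix X assume X: "X \<in> blk n n" "\<And>w. w \<in> W \<Longrightarrow> X * E w = E w * X"
    show "\<exists>a. X = sm a (idn n)"
    proof (rule h.scalar_commutant[where C = C and \<Phi> = \<Phi> and \<Phi>' = "\<lambda>c. \<Phi> (ct c)" and act = act])
      show "\<exists>k\<in>W. (\<beta> k v)\<^sup>2 \<noteq> 1" if "v \<in> W" "\<not> cg 1 v 0" for v by (rule \<beta>_nondeg[OF o that])
      show "\<Phi> c \<in> blk n n" "\<Phi> (ct c) \<in> blk n n" if "c \<in> C" for c
        using that ct(1) C_cents \<Phi>_blk by blast+
      show "\<Phi> c * \<Phi> (ct c) = idn n" "\<Phi> (ct c) * \<Phi> c = idn n" if "c \<in> C" for c by (rule \<Phi>_C_inverse[OF that])+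
      show "\<Phi> c * \<Phi> d = \<Phi> d * \<Phi> c" if "c \<in> C" "d \<in> C" for c d by (rule \<Phi>_C_comm[OF that])
      show "act c w \<in> W" "\<Phi> c * E w = E (act c w) * \<Phi> c" if "c \<in> C" "w \<in> W" for c w
        by (rule act_W[OF that], rule E_act[OF o that])
      show "cg 1 v w" if "c \<in> C" "cg 1 (act c v) (act c w)" for c v w
        by (rule act_inj[OF that(1) _ that(2)]) (use l in simp)
      show "act c (- w) = - act c w" for c w by (rule act_lin)
      show "cg 1 (act c w) 0" if "cg 1 w 0" for c w using act_cong[OF that, of c] by (simp add: act_lin)
      show "(\<forall>w\<in>W. cg 1 (act c w) w) \<or> (\<forall>w\<in>W. cg 1 (act c w) w \<longrightarrow> cg 1 w 0)" if c: "c \<in> C" for c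
      proof -
        obtain x y where xy: "c = alg x y" using C_D(1)[OF c] by (auto elim: AlgE)
        show ?thesis
          by (cases "qcong \<pi> 1 y 0") (use act_trivial[OF c xy] act_fixfree[OF c xy] in blast)+
      qed
      show "\<exists>a. Z = sm a (idn n)"
        if Z: "Z \<in> blk n n" "\<And>w. w \<in> W \<Longrightarrow> Z * E w = E w * Z" "\<And>c. c \<in> C \<Longrightarrow> Z * \<Phi> c = \<Phi> c * Z" for Z
      proof (rule schur\<Phi>[OF Z(1)])
        fix g assume "g \<in> cents {N}"
        then obtain c k where ck: "c \<in> C" "k \<in> Kset G \<delta> \<pi> l r" "\<Phi> g = \<Phi> c * \<Phi> k" using \<Phi>_decomp by blast
        obtain Y where Y: "ah Y" "cg l k (ex Y)" using Kset_exp[OF o ck(2)] by blast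
        \<comment> \<open>Up to an element of \<open>C\<close>, \<open>g\<close> is the exponential
          of \<open>Y\<close>. The part \<open>u\<close> along \<open>Alg\<close> exponentiates into
          \<open>C\<close> and pairs trivially with \<open>w\<close>, so \<open>\<Phi> g\<close> is
          a product of operators of elements of \<open>C\<close> and one \<open>E w\<close>.\<close>
        obtain u w where uw: "Y = u + w" "u \<in> Alg" "ah u" "w \<in> W" using ah_decomp[OF Y(1)] by blast
        have kE: "\<Phi> k = E Y" unfolding E_def by (rule \<Phi>_cong[OF Kset_cents[OF ck(2)] ex_cents[OF o Y(1)] Y(2)])
        have "\<beta> u w = 1" unfolding \<beta>_def tf_bracket using Alg_commN[OF uw(2)] by (simp add: psi_0)
        then have "E Y = \<Phi> (ex u) * E w" using E_mult[OF o uw(3) g0D(1)[OF WD(1)[OF uw(4)]]] uw(1) by (simp add: E_def)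
        then have g: "\<Phi> g = \<Phi> c * (\<Phi> (ex u) * E w)" using ck(3) kE by simp
        show "Z * \<Phi> g = \<Phi> g * Z"
          unfolding g using Z(2)[OF uw(4)] Z(3)[OF ck(1)] Z(3)[OF ex_C[OF o uw(2,3)]] by (metis mult.assoc)
      qed
    qed (use X in auto)
  qed
qed

end

section \<open>Conjugation and reflections\<close>

context cusp
begin

text \<open>The trace recovers \<open>x\<close>, as \<open>N\<close> is traceless; multiplying the
  rest by \<open>N\<close> recovers \<open>y\<close>, as \<open>N \<star> N\<close> is a unit
  scalar.\<close>

lemma alg_cong_0: assumes "cg k (alg x y) 0" shows "qcong \<pi> k x 0" "qcong \<pi> k y 0"
proof -
  have "mtr (alg x y) = qsmul 2 x"
    using g0D(2)[OF N] by (simp add: alg_def mtr_add mtr_qs mtr_mI) (simp add: qmul_def qsmul_def zero_prod_def mult.commute)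
  then have "qcong \<pi> k (qsmul 2 x) 0" using mcong_mtr[OF assms] by simp
  then have "\<pi> ^ k dvd 2 * fst x" "\<pi> ^ k dvd 2 * snd x" by (simp_all add: qcong_def qsmul_def zero_prod_def)
  from this[THEN pow_dvd_unit_mult[OF pi_2]] show x: "qcong \<pi> k x 0" by (simp add: qcong_def zero_prod_def)
  have "cg k (alg x y - qs x mI) (0 - 0)" by (intro mcong_sub assms qcong_0_qs x)
  then have "cg k (qs y N) 0" by (simp add: alg_def)
  from mcong_mult_right[OF this, of \<delta> N] have "cg k (msmul D (qs y mI)) (msmul D 0)"
    by (simp add: qs_mult_left NN qs_msmul)
  then have "cg k (qs y mI) 0" by (rule mcong_unit_cancel[OF D_unit])
  then show "qcong \<pi> k y 0" by (simp add: qs_def mcong_iff_dvd qsc_def m2_defs qcong_def zero_prod_def)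
qed

text \<open>These are probes near the identity. The element \<open>1 + \<pi> ^ m u N\<close> of
  \<open>Alg\<close> is unitary only modulo \<open>\<pi> ^ (2 m)\<close>; the correction leaves its
  \<open>N\<close>-coordinate unchanged modulo \<open>\<pi> ^ (m + 1)\<close>, so the leading
  coefficient is still \<open>u\<close>.\<close>

lemma near_one_C:
  assumes m: "1 \<le> m"
  shows "\<exists>h\<in>C. \<exists>x Y. h = alg x (qsmul (\<pi> ^ m) Y) \<and> cg 1 h mI \<and> qcong \<pi> 1 Y (u, 0)"
proof -
  define c0 where "c0 = alg (1, 0) (\<pi> ^ m * u, 0)"
  have c0: "c0 = mI + msmul (\<pi> ^ m * u) N" by (simp add: c0_def alg_def qs_real)
  have c0A: "c0 \<in> Alg" unfolding c0_def by (intro AlgI) (auto simp: inR_def)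
  have c01: "cg m c0 mI"
  proof -
    have "c0 = mI + msmul (\<pi> ^ m) (msmul u N)" unfolding c0 by simp
    then show ?thesis unfolding mcong_iff by blast
  qed
  have "\<exists>h\<in>C. cg (m + m) h c0"
  proof (rule alg_lift[OF c0A])
    show "1 \<le> m + m" using m by simp
    show "\<exists>B. cg 1 (c0 \<star> B) mI" using mcong_mono[OF c01 m] by (intro exI[of _ mI]) simp
    show "cg (m + m) (mstar c0 \<star> c0) mI" if "G = GU"
    proof -
      have "mstar c0 \<star> c0 = mI - msmul (\<pi> ^ (m + m)) (msmul (u * u * D) mI)"
        unfolding c0 using ahD(2)[OF g0D(1)[OF N] that]
        by (simp add: mstar_add mstar_msmul mm_ring NN power_add mult_ac)
      moreover have "cg (m + m) (mI - msmul (\<pi> ^ (m + m)) (msmul (u * u * D) mI)) (mI - 0)"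
        by (intro mcong_sub mcong_refl mcong_pow_0) simp
      ultimately show ?thesis by simp
    qed
  qed
  then obtain h where h: "h \<in> C" "cg (m + m) h c0" by blast
  obtain x y where xy: "h = alg x y" using C_D(1)[OF h(1)] by (auto elim: AlgE)
  have "cg (m + m) (alg (x - (1, 0)) (y - (\<pi> ^ m * u, 0))) 0"
    using iffD1[OF mcong_diff h(2)] unfolding xy c0_def alg_diff .
  note q = alg_cong_0(2)[OF this]
  have "\<pi> ^ m * \<pi> dvd \<pi> ^ (m + m)" using m by (metis le_imp_power_dvd power_Suc2 add_le_cancel_left plus_1_eq_Suc add.commute)
  then have d: "\<pi> ^ m * \<pi> dvd fst y - \<pi> ^ m * u" "\<pi> ^ m * \<pi> dvd snd y"
    using q dvd_trans unfolding qcong_def by (auto simp: zero_prod_def)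
  then obtain y1 y2 where "fst y - \<pi> ^ m * u = \<pi> ^ m * \<pi> * y1" "snd y = \<pi> ^ m * \<pi> * y2" by (meson dvdE)
  then have y: "y = qsmul (\<pi> ^ m) (u + \<pi> * y1, \<pi> * y2)"
    by (intro prod_eqI) (simp_all add: qsmul_def algebra_simps)
  moreover have "qcong \<pi> 1 (u + \<pi> * y1, \<pi> * y2) (u, 0)" by (simp add: qcong_def)
  moreover have "cg 1 h mI"
    using mcong_trans[OF mcong_mono[OF h(2)] mcong_mono[OF c01 m]] m by simp
  ultimately show ?thesis using h(1) xy by blast
qed

lemma reflection_axis: "\<exists>J\<in>W. \<not> cg 1 J 0"
proof -
  obtain p q s where Nc: "N = G0 p q s" using g0_coord[OF N] by blast
  have "fst (e11 (N \<star> N)) = D" unfolding NN by (simp add: m2_defs)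
  then have Dc: "D = p * p + es * (q * s)" unfolding Nc G0_mult by simp
  \<comment> \<open>With \<open>N = G0 p q s\<close> this element is orthogonal to \<open>N\<close>
    by inspection, and \<open>q\<close> is a unit, since otherwise \<open>D\<close> would be the
    square of \<open>p\<close> modulo \<pi>.\<close>
  define J where "J = G0 0 q (- s)"
  have "tf J N = 0" unfolding J_def Nc tf_G0 by (simp add: algebra_simps)
  then have "J \<in> W" unfolding W_def J_def using G0_g0 by simp
  moreover have "\<not> cg 1 J 0"
  proof
    assume "cg 1 J 0"
    then have "\<pi> dvd q" unfolding J_def G0_def eps_def
      by (cases G) (auto simp: mcong_iff_dvd m2_defs)
    then have "\<pi> dvd p * p - D" unfolding Dc by simp
    then show False using nonsq by blast
  qed
  ultimately show ?thesis by blast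
qed

section \<open>The reflection of the plane along a chosen axis\<close>

definition J :: "'a m2" where "J = (SOME J. J \<in> W \<and> \<not> cg 1 J 0)"
definition \<nu> :: 'a where "\<nu> = hf * tf J J"
definition \<nu>i :: 'a where "\<nu>i = (SOME x. \<nu> * x = 1)"

lemma J: "J \<in> W" "\<not> cg 1 J 0"
  unfolding J_def using someI_ex[of "\<lambda>J. J \<in> W \<and> \<not> cg 1 J 0"] reflection_axis by blast+

lemma J_sq: "J \<star> J = msmul \<nu> mI"
  unfolding \<nu>_def by (rule g0_sq[OF WD(1)[OF J(1)]])

lemma hf_unit: "\<not> \<pi> dvd hf"
proof
  assume "\<pi> dvd hf"
  then have "\<pi> dvd 2 * hf" by (rule dvd_mult)
  then show False using hf2 pi_nunit by simp
qed

lemma W_sq_unit: "w \<in> W \<Longrightarrow> \<not> cg 1 w 0 \<Longrightarrow> \<not> \<pi> dvd hf * tf w w"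
  using W_anisotropic hf_unit pi_prime by blast

lemma \<nu>i: "\<nu> * \<nu>i = 1"
  unfolding \<nu>i_def by (rule someI_ex[OF unit_ex]) (use W_sq_unit[OF J] in \<open>simp add: \<nu>_def\<close>)

text \<open>As \<open>\<nu>i\<close> is 2 divided by \<open>tf J J\<close>, this is the reflection
  that fixes \<open>J\<close> and negates its orthogonal complement. By \<open>sr_J\<close> it is
  also conjugation by \<open>J\<close>.\<close>

definition sr :: "'a m2 \<Rightarrow> 'a m2" where "sr X = msmul (\<nu>i * tf J X) J - X"

lemma sr_W: "X \<in> W \<Longrightarrow> sr X \<in> W"
  unfolding sr_def by (intro W_closed J)

lemma sr_lin: "sr (v - w) = sr v - sr w" "sr (v + w) = sr v + sr w" "sr (msmul c v) = msmul c (sr v)"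
  by (simp_all add: sr_def tf_lin right_diff_distrib distrib_left msmul_diff_left msmul_add_left msmul_diff mult_ac)

lemma sr_J: "X \<in> W \<Longrightarrow> sr X \<star> J = J \<star> X"
proof -
  assume X: "X \<in> W"
  have "sr X \<star> J = msmul (\<nu> * \<nu>i * tf J X) mI - X \<star> J"
    by (simp add: sr_def mm_ring J_sq mult_ac)
  also have "\<dots> = J \<star> X"
    using g0_anticomm[OF WD(1)[OF J(1)] WD(1)[OF X]] \<nu>i by (simp add: algebra_simps)
  finally show ?thesis .
qed

lemma sr_sr: assumes "X \<in> W" shows "sr (sr X) = X"
proof -
  have "tf J J = 2 * \<nu>" unfolding \<nu>_def using hf_add[of "tf J J"] by (simp add: algebra_simps)
  then have "tf J (sr X) = 2 * (\<nu> * \<nu>i) * tf J X - tf J X"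
    by (simp add: sr_def tf_lin mult_ac)
  then have "tf J (sr X) = tf J X" using \<nu>i by simp
  then show ?thesis by (simp add: sr_def)
qed

lemma sr_cong: assumes "cg k v w" shows "cg k (sr v) (sr w)"
proof -
  have "\<pi> ^ k dvd \<nu>i * tf J v - \<nu>i * tf J w"
    using tf_cong_right[OF assms, of J] by (simp add: right_diff_distrib[symmetric])
  then have "cg k (msmul (\<nu>i * tf J v - \<nu>i * tf J w) J) 0"
    by (auto elim!: dvdE simp: mcong_0_iff) (metis msmul_msmul)
  then have "cg k (msmul (\<nu>i * tf J v) J) (msmul (\<nu>i * tf J w) J)"
    by (subst mcong_diff) (simp add: msmul_diff_left)
  then show ?thesis unfolding sr_def by (intro mcong_sub assms)
qed

lemma sr_cong_iff: assumes "v \<in> W" "w \<in> W" "cg k (sr v) (sr w)" shows "cg k v w"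
  using sr_cong[OF assms(3)] sr_sr assms by simp

text \<open>\<open>sr\<close> is conjugation by \<open>J\<close>, and \<open>J\<close> anticommutes
  with \<open>N\<close>, so the pairing changes sign.\<close>

lemma tf_sr: assumes "v \<in> W" "w \<in> W"
  shows "tf N (sr v \<star> sr w - sr w \<star> sr v) = tf N (w \<star> v - v \<star> w)"
proof -
  let ?P = "v \<star> w - w \<star> v" and ?P' = "sr v \<star> sr w - sr w \<star> sr v"
  have "sr x \<star> sr y \<star> J = J \<star> (x \<star> y)" if "x \<in> W" "y \<in> W" for x y
    using sr_J[OF that(1)] sr_J[OF that(2)] by (metis mm_assoc)
  then have P'J: "?P' \<star> J = J \<star> ?P" using assms by (simp add: mm_diff_left mm_diff_right)
  have "msmul \<nu> ?P' = ?P' \<star> J \<star> J" by (simp only: mm_assoc J_sq msmul_mult_right mm_one_right)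
  then have "\<nu> * tf N ?P' = tf N (J \<star> ?P \<star> J)" unfolding P'J by (simp only: tf_msmul_right[symmetric])
  also have "\<dots> = fst (mtr (J \<star> N \<star> J \<star> ?P))"
    unfolding tf_def using mtr_comm[of \<delta> "N \<star> J \<star> ?P" J] by (simp only: mm_assoc)
  also have "J \<star> N \<star> J \<star> ?P = msmul (- \<nu>) (N \<star> ?P)"
    unfolding W_anti[OF J(1)] by (simp only: mm_minus_left mm_assoc msmul_minus_left)
      (simp only: mm_assoc[of \<delta> J J, symmetric] J_sq msmul_mult_left msmul_mult_right mm_one_left)
  also have "fst (mtr (msmul (- \<nu>) (N \<star> ?P))) = \<nu> * tf N (w \<star> v - v \<star> w)"
    unfolding mtr_msmul tf_diff_right tf_def[symmetric] by (simp add: qsmul_def tf_def mm_ring mtr_diff algebra_simps)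
  finally have "\<nu>i * \<nu> * tf N ?P' = \<nu>i * \<nu> * tf N (w \<star> v - v \<star> w)" by (simp only: mult.assoc)
  then show ?thesis using \<nu>i by (simp add: mult.commute[of \<nu>i])
qed

lemma \<beta>_sr: "v \<in> W \<Longrightarrow> w \<in> W \<Longrightarrow> \<beta> (sr v) (sr w) = \<beta> w v"
  unfolding \<beta>_def using tf_sr by simp

text \<open>The witness is \<open>J X\<close>, normalised by the scalar \<open>p + q s \<theta>\<close> of norm \<open>p\<^sup>2 - q\<^sup>2 D\<close> in the
  unitary case.\<close>
lemma sr_orbit:
  assumes X: "X \<in> W" "\<not> cg 1 X 0" and Ds: "G = GU \<Longrightarrow> \<exists>s. \<pi> dvd D - \<delta> * (s * s)"
  shows "\<exists>t\<in>C. cg 1 (act t X) (sr X)"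
proof -
  obtain v where v: "(2 * D) * v = 1" using unit_ex[of "2 * D"] pi_prime pi_2 D_unit by blast
  define p where "p = hf * tf J X"
  define q where "q = tf J (X \<star> N) * v"
  have XN: "X \<star> N \<in> W" by (rule WN_W[OF X(1)])
  have g: "J \<star> X = msmul p mI + msmul q N"
  proof -
    \<comment> \<open>A product of two elements that anticommute with \<open>N\<close> commutes with
      \<open>N\<close>, so \<open>N_decomp\<close> expresses \<open>J \<star> X\<close> in
      \<open>Alg\<close>.\<close>
    have "N \<star> (J \<star> X) \<star> N = J \<star> X \<star> N \<star> N"
    proof -
      have "N \<star> J = - (J \<star> N)" using W_anti[OF J(1)] by simp
      then have "N \<star> (J \<star> X) = - (J \<star> (N \<star> X))" by (simp only: mm_assoc[symmetric] mm_minus_left)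
      moreover have "N \<star> X = - (X \<star> N)" using W_anti[OF X(1)] by simp
      ultimately show ?thesis by (simp only: mm_minus_right minus_minus mm_assoc)
    qed
    also have "\<dots> = msmul D (J \<star> X)" by (simp only: mm_assoc[of \<delta> _ N N] NN msmul_mult_right mm_one_right)
    finally have "msmul (2 * D) (J \<star> X) = alg (qsmul D (mtr (J \<star> X))) (mtr (J \<star> X \<star> N))"
      using N_decomp[of "J \<star> X"] by (simp add: msmul_add_left[symmetric])
    moreover have "mtr (J \<star> X) = (2 * p, 0)"
      using mtr_g0[OF WD(1)[OF J(1)] WD(1)[OF X(1)]] hf_add[of "tf J X"] by (simp add: p_def algebra_simps)
    moreover have "mtr (J \<star> X \<star> N) = (tf J (X \<star> N), 0)"
      using mtr_g0[OF WD(1)[OF J(1)] WD(1)[OF XN]] by (simp add: mm_assoc)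
    ultimately have "msmul (2 * D) (J \<star> X) = msmul (2 * D * p) mI + msmul (tf J (X \<star> N)) N"
      by (simp add: alg_def qs_real qsmul_def mult_ac)
    then have "msmul v (msmul (2 * D) (J \<star> X)) = msmul v (msmul (2 * D * p) mI + msmul (tf J (X \<star> N)) N)" by simp
    then have "msmul (2 * D * v) (J \<star> X) = msmul ((2 * D * v) * p) mI + msmul q N"
      by (simp add: msmul_add q_def mult_ac)
    then show ?thesis unfolding v by simp
  qed
  \<comment> \<open>The norm of \<open>J \<star> X\<close>, as the product of the squares of
    \<open>J\<close> and \<open>X\<close>.\<close>
  define n0 where "n0 = \<nu> * (hf * tf X X)"
  have n0u: "\<not> \<pi> dvd n0"
    unfolding n0_def \<nu>_def using W_sq_unit[OF X] W_sq_unit[OF J] pi_prime by blast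
  obtain ni where ni: "n0 * ni = 1" using unit_ex[OF n0u] by blast
  have XJ: "X \<star> J = msmul p mI - msmul q N"
  proof -
    have "J \<star> X + X \<star> J = msmul (p + p) mI"
      unfolding p_def hf_add by (rule g0_anticomm[OF WD(1)[OF J(1)] WD(1)[OF X(1)]])
    then have "X \<star> J = msmul (p + p) mI - J \<star> X" by (simp add: algebra_simps)
    then show ?thesis unfolding g msmul_add_left by simp
  qed
  have gg: "(msmul p mI - msmul q N) \<star> (msmul p mI + msmul q N) = msmul n0 mI"
  proof -
    have "X \<star> J \<star> (J \<star> X) = X \<star> (J \<star> J) \<star> X" by (simp only: mm_assoc)
    also have "\<dots> = msmul n0 mI"
      unfolding J_sq by (simp add: mm_ring g0_sq[OF WD(1)[OF X(1)]] n0_def)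
    finally show ?thesis unfolding XJ g .
  qed
  have n0pq: "n0 = p * p - D * (q * q)"
  proof -
    have "(msmul p mI - msmul q N) \<star> (msmul p mI + msmul q N) = msmul (p * p - D * (q * q)) mI"
      by (simp add: mm_ring NN msmul_diff_left mult_ac)
    then have "msmul n0 mI = msmul (p * p - D * (q * q)) mI" using gg by simp
    then have "fst (e11 (msmul n0 mI)) = fst (e11 (msmul (p * p - D * (q * q)) mI))" by simp
    then show ?thesis by (simp add: m2_defs)
  qed
  have gA: "J \<star> X \<in> Alg" unfolding g by (intro Alg_add Alg_msmul Alg_mI Alg_N)
  have sg: "sr X \<star> (J \<star> X) = J \<star> X \<star> X" using sr_J[OF X(1)] by (simp only: mm_assoc[symmetric])
  have "\<exists>\<eta>. inR G \<eta> \<and> (\<exists>t\<in>C. cg 1 t (qs \<eta> (J \<star> X)))"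
  proof (cases G)
    case GL
    have "\<exists>t\<in>C. cg 1 t (J \<star> X)"
    proof (rule alg_lift[OF gA order_refl])
      have "J \<star> X \<star> msmul ni (msmul p mI - msmul q N) = msmul ni ((msmul p mI - msmul q N) \<star> (msmul p mI + msmul q N))"
        unfolding g by (simp add: mm_ring algebra_simps mult_ac)
      also have "\<dots> = mI" unfolding gg using ni by (simp add: mult.commute)
      finally show "\<exists>B. cg 1 (J \<star> X \<star> B) mI" by (metis mcong_refl)
    qed (use GL in simp)
    then show ?thesis by (intro exI[of _ "(1, 0)"]) (simp add: inR_def qs_real)
  next
    case GU
    obtain s where s: "\<pi> dvd D - \<delta> * (s * s)" using Ds[OF GU] by blast
    define \<zeta> where "\<zeta> = (p, q * s)"
    \<comment> \<open>The adjoint of \<open>J \<star> X\<close> times \<open>J \<star> X\<close> is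
      \<open>n0\<close>. Since \<open>D\<close> is \<open>\<delta> * (s * s)\<close> modulo \<pi>,
      the norm of \<zeta> is \<open>n0\<close> there, so \<eta>, the conjugate of \<zeta> divided by
      \<open>n0\<close>, has norm inverse to \<open>n0\<close>.\<close>
    define \<eta> where "\<eta> = qsmul ni (qconj \<zeta>)"
    have \<eta>R: "inR G \<eta>" unfolding inR_def using GU by simp
    have "\<exists>t\<in>C. cg 1 t (qs \<eta> (J \<star> X))"
    proof (rule alg_lift[OF Alg_qs[OF \<eta>R gA] order_refl])
      let ?nz = "p * p - \<delta> * (q * s * (q * s))"
      have gs: "mstar (J \<star> X) = msmul p mI - msmul q N"
        unfolding g using ahD(2)[OF g0D(1)[OF N] GU] by (simp add: mstar_add mstar_msmul msmul_minus)
      have "qmul \<delta> \<eta> (qconj \<eta>) = (ni * ni * ?nz, 0)"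
        unfolding \<eta>_def \<zeta>_def by (rule prod_eqI) (simp_all add: qmul_def qconj_def qsmul_def algebra_simps)
      then have "mstar (qs \<eta> (J \<star> X)) \<star> qs \<eta> (J \<star> X) = msmul (ni * ni * ?nz) (mstar (J \<star> X) \<star> (J \<star> X))"
        by (simp add: mstar_qs qs_mult_left qs_mult_right qs_qs qs_real)
      also have "\<dots> = msmul (ni * ni * ?nz * n0) mI" unfolding gs unfolding g gg by simp
      finally have e: "mstar (qs \<eta> (J \<star> X)) \<star> qs \<eta> (J \<star> X) = msmul (ni * ni * ?nz * n0) mI" .
      have "?nz = n0 + (q * q) * (D - \<delta> * (s * s))" unfolding n0pq by (simp add: algebra_simps)
      then obtain k where k: "?nz = n0 + k" "\<pi> dvd k" using dvd_mult[OF s, of "q * q"] by blast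
      have "ni * ni * (n0 + k) * n0 - 1 = (n0 * ni) * (n0 * ni) - 1 + ni * ni * n0 * k"
        by (simp add: algebra_simps)
      then have "\<pi> dvd ni * ni * ?nz * n0 - 1" unfolding k(1) ni using k(2) by simp
      then have "cg 1 (msmul (ni * ni * ?nz * n0 - 1) mI) 0" unfolding mI_cong_0_iff by simp
      then show "cg 1 (mstar (qs \<eta> (J \<star> X)) \<star> qs \<eta> (J \<star> X)) mI"
        unfolding e by (subst mcong_diff) (simp add: msmul_diff_left)
    qed (use GU in simp)
    then show ?thesis using \<eta>R by blast
  qed
  then obtain \<eta> t where t: "t \<in> C" "cg 1 t (qs \<eta> (J \<star> X))" by blast
  \<comment> \<open>The central factor \<eta> does not affect conjugation, so the normalised element
    still carries \<open>X\<close> to \<open>sr X\<close>.\<close>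
  have e: "sr X \<star> qs \<eta> (J \<star> X) = qs \<eta> (J \<star> X) \<star> X" using sg by (simp only: qs_mult_right qs_mult_left)
  have 1: "cg 1 (sr X \<star> t) (t \<star> X)"
    using mcong_trans[OF mcong_mult_left[OF t(2), of \<delta> "sr X", unfolded e] mcong_sym[OF mcong_mult_right[OF t(2)]]] .
  have "cg 1 (act t X \<star> t) (t \<star> X)" using mcong_mono[OF act_commute[OF t(1)]] l by simp
  then have "cg 1 (act t X \<star> t) (sr X \<star> t)" by (rule mcong_trans[OF _ mcong_sym[OF 1]])
  then have "cg 1 (act t X) (sr X)" by (rule cancel_right[OF t(1), rotated]) (use l in simp)
  then show ?thesis using t(1) by blast
qed

end

context crep
begin

lemma E_conj:
  assumes o: "odd l" and h: "h \<in> cents {N}" and w: "ah w" "ah w'" and c: "cg l (w' \<star> h) (h \<star> w)"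
  shows "\<Phi> h * E w = E w' * \<Phi> h"
proof -
  have "\<Phi> (h \<star> ex w) = \<Phi> (ex w' \<star> h)"
    by (intro \<Phi>_cong pg.closed h ex_cents o w ex_conj c)
  then show ?thesis
    using \<Phi>_mult[OF h ex_cents[OF o w(1)]] \<Phi>_mult[OF ex_cents[OF o w(2)] h] by (simp add: E_def)
qed

lemma E_comm:
  assumes o: "odd l" and X: "ah X" "ah Y"
  shows "E X * E Y = sm (\<psi> (\<pi> ^ (r + r) * tf N (X \<star> Y - Y \<star> X))) (E Y * E X)"
proof -
  have "\<psi> (\<pi> ^ (r + r) * tf N (X \<star> Y - Y \<star> X)) * \<beta> Y X = \<beta> X Y"
  proof -
    have "tf N (Y \<star> X - X \<star> Y) = - tf N (X \<star> Y - Y \<star> X)" by (simp add: tf_lin)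
    then have "\<beta> X Y * \<beta> Y X = 1" unfolding \<beta>_def using psi_minus[of "hf * \<pi> ^ (r + r) * tf N (X \<star> Y - Y \<star> X)"] by simp
    then show ?thesis unfolding \<beta>_sq[symmetric] by (simp add: power2_eq_square mult.assoc)
  qed
  then show ?thesis unfolding E_mult[OF o X] E_mult[OF o X(2,1)] by (simp add: add.commute)
qed

text \<open>For \<open>d\<close> divisible by \<pi> the exponential has level \<open>l2\<close>,
  where the character of \<open>A\<close> applies. As \<open>d\<close> may have a trace, the scalar
  part \<open>a\<close> is kept.\<close>

lemma E_small:
  assumes o: "odd l" and d: "ah d" "cg 1 d 0"
  shows "E d = sm (bigpsi \<psi> (qsmul (\<pi> ^ r) (mtr ((qsc a + N) \<star> d)))) (idn n)"
proof -
  obtain B where B: "inM G B" "d = 0 + msmul (\<pi> ^ 1) B"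
    using mcong_iff_inM[OF ahD(1)[OF d(1)] inM_0 d(2)] by blast
  then have dB: "d = msmul \<pi> B" by simp
  have exd: "ex d = mI + msmul (\<pi> ^ l2) B + msmul (hf * \<pi> * \<pi> ^ l) (B \<star> B)"
    unfolding ex_def odd_l(2)[OF o] dB
    by (subst (3) odd_l(1)[OF o]) (simp add: msmul_mult_left msmul_mult_right power_add mult_ac)
  have "cg l (mI + msmul (\<pi> ^ l2) B + msmul (hf * \<pi> * \<pi> ^ l) (B \<star> B)) (mI + msmul (\<pi> ^ l2) B + 0)"
    by (intro mcong_add mcong_refl mcong_pow_0') simp
  then have e: "cg l (ex d) (mI + msmul (\<pi> ^ l2) B)" unfolding exd by simp
  have "cg l2 (mI + msmul (\<pi> ^ l2) B) mI" unfolding mcong_iff by blast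
  then have "cg l2 (ex d) mI" by (rule mcong_trans[OF mcong_mono[OF e l2l(2)]])
  then have K: "ex d \<in> Kset G \<delta> \<pi> l l2" by (rule KsetI[OF ex_Gl[OF o d(1)]])
  have "psiA G \<delta> \<pi> \<psi> l A (ex d) = bigpsi \<psi> (qsmul (\<pi> ^ l2) (mtr ((qsc a + N) \<star> B)))"
    using psiA_cong[OF An K] psiA_eq[OF B(1) e] by simp
  also have "qsmul (\<pi> ^ l2) (mtr ((qsc a + N) \<star> B)) = qsmul (\<pi> ^ r) (mtr ((qsc a + N) \<star> d))"
    unfolding dB odd_l(2)[OF o] msmul_mult_right mtr_msmul by (simp add: qsmul_def mult_ac)
  finally show ?thesis using Kset_scalar[OF K] by (simp add: E_def)
qed

text \<open>Conjugation by \<open>h\<close> moves \<open>y\<close> by \<open>d = h y h' - y\<close>,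
  which is divisible by \<pi>, so the operators differ by the scalar \<open>E d\<close>. By
  cyclicity \<open>tr (N d)\<close> is the trace of \<open>h' [N, h] y\<close>, that is,
  \<open>\<pi> ^ r tr (Z y)\<close> modulo \<open>\<pi> ^ (r + 1)\<close>.\<close>

lemma E_conj_near_one:
  assumes o: "odd l" and h: "h \<in> cents {N}" "cg 1 h mI" and h': "inM G h'" "cg l (h' \<star> h) mI" "G = GU \<Longrightarrow> h' = mstar h"
    and y: "y \<in> g0" and Z: "N \<star> h - h \<star> N = msmul (\<pi> ^ r) Z"
  shows "\<Phi> h * E y = sm (bigpsi \<psi> (qsmul (\<pi> ^ (r + r)) (mtr (Z \<star> y)))) (E y * \<Phi> h)"
proof -
  have hG: "h \<in> Gl" using h(1) by (simp add: cents_def)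
  have yah: "ah y" by (rule g0D(1)[OF y])
  define y1 where "y1 = h \<star> y \<star> h'"
  have "mstar y1 = - y1" if "G = GU"
    unfolding y1_def h'(3)[OF that] using ahD(2)[OF yah that] by (simp add: mstar_mult mm_ring)
  then have y1: "ah y1" unfolding ah_def y1_def using GsetD(1)[OF hG] h'(1) ahD(1)[OF yah] by (auto intro: inM_mult)
  have h'1: "cg 1 h' mI"
  proof -
    have "cg 1 (h' \<star> h) (h' \<star> mI)" by (rule mcong_mult_left[OF h(2)])
    then have "cg 1 h' (h' \<star> h)" by (simp add: mcong_sym)
    then show ?thesis using mcong_trans[OF _ mcong_mono[OF h'(2)]] l by simp
  qed
  have "cg l (y1 \<star> h) (h \<star> y)"
    unfolding y1_def using mcong_mult_left[OF h'(2), of \<delta> "h \<star> y"] by (simp add: mm_assoc)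
  then have 1: "\<Phi> h * E y = E y1 * \<Phi> h" by (rule E_conj[OF o h(1) yah y1])
  define d where "d = y1 - y"
  have dah: "ah d" unfolding d_def by (rule ah_diff[OF y1 yah])
  have d1: "cg 1 d 0"
  proof -
    have "cg 1 (h \<star> y \<star> h') (mI \<star> y \<star> mI)" by (intro mcong_mult mcong_refl h h'1)
    then have "cg 1 y1 y" by (simp add: y1_def)
    then show ?thesis unfolding d_def by (rule iffD1[OF mcong_diff])
  qed
  have "cg 1 (d \<star> y - y \<star> d) (0 \<star> y - y \<star> 0)" by (intro mcong_sub mcong_mult_left mcong_mult_right d1)
  then have "\<pi> dvd tf N (d \<star> y - y \<star> d)" using tf_cong_right[of 1 "d \<star> y - y \<star> d" 0 N] by simp
  then have "\<beta> d y = 1" by (rule \<beta>_dvd[OF o])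
  then have "E y1 = E d * E y" using E_mult[OF o dah yah] by (simp add: d_def)
  also have "\<dots> = sm (bigpsi \<psi> (qsmul (\<pi> ^ r) (mtr ((qsc a + N) \<star> d)))) (E y)"
    unfolding E_small[OF o dah d1] using blk_left[OF \<Phi>_blk[OF ex_cents[OF o yah]]] by (simp add: E_def[of y])
  finally have 2: "\<Phi> h * E y = sm (bigpsi \<psi> (qsmul (\<pi> ^ r) (mtr ((qsc a + N) \<star> d)))) (E y * \<Phi> h)"
    unfolding 1 by (simp only: sm_mult_left)
  have "qcong \<pi> l (qsmul (\<pi> ^ r) (mtr ((qsc a + N) \<star> d))) (qsmul (\<pi> ^ (r + r)) (mtr (Z \<star> y)))"
  proof -
    have c1: "cg l (h' \<star> (h \<star> B)) B" for B
      using mcong_mult_right[OF h'(2), of \<delta> B] by (simp add: mm_assoc)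
    have t1: "mtr (qsc a \<star> d) = qmul \<delta> a (mtr (h' \<star> (h \<star> y) - y))"
      unfolding d_def y1_def using mtr_qs[of a d] mtr_comm[of \<delta> "h \<star> y" h'] by (simp add: qs_def mm_ring mtr_diff d_def y1_def)
    \<comment> \<open>The scalar part pairs trivially with \<open>d\<close>, because conjugate
      matrices have the same trace.\<close>
    have q1: "qcong \<pi> l (mtr (qsc a \<star> d)) 0"
    proof -
      have "cg l (h' \<star> (h \<star> y) - y) 0" by (rule iffD1[OF mcong_diff c1])
      from mcong_mtr[OF this] show ?thesis unfolding t1 by (simp add: qcong_def qmul_def zero_prod_def)
    qed
    have t2: "mtr (N \<star> d) = mtr (h' \<star> (N \<star> h \<star> y) - N \<star> y)"
      unfolding d_def y1_def mm_diff_right mtr_diff using mtr_comm[of \<delta> "N \<star> h \<star> y" h'] by (simp add: mm_assoc)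
    have "N \<star> h \<star> y = h \<star> (N \<star> y) + msmul (\<pi> ^ r) (Z \<star> y)"
    proof -
      have "N \<star> h = h \<star> N + msmul (\<pi> ^ r) Z" using Z by (simp add: algebra_simps)
      then show ?thesis by (simp add: mm_ring)
    qed
    then have e: "h' \<star> (N \<star> h \<star> y) - N \<star> y = (h' \<star> (h \<star> (N \<star> y)) - N \<star> y) + msmul (\<pi> ^ r) (h' \<star> (Z \<star> y))"
      by (simp add: mm_ring)
    have rl1: "r + 1 \<le> l" using odd_l(1)[OF o] by linarith
    have "cg (r + 1) (h' \<star> (h \<star> (N \<star> y)) - N \<star> y) 0"
      by (rule mcong_mono[OF iffD1[OF mcong_diff c1] rl1])
    moreover have "cg (r + 1) (msmul (\<pi> ^ r) (h' \<star> (Z \<star> y))) (msmul (\<pi> ^ r) (mI \<star> (Z \<star> y)))"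
      by (intro mcong_scaled mcong_mult_right h'1)
    ultimately have "cg (r + 1) (h' \<star> (N \<star> h \<star> y) - N \<star> y) (0 + msmul (\<pi> ^ r) (mI \<star> (Z \<star> y)))"
      unfolding e by (rule mcong_add)
    from mcong_mtr[OF this] have q2: "qcong \<pi> (r + 1) (mtr (N \<star> d)) (qsmul (\<pi> ^ r) (mtr (Z \<star> y)))"
      unfolding t2 by (simp add: mtr_msmul)
    have pd: "\<pi> ^ (r + 1) dvd \<pi> ^ l" by (rule le_imp_power_dvd[OF rl1])
    have add: "\<pi> ^ (r + 1) dvd u + v - w" if "\<pi> ^ l dvd u" "\<pi> ^ (r + 1) dvd v - w" for u v w
      using dvd_add[OF dvd_trans[OF pd that(1)] that(2)] by (simp add: algebra_simps)
    have "qcong \<pi> (r + 1) (mtr ((qsc a + N) \<star> d)) (qsmul (\<pi> ^ r) (mtr (Z \<star> y)))"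
      using q1 q2 add unfolding mm_add_left mtr_add qcong_def fst_add snd_add
      by (simp only: zero_prod_def fst_conv snd_conv diff_0_right)
    \<comment> \<open>As \<open>r + (r + 1) = l\<close>, precision \<open>r + 1\<close> is exactly
      enough after scaling.\<close>
    from qcong_scaled[OF this, of r] show ?thesis
      using odd_l(1)[OF o] unfolding qsmul_mult_eq power_add[symmetric] by (simp only: add.assoc)
  qed
  then show ?thesis using 2 bigpsi_cong by simp
qed

end

section \<open>The tensor product\<close>

locale pair = setting \<pi> \<delta> \<psi> G l +
  c1: crep \<pi> \<delta> \<psi> G l N1 D1 a1 A1 n1 \<phi>1 + c2: crep \<pi> \<delta> \<psi> G l N2 D2 a2 A2 n2 \<phi>2
  for \<pi> :: "'a::idom" and \<delta> \<psi> G l N1 D1 a1 A1 n1 \<phi>1 N2 D2 a2 A2 n2 \<phi>2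
begin

definition H :: "'a m2 set" where "H = cents {N1, N2}"
definition \<rho> :: "'a m2 \<Rightarrow> fm" where "\<rho> g = ten n1 n2 (c1.\<Phi> g) (c2.\<Phi> g)"
definition commutant :: "fm set" where
  "commutant = {Z \<in> blk (n1 * n2) (n1 * n2). \<forall>h\<in>H. Z * \<rho> h = \<rho> h * Z}"

lemma H_D: "h \<in> H \<Longrightarrow> h \<in> cents {N1}" "h \<in> H \<Longrightarrow> h \<in> cents {N2}"
  by (auto simp: H_def cents_def)

lemma H_I: "h \<in> cents {N1} \<Longrightarrow> h \<in> cents {N2} \<Longrightarrow> h \<in> H"
  by (auto simp: H_def cents_def)

lemma H_eq: "Stab G \<delta> \<pi> \<psi> l A1 \<inter> Stab G \<delta> \<pi> \<psi> l A2 = H"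
  unfolding c1.S_eq c2.S_eq using H_D H_I by blast

sublocale pgH: pgroup H mm mI "cg l"
  unfolding H_def by (rule cents_pgroup)

lemma prep\<rho>: "pgH.prep (n1 * n2) \<rho>"
  unfolding pgH.prep_def \<rho>_def
proof (intro conjI ballI impI)
  show "ten n1 n2 (c1.\<Phi> g) (c2.\<Phi> g) \<in> blk (n1 * n2) (n1 * n2)" for g by (rule ten_blk)
  show "ten n1 n2 (c1.\<Phi> g) (c2.\<Phi> g) = ten n1 n2 (c1.\<Phi> h) (c2.\<Phi> h)" if "g \<in> H" "h \<in> H" "cg l g h" for g h
    using c1.\<Phi>_cong[OF H_D(1)[OF that(1)] H_D(1)[OF that(2)] that(3)]
      c2.\<Phi>_cong[OF H_D(2)[OF that(1)] H_D(2)[OF that(2)] that(3)] by simp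
  show "ten n1 n2 (c1.\<Phi> (g \<star> h)) (c2.\<Phi> (g \<star> h)) = ten n1 n2 (c1.\<Phi> g) (c2.\<Phi> g) * ten n1 n2 (c1.\<Phi> h) (c2.\<Phi> h)"
    if "g \<in> H" "h \<in> H" for g h
    unfolding c1.\<Phi>_mult[OF H_D(1)[OF that(1)] H_D(1)[OF that(2)]] c2.\<Phi>_mult[OF H_D(2)[OF that(1)] H_D(2)[OF that(2)]]
    by (rule ten_mult[OF c1.\<Phi>_blk[OF H_D(1)[OF that(1)]] c2.\<Phi>_blk[OF H_D(2)[OF that(1)]], symmetric])
  show "ten n1 n2 (c1.\<Phi> mI) (c2.\<Phi> mI) = idn (n1 * n2)" unfolding c1.\<Phi>_one c2.\<Phi>_one by (rule ten_idn)
qed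

definition EE :: "'a m2 \<times> 'a m2 \<Rightarrow> fm" where "EE = (\<lambda>(v, w). ten n1 n2 (c1.E v) (c2.E w))"
definition BB :: "'a m2 \<times> 'a m2 \<Rightarrow> 'a m2 \<times> 'a m2 \<Rightarrow> complex" where
  "BB = (\<lambda>(v, w) (v', w'). c1.\<beta> v v' * c2.\<beta> w w')"

lemma heis_complete:
  assumes o: "odd l"
  shows "\<exists>Q \<kappa>. heis (n1 * n2) (c1.W \<times> c2.W) (rel_prod (cg 1) (cg 1)) Q EE BB \<and> heis.complete (n1 * n2) Q EE \<kappa>"
proof -
  obtain Q1 Q2 where Q: "transversal (cg 1) c1.W Q1" "transversal (cg 1) c2.W Q2" using transversal_m2 by metis
  obtain \<kappa>1 \<kappa>2 where \<kappa>: "heis.complete n1 Q1 c1.E \<kappa>1" "heis.complete n2 Q2 c2.E \<kappa>2"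
    using c1.complete_E[OF o Q(1)] c2.complete_E[OF o Q(2)] by blast
  note h = c1.heis_E[OF o Q(1)] c2.heis_E[OF o Q(2)]
  show ?thesis unfolding EE_def BB_def
    using heis_tensor[OF h] complete_tensor[OF h \<kappa>] by blast
qed

lemma commutant_mult: assumes "Z \<in> commutant" "Z' \<in> commutant" shows "Z * Z' \<in> commutant"
proof -
  have "Z * Z' * \<rho> h = \<rho> h * (Z * Z')" if "h \<in> H" for h
    using assms that unfolding commutant_def by (metis (mono_tags, lifting) mem_Collect_eq mult.assoc)
  then show ?thesis using assms blk_mult unfolding commutant_def by blast
qed

lemma coef_conj:
  assumes o: "odd l" and hh: "heis (n1 * n2) (c1.W \<times> c2.W) (rel_prod (cg 1) (cg 1)) Q EE BB"
    and Z: "Z \<in> commutant" and h: "h \<in> H"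
    and x: "x \<in> c1.W" "x' \<in> c1.W" "c1.\<Phi> h * c1.E (- x) = sm \<mu>1 (c1.E (- x') * c1.\<Phi> h)"
    and y: "y \<in> c2.W" "y' \<in> c2.W" "c2.\<Phi> h * c2.E (- y) = sm \<mu>2 (c2.E (- y') * c2.\<Phi> h)"
  shows "heis.coef (n1 * n2) EE Z (x, y) = \<mu>1 * \<mu>2 * heis.coef (n1 * n2) EE Z (x', y')"
proof -
  interpret t: heis "n1 * n2" "c1.W \<times> c2.W" "rel_prod (cg 1) (cg 1)" Q EE BB by (rule hh)
  note b = c1.\<Phi>_blk[OF H_D(1)[OF h]] c2.\<Phi>_blk[OF H_D(2)[OF h]]
  have Eb: "c1.E (- x') \<in> blk n1 n1" "c2.E (- y') \<in> blk n2 n2"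
    unfolding c1.E_def c2.E_def
    by (intro c1.\<Phi>_blk c1.ex_cents o g0D(1) c1.WD(1) x c1.W_closed,
        intro c2.\<Phi>_blk c2.ex_cents o g0D(1) c2.WD(1) y c2.W_closed)
  show ?thesis
  proof (rule t.coef_eq_conj[where h = "\<rho> h" and h' = "\<rho> (pgH.iv h)"])
    show "Z \<in> blk (n1 * n2) (n1 * n2)" "Z * \<rho> h = \<rho> h * Z" using Z h by (auto simp: commutant_def)
    show "\<rho> h \<in> blk (n1 * n2) (n1 * n2)" "\<rho> (pgH.iv h) \<in> blk (n1 * n2) (n1 * n2)"
      unfolding \<rho>_def by (rule ten_blk)+
    show "\<rho> h * \<rho> (pgH.iv h) = idn (n1 * n2)" "\<rho> (pgH.iv h) * \<rho> h = idn (n1 * n2)"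
      by (rule pgH.prep_iv[OF prep\<rho> h])+
    show "(x, y) \<in> c1.W \<times> c2.W" "(x', y') \<in> c1.W \<times> c2.W" using x y by auto
    have "\<rho> h * EE (- (x, y)) = ten n1 n2 (c1.\<Phi> h * c1.E (- x)) (c2.\<Phi> h * c2.E (- y))"
      unfolding \<rho>_def EE_def by (simp add: ten_mult[OF b])
    also have "\<dots> = sm (\<mu>1 * \<mu>2) (ten n1 n2 (c1.E (- x') * c1.\<Phi> h) (c2.E (- y') * c2.\<Phi> h))"
      unfolding x(3) y(3) by (rule ten_sm)
    also have "ten n1 n2 (c1.E (- x') * c1.\<Phi> h) (c2.E (- y') * c2.\<Phi> h) = EE (- (x', y')) * \<rho> h"
      unfolding \<rho>_def EE_def by (simp add: ten_mult[OF Eb])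
    finally show "\<rho> h * EE (- (x, y)) = sm (\<mu>1 * \<mu>2) (EE (- (x', y')) * \<rho> h)" .
  qed
qed

abbreviation cf :: "fm \<Rightarrow> 'a m2 \<times> 'a m2 \<Rightarrow> complex" where "cf \<equiv> heis.coef (n1 * n2) EE"
abbreviation hs :: "('a m2 \<times> 'a m2) set \<Rightarrow> bool" where
  "hs Q \<equiv> heis (n1 * n2) (c1.W \<times> c2.W) (rel_prod (cg 1) (cg 1)) Q EE BB"

lemma psi_top: assumes "odd l" "\<pi> dvd t" shows "\<psi> (\<pi> ^ (r + r) * t) = 1"
proof -
  have "\<pi> ^ l = \<pi> ^ (r + r) * \<pi>" by (subst odd_l(1)[OF assms(1)]) (simp add: power_add)
  then show ?thesis using assms(2) by (intro psi_dvd) (simp add: mult_dvd_mono)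
qed

lemma psi_top_nondeg: assumes "odd l" "\<And>z. \<psi> (\<pi> ^ (r + r) * (t * z)) = 1" shows "\<pi> dvd t"
proof -
  have "\<pi> ^ (l - (r + r)) dvd t" by (rule psi_nondeg[OF _ assms(2)]) (use odd_l(1)[OF assms(1)] in linarith)
  moreover have "l - (r + r) = 1" using odd_l(1)[OF assms(1)] by linarith
  ultimately show ?thesis by simp
qed

text \<open>Every \<open>ex X\<close> with \<open>X\<close> in \<open>g0\<close> lies in
  \<open>H\<close> and changes the coefficient by the phase
  \<open>\<psi> (\<pi> ^ (2 r) * tf ([N1, x] + [N2, y]) X)\<close>. A nonzero coefficient makes all
  phases 1, and the form is nondegenerate; by anticommutation each bracket is twice a
  product.\<close>

lemma coef_adm:
  assumes o: "odd l" and hh: "hs Q" and Z: "Z \<in> commutant" and x: "x \<in> c1.W" and y: "y \<in> c2.W"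
    and nz: "cf Z (x, y) \<noteq> 0"
  shows "cg 1 (N1 \<star> x + N2 \<star> y) 0"
proof -
  let ?U = "(N1 \<star> x - x \<star> N1) + (N2 \<star> y - y \<star> N2)"
  have Ug: "?U \<in> g0" by (intro g0_add g0_bracket c1.N c2.N c1.WD(1) c2.WD(1) x y)
  have "cg (l - (r + r)) ?U 0"
  proof (rule g0_form_nondeg[OF Ug])
    show "r + r \<le> l" using odd_l(1)[OF o] by linarith
    fix X assume X: "X \<in> g0"
    have Xah: "ah X" by (rule g0D(1)[OF X])
    have exH: "ex X \<in> H" unfolding H_def by (rule cents_near_one[OF ex_Gl[OF o Xah] ex_near_one])
    have mx: "- x \<in> c1.W" and my: "- y \<in> c2.W" using x y c1.W_closed c2.W_closed by auto
    have k1: "tf N1 (X \<star> (- x) - (- x) \<star> X) = tf (N1 \<star> x - x \<star> N1) X"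
      unfolding tf_bracket[symmetric] by (simp add: mm_ring)
    have k2: "tf N2 (X \<star> (- y) - (- y) \<star> X) = tf (N2 \<star> y - y \<star> N2) X"
      unfolding tf_bracket[symmetric] by (simp add: mm_ring)
    have "cf Z (x, y) = \<psi> (\<pi> ^ (r + r) * tf (N1 \<star> x - x \<star> N1) X) * \<psi> (\<pi> ^ (r + r) * tf (N2 \<star> y - y \<star> N2) X) * cf Z (x, y)"
      by (rule coef_conj[OF o hh Z exH x x _ y y])
        (use c1.E_comm[OF o Xah g0D(1)[OF c1.WD(1)[OF mx]]] c2.E_comm[OF o Xah g0D(1)[OF c2.WD(1)[OF my]]]
          in \<open>simp_all only: k1 k2 c1.E_def[of X] c2.E_def[of X]\<close>)
    then show "\<psi> (\<pi> ^ (r + r) * tf ?U X) = 1"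
      using nz by (simp add: psi_add[symmetric] tf_add_left distrib_left)
  qed
  moreover have "l - (r + r) = 1" using odd_l(1)[OF o] by linarith
  moreover have "?U = msmul 2 (N1 \<star> x + N2 \<star> y)"
  proof -
    have "?U = (N1 \<star> x + N2 \<star> y) + (N1 \<star> x + N2 \<star> y)" unfolding c1.W_anti[OF x] c2.W_anti[OF y] by simp
    also have "\<dots> = msmul (1 + 1) (N1 \<star> x + N2 \<star> y)" by (simp only: msmul_add_left msmul_1)
    finally show ?thesis by simp
  qed
  ultimately have "cg 1 (msmul 2 (N1 \<star> x + N2 \<star> y)) (msmul 2 0)" by simp
  then show ?thesis by (rule mcong_unit_cancel[OF pi_2])
qed

text \<open>Multiply the congruences \<open>N1 x = - N2 y\<close> and
  \<open>N1 x' = - N2 y'\<close>; anticommutation brings equal factors together into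
  \<open>D1\<close> and \<open>D2\<close>.\<close>

lemma adm_product:
  assumes "x \<in> c1.W" "y \<in> c2.W" "x' \<in> c1.W" "y' \<in> c2.W"
    and "cg 1 (N1 \<star> x + N2 \<star> y) 0" "cg 1 (N1 \<star> x' + N2 \<star> y') 0"
  shows "cg 1 (msmul D1 (x \<star> x')) (msmul D2 (y \<star> y'))"
proof -
  have n: "cg 1 (N1 \<star> u) (- (N2 \<star> v))" if "cg 1 (N1 \<star> u + N2 \<star> v) 0" for u v
    using mcong_sub[OF that mcong_refl, of "N2 \<star> v"] by simp
  have e1: "N1 \<star> x \<star> (N1 \<star> x') = - msmul D1 (x \<star> x')"
  proof -
    have "N1 \<star> x \<star> (N1 \<star> x') = N1 \<star> (x \<star> N1) \<star> x'" by (simp only: mm_assoc)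
    also have "\<dots> = - (N1 \<star> N1 \<star> (x \<star> x'))" unfolding c1.W_anti[OF assms(1)] by (simp only: mm_minus_left mm_minus_right mm_assoc)
    finally show ?thesis by (simp add: c1.NN msmul_mult_left)
  qed
  have e2: "N2 \<star> y \<star> (N2 \<star> y') = - msmul D2 (y \<star> y')"
  proof -
    have "N2 \<star> y \<star> (N2 \<star> y') = N2 \<star> (y \<star> N2) \<star> y'" by (simp only: mm_assoc)
    also have "\<dots> = - (N2 \<star> N2 \<star> (y \<star> y'))" unfolding c2.W_anti[OF assms(2)] by (simp only: mm_minus_left mm_minus_right mm_assoc)
    finally show ?thesis by (simp add: c2.NN msmul_mult_left)
  qed
  have "cg 1 (N1 \<star> x \<star> (N1 \<star> x')) (- (N2 \<star> y) \<star> (- (N2 \<star> y')))" by (intro mcong_mult n assms)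
  then have "cg 1 (- msmul D1 (x \<star> x')) (- msmul D2 (y \<star> y'))" unfolding e1 by (simp only: mm_minus_left mm_minus_right minus_minus e2)
  from mcong_minus[OF this] show ?thesis by simp
qed

text \<open>An element \<open>h\<close> of the algebra of \<open>N1\<close> at depth
  \<open>m = r - j\<close> from 1 commutes with \<open>N2\<close> modulo \<open>\<pi> ^ r\<close>,
  so it lies in \<open>H\<close>. It fixes the first operator and multiplies the second by a phase
  in \<open>tf V y\<close>, which a nonzero coefficient forces to be trivial.\<close>

lemma coef_V:
  assumes o: "odd l" and hh: "hs Q" and Z: "Z \<in> commutant" and x: "x \<in> c1.W" and y: "y \<in> c2.W"
    and nz: "cf Z (x, y) \<noteq> 0"
    and j: "j < r" and V: "V \<in> g0" "N2 \<star> N1 - N1 \<star> N2 = msmul (\<pi> ^ j) V"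
  shows "\<pi> dvd tf V y"
proof (rule psi_top_nondeg[OF o])
  fix z
  define m where "m = r - j"
  have m: "1 \<le> m" "m + j = r" using j by (auto simp: m_def)
  \<comment> \<open>The sign of \<open>- z\<close> compensates the one of \<open>- y\<close> in the
    definition of the coefficient.\<close>
  obtain h x0 Y where h: "h \<in> c1.C" "h = c1.alg x0 (qsmul (\<pi> ^ m) Y)" "cg 1 h mI" "qcong \<pi> 1 Y (- z, 0)"
    using c1.near_one_C[OF m(1), of "- z"] by blast
  have comm: "N2 \<star> h - h \<star> N2 = msmul (\<pi> ^ r) (qs Y V)"
  proof -
    have "N2 \<star> h - h \<star> N2 = msmul (\<pi> ^ m) (qs Y (N2 \<star> N1 - N1 \<star> N2))"
      unfolding h(2) c1.alg_def by (simp add: mm_ring qs_ring qs_qsmul)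
    then show ?thesis unfolding V(2) using m(2) by (simp add: qs_msmul power_add[symmetric])
  qed
  have h2: "h \<in> cents {N2}"
  proof -
    have "cg r (N2 \<star> h - h \<star> N2) 0" unfolding comm by (rule mcong_pow_0) simp
    then have "cg r (h \<star> N2) (N2 \<star> h)" by (rule mcong_sym[OF iffD2[OF mcong_diff]])
    then show ?thesis using c1.C_D(2)[OF h(1)] by (simp add: cents_def)
  qed
  have hH: "h \<in> H" by (rule H_I[OF c1.C_cents[OF h(1)] h2])
  have mx: "- x \<in> c1.W" and my: "- y \<in> c2.W" using x y c1.W_closed c2.W_closed by auto
  have q0: "qcong \<pi> 1 (qsmul (\<pi> ^ m) Y) 0"
    using m(1) by (simp add: qcong_def qsmul_def zero_prod_def dvd_mult2 dvd_power)
  have 1: "c1.\<Phi> h * c1.E (- x) = sm 1 (c1.E (- x) * c1.\<Phi> h)"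
    using c1.E_act[OF o h(1) mx] c1.E_per[OF o c1.act_W[OF h(1) mx] mx c1.act_trivial[OF h(1,2) q0 mx]] by simp
  note t = c1.ct[OF h(1)]
  let ?b = "bigpsi \<psi> (qsmul (\<pi> ^ (r + r)) (mtr (qs Y V \<star> (- y))))"
  have 2: "c2.\<Phi> h * c2.E (- y) = sm ?b (c2.E (- y) * c2.\<Phi> h)"
    by (rule c2.E_conj_near_one[OF o h2 h(3) GsetD(1)[OF c1.C_D(2)[OF t(1)]] t(2) t(4) c2.WD(1)[OF my] comm])
  have "cf Z (x, y) = 1 * ?b * cf Z (x, y)" by (rule coef_conj[OF o hh Z hH x x 1 y y 2])
  then have b1: "?b = 1" using nz by simp
  have "mtr (qs Y V \<star> (- y)) = qmul \<delta> Y (- tf V y, 0)"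
    using mtr_g0[OF V(1) c2.WD(1)[OF my]] by (simp add: qs_mult_left mtr_qs tf_minus_right)
  moreover have "qcong \<pi> 1 (qmul \<delta> Y (- tf V y, 0)) (tf V y * z, 0)"
  proof -
    have "\<pi> dvd fst Y - (- z)" "\<pi> dvd snd Y" using h(4) by (simp_all add: qcong_def)
    from this[THEN dvd_mult2, of "- tf V y"]
    have "\<pi> dvd (fst Y - (- z)) * (- tf V y)" "\<pi> dvd snd Y * (- tf V y)" .
    moreover have "fst Y * (- tf V y) - tf V y * z = (fst Y - (- z)) * (- tf V y)" by (simp add: algebra_simps)
    ultimately show ?thesis
      unfolding qcong_def qmul_def fst_conv snd_conv by (simp only: mult_zero_right add_0_right add_0_left diff_0_right power_one_right simp_thms)
  qed
  ultimately have "qcong \<pi> (r + r + 1) (qsmul (\<pi> ^ (r + r)) (mtr (qs Y V \<star> (- y)))) (qsmul (\<pi> ^ (r + r)) (tf V y * z, 0))"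
    using qcong_scaled[of 1 _ _ "r + r"] by simp
  then have "?b = bigpsi \<psi> (qsmul (\<pi> ^ (r + r)) (tf V y * z, 0))"
    using bigpsi_cong odd_l(1)[OF o] by (simp only:)
  then show "\<psi> (\<pi> ^ (r + r) * (tf V y * z)) = 1" using b1 by (simp add: qsmul_def bigpsi_real)
qed

text \<open>Modulo \<pi> the bracket of \<open>y\<close> and \<open>y'\<close> commutes with
  \<open>V\<close>, since both anticommute with it, and with \<open>N1\<close>, since
  \<open>adm_product\<close> makes it proportional to the bracket of \<open>x\<close> and
  \<open>x'\<close>. As \<open>V\<close> and \<open>N1\<close> anticommute, no nonzero traceless
  matrix commutes with both.\<close>

lemma adm_bracket_0:
  assumes V: "V \<in> c1.W" "\<not> cg 1 V 0"
    and xy: "x \<in> c1.W" "y \<in> c2.W" "x' \<in> c1.W" "y' \<in> c2.W"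
    and a: "cg 1 (N1 \<star> x + N2 \<star> y) 0" "cg 1 (N1 \<star> x' + N2 \<star> y') 0"
    and b: "\<pi> dvd tf V y" "\<pi> dvd tf V y'"
  shows "cg 1 (x \<star> x' - x' \<star> x) 0" "cg 1 (y \<star> y' - y' \<star> y) 0"
proof -
  let ?T = "y \<star> y' - y' \<star> y" and ?S = "x \<star> x' - x' \<star> x"
  have TS: "cg 1 (msmul D1 ?S) (msmul D2 ?T)"
    unfolding msmul_diff by (intro mcong_sub adm_product xy a)
  have Tg: "?T \<in> g0" by (intro g0_bracket c2.WD(1) xy)
  have anti: "cg 1 (V \<star> w) (- (w \<star> V))" if "w \<in> g0" "\<pi> dvd tf V w" for w
  proof -
    have "cg 1 (V \<star> w + w \<star> V) 0"
      unfolding g0_anticomm[OF c1.WD(1)[OF V(1)] that(1)] mI_cong_0_iff using that(2) by simp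
    from mcong_sub[OF this mcong_refl, of "w \<star> V"] show ?thesis by simp
  qed
  have Vprod: "cg 1 (V \<star> (v \<star> w)) (v \<star> w \<star> V)" if "v \<in> g0" "w \<in> g0" "\<pi> dvd tf V v" "\<pi> dvd tf V w" for v w
  proof -
    have 1: "cg 1 (V \<star> v \<star> w) (- (v \<star> V) \<star> w)" by (intro mcong_mult_right anti that)
    have 2: "cg 1 (- v \<star> (V \<star> w)) (- v \<star> (- (w \<star> V)))" by (intro mcong_mult_left anti that)
    from mcong_trans[OF 1[unfolded mm_minus_left mm_assoc] 2[unfolded mm_minus_left]] show ?thesis
      by (simp only: mm_minus_right minus_minus mm_assoc)
  qed
  have VT: "cg 1 (V \<star> ?T) (?T \<star> V)"
    unfolding mm_diff_left mm_diff_right by (intro mcong_sub Vprod c2.WD(1) xy b)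
  have SN: "?S \<star> N1 = N1 \<star> ?S"
  proof -
    have "u \<star> v \<star> N1 = N1 \<star> (u \<star> v)" if "u \<in> c1.W" "v \<in> c1.W" for u v
    proof -
      have "u \<star> v \<star> N1 = u \<star> (v \<star> N1)" by (rule mm_assoc)
      also have "\<dots> = - (u \<star> N1 \<star> v)" unfolding c1.W_anti[OF that(2)] by (simp only: mm_minus_right mm_assoc)
      also have "\<dots> = N1 \<star> (u \<star> v)" unfolding c1.W_anti[OF that(1)] by (simp only: mm_minus_left minus_minus mm_assoc)
      finally show ?thesis .
    qed
    then show ?thesis using xy by (simp add: mm_diff_left mm_diff_right)
  qed
  have TN: "cg 1 (?T \<star> N1) (N1 \<star> ?T)"
  proof (rule mcong_unit_cancel[OF c2.D_unit])
    have 1: "cg 1 (msmul D1 (?S \<star> N1)) (msmul D2 (?T \<star> N1))"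
      using mcong_mult_right[OF TS, of \<delta> N1] by (simp only: msmul_mult_left)
    have 2: "cg 1 (msmul D1 (N1 \<star> ?S)) (msmul D2 (N1 \<star> ?T))"
      using mcong_mult_left[OF TS, of \<delta> N1] by (simp only: msmul_mult_right)
    show "cg 1 (msmul D2 (?T \<star> N1)) (msmul D2 (N1 \<star> ?T))"
      by (rule mcong_trans[OF mcong_sym[OF 1[unfolded SN]] 2])
  qed
  define \<tau> where "\<tau> = tf ?T N1"
  have two: "msmul 2 (?T \<star> N1) = ?T \<star> N1 + ?T \<star> N1"
    using msmul_add_left[of 1 1 "?T \<star> N1"] by simp
  have TN\<tau>: "cg 1 (msmul 2 (?T \<star> N1)) (msmul \<tau> mI)"
    unfolding two \<tau>_def g0_anticomm[OF Tg c1.N, symmetric] by (intro mcong_add mcong_refl TN)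
  have "\<pi> dvd \<tau>"
  proof (rule ccontr)
    assume nd: "\<not> \<pi> dvd \<tau>"
    have 1: "cg 1 (msmul 2 (V \<star> (?T \<star> N1))) (msmul \<tau> V)"
      using mcong_mult_left[OF TN\<tau>, of \<delta> V] by (simp only: msmul_mult_right mm_one_right)
    have 2: "cg 1 (msmul 2 (?T \<star> N1 \<star> V)) (msmul \<tau> V)"
      using mcong_mult_right[OF TN\<tau>, of \<delta> V] by (simp only: msmul_mult_left mm_one_left)
    have 3: "cg 1 (V \<star> (?T \<star> N1)) (- (?T \<star> N1 \<star> V))"
      using mcong_mult_right[OF VT, of \<delta> N1]
      by (simp only: mm_assoc c1.W_anti[OF V(1)] mm_minus_right)
    have "cg 1 (msmul 2 (V \<star> (?T \<star> N1))) (- msmul 2 (?T \<star> N1 \<star> V))"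
      using mcong_msmul[OF 3, of 2] by (simp only: msmul_minus)
    \<comment> \<open>\<open>V\<close> commutes with \<open>?T\<close> and anticommutes with
      \<open>N1\<close>, so it anticommutes with their product; but twice that product is the scalar
      \<tau>.\<close>
    then have "cg 1 (msmul \<tau> V) (- msmul \<tau> V)"
      using mcong_trans[OF mcong_sym[OF 1]] mcong_trans[OF _ mcong_minus[OF 2]] by blast
    from mcong_add[OF this mcong_refl, of "msmul \<tau> V"] have "cg 1 (msmul (\<tau> + \<tau>) V) 0"
      by (simp only: msmul_add_left add.left_inverse)
    then have "cg 1 (msmul (2 * \<tau>) V) (msmul (2 * \<tau>) 0)" by (simp only: mult_2 msmul_zero)
    moreover have "\<not> \<pi> dvd 2 * \<tau>" using nd pi_2 pi_prime by blast
    ultimately have "cg 1 V 0" using mcong_unit_cancel by blast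
    then show False using V(2) by simp
  qed
  then have "cg 1 (msmul \<tau> mI) 0" unfolding mI_cong_0_iff by simp
  then have "cg 1 (msmul 2 (?T \<star> N1)) (msmul 2 0)" using mcong_trans[OF TN\<tau>] by simp
  then have "cg 1 (?T \<star> N1) 0" by (rule mcong_unit_cancel[OF pi_2])
  from mcong_mult_right[OF this, of \<delta> N1] have "cg 1 (msmul D1 ?T) (msmul D1 0)"
    by (simp only: mm_assoc[of \<delta> _ N1 N1] c1.NN msmul_mult_right mm_one_right mm_zero_left msmul_zero)
  then show T0: "cg 1 ?T 0" by (rule mcong_unit_cancel[OF c1.D_unit])
  have "cg 1 (msmul D1 ?S) (msmul D1 0)"
    using mcong_trans[OF TS mcong_msmul[OF T0, of D2]] by simp
  then show "cg 1 ?S 0" by (rule mcong_unit_cancel[OF c1.D_unit])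
qed

lemma commutant_commutative_A:
  assumes o: "odd l" and nc: "\<not> cg r (N1 \<star> N2) (N2 \<star> N1)" and Z: "Z \<in> commutant" "Z' \<in> commutant"
  shows "Z * Z' = Z' * Z"
proof -
  define K where "K = N2 \<star> N1 - N1 \<star> N2"
  have Kg: "K \<in> g0" unfolding K_def by (rule g0_bracket[OF c2.N c1.N])
  have nK: "\<not> cg r K 0" unfolding K_def using nc mcong_sym[OF iffD2[OF mcong_diff]] by blast
  \<comment> \<open>The exact order \<open>j\<close> to which \<open>N1\<close> and
    \<open>N2\<close> commute, so that the commutator divided by \<open>\<pi> ^ j\<close> is nonzero
    modulo \<pi>.\<close>
  have "\<exists>j<r. cg j K 0 \<and> \<not> cg (Suc j) K 0"
  proof (rule ccontr)
    assume no: "\<not> ?thesis"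
    have "i \<le> r \<longrightarrow> cg i K 0" for i
    proof (induction i)
      case 0 show ?case by (simp add: mcong_iff_dvd)
    next
      case (Suc i) then show ?case using no by auto
    qed
    then show False using nK by blast
  qed
  then obtain j where j: "j < r" "cg j K 0" "\<not> cg (Suc j) K 0" by blast
  obtain V where V: "V \<in> g0" "K = msmul (\<pi> ^ j) V" using g0_div[OF Kg j(2)] by blast
  have V0: "\<not> cg 1 V 0"
  proof
    assume "cg 1 V 0"
    from mcong_scaled[OF this, of j] show False using j(3) V(2) by simp
  qed
  \<comment> \<open>A commutator with \<open>N1\<close> is orthogonal to \<open>N1\<close>, so
    \<open>V\<close> lies in the plane of \<open>N1\<close>.\<close>
  have "\<pi> ^ j * tf V N1 = tf K N1" unfolding V(2) tf_msmul_left ..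
  also have "\<dots> = 0"
  proof -
    have "tf K N1 = - tf N1 (N1 \<star> N2 - N2 \<star> N1)" unfolding K_def by (simp add: tf_sym[of _ N1] tf_lin)
    also have "\<dots> = 0" unfolding tf_bracket by simp
    finally show ?thesis .
  qed
  finally have "tf V N1 = 0" using pi_nz by simp
  then have VW: "V \<in> c1.W" using V(1) by (simp add: c1.W_def)
  obtain Q \<kappa> where hh: "hs Q" and \<kappa>: "heis.complete (n1 * n2) Q EE \<kappa>" using heis_complete[OF o] by blast
  interpret t: heis "n1 * n2" "c1.W \<times> c2.W" "rel_prod (cg 1) (cg 1)" Q EE BB by (rule hh)
  define Ad where "Ad = {(x, y). cg 1 (N1 \<star> x + N2 \<star> y) 0 \<and> \<pi> dvd tf V y}"
  have supp: "cf Z v = 0" if Zc: "Z \<in> commutant" and vW: "v \<in> c1.W \<times> c2.W" and vA: "v \<notin> Ad" for Z v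
  proof (rule ccontr)
    assume nz: "cf Z v \<noteq> 0"
    obtain x y where v: "v = (x, y)" "x \<in> c1.W" "y \<in> c2.W" using vW by auto
    show False
      using coef_adm[OF o hh Zc v(2,3) nz[unfolded v(1)]] V(2)
        coef_V[OF o hh Zc v(2,3) nz[unfolded v(1)] j(1) V(1)] vA unfolding v(1) Ad_def K_def by simp
  qed
  show ?thesis
  proof (rule t.commute_if_coef_supported[OF \<kappa>, of _ _ Ad])
    show "Z \<in> blk (n1 * n2) (n1 * n2)" "Z' \<in> blk (n1 * n2) (n1 * n2)" using Z by (auto simp: commutant_def)
    show "cf Z v = 0" "cf Z' v = 0" if "v \<in> c1.W \<times> c2.W" "v \<notin> Ad" for v using supp Z that by blast+
    fix v w assume vw: "v \<in> c1.W \<times> c2.W" "w \<in> c1.W \<times> c2.W" "v \<in> Ad" "w \<in> Ad"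
    obtain x y x' y' where e: "v = (x, y)" "w = (x', y')" by (cases v; cases w)
    have xy: "x \<in> c1.W" "y \<in> c2.W" "x' \<in> c1.W" "y' \<in> c2.W" and a: "cg 1 (N1 \<star> x + N2 \<star> y) 0" "cg 1 (N1 \<star> x' + N2 \<star> y') 0"
      and b: "\<pi> dvd tf V y" "\<pi> dvd tf V y'" using vw unfolding e Ad_def by auto
    note z = adm_bracket_0[OF VW V0 xy a b]
    have "\<pi> dvd tf N1 (x \<star> x' - x' \<star> x)" "\<pi> dvd tf N2 (y \<star> y' - y' \<star> y)"
      using tf_dvd[OF z(1), of N1] tf_dvd[OF z(2), of N2] by (simp_all add: tf_sym)
    then have "(c1.\<beta> x x')\<^sup>2 = 1" "(c2.\<beta> y y')\<^sup>2 = 1"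
      unfolding c1.\<beta>_sq c2.\<beta>_sq by (auto intro: psi_top[OF o])
    then show "(BB v w)\<^sup>2 = 1" unfolding e BB_def by (simp add: power_mult_distrib)
  qed
qed

lemma commutant_commutative_B:
  assumes o: "odd l" and N2b: "N2 = msmul b N1" and b: "\<not> \<pi> dvd b"
    and Ds: "G = GU \<Longrightarrow> \<exists>s. \<pi> dvd D1 - \<delta> * (s * s)" and Z: "Z \<in> commutant" "Z' \<in> commutant"
  shows "Z * Z' = Z' * Z"
proof -
  have "b \<noteq> 0" using b by auto
  then have WW: "c2.W = c1.W" unfolding c1.W_def c2.W_def unfolding N2b tf_msmul_right by simp
  obtain Q \<kappa> where hh: "hs Q" and \<kappa>: "heis.complete (n1 * n2) Q EE \<kappa>" using heis_complete[OF o] by blast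
  interpret t: heis "n1 * n2" "c1.W \<times> c2.W" "rel_prod (cg 1) (cg 1)" Q EE BB by (rule hh)
  define s where "s = (\<lambda>(x, y). (c1.sr x, c1.sr y))"
  \<comment> \<open>With \<open>N2 = b N1\<close> the support condition reads
    \<open>x + b y = 0\<close> modulo \<pi>, so \<open>x\<close> determines
    \<open>y\<close>.\<close>
  have adm: "cg 1 (x + msmul b y) 0" if "Z \<in> commutant" "x \<in> c1.W" "y \<in> c2.W" "cf Z (x, y) \<noteq> 0" for Z x y
  proof -
    have "N1 \<star> x + N2 \<star> y = N1 \<star> (x + msmul b y)" unfolding N2b by (simp add: mm_ring)
    then have "cg 1 (N1 \<star> (x + msmul b y)) 0" using coef_adm[OF o hh that] by simp
    from mcong_mult_left[OF this, of \<delta> N1]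
    have "cg 1 (msmul D1 (x + msmul b y)) (msmul D1 0)"
      by (simp only: mm_assoc[symmetric] c1.NN msmul_mult_left mm_one_left mm_zero_right msmul_zero)
    then show ?thesis by (rule mcong_unit_cancel[OF c1.D_unit])
  qed
  have sW: "s v \<in> c1.W \<times> c2.W" if "v \<in> c1.W \<times> c2.W" for v
    using that c1.sr_W by (cases v) (auto simp: s_def WW)
  have inv: "cf Z (s v) = cf Z v" if Z: "Z \<in> commutant" and v: "v \<in> c1.W \<times> c2.W" for Z v
  proof -
    obtain x y where e: "v = (x, y)" by (cases v)
    have x: "x \<in> c1.W" and y: "y \<in> c2.W" "y \<in> c1.W" using v WW unfolding e by auto
    have sx: "c1.sr x \<in> c1.W" and sy: "c1.sr y \<in> c2.W" using c1.sr_W x y WW by auto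
    have sv: "s v = (c1.sr x, c1.sr y)" unfolding e s_def by simp
    have xby: "x + msmul b y \<in> c1.W" by (intro c1.W_closed x y)
    show ?thesis
    proof (cases "cg 1 (x + msmul b y) 0")
      case False
      have "cf Z (x, y) = 0" using adm[OF Z x y(1)] False by blast
      moreover have "cf Z (c1.sr x, c1.sr y) = 0"
      proof (rule ccontr)
        assume "cf Z (c1.sr x, c1.sr y) \<noteq> 0"
        then have "cg 1 (c1.sr x + msmul b (c1.sr y)) 0" by (rule adm[OF Z sx sy])
        then have "cg 1 (c1.sr (x + msmul b y)) 0" unfolding c1.sr_lin .
        from c1.sr_cong[OF this] have "cg 1 (x + msmul b y) (c1.sr 0)" unfolding c1.sr_sr[OF xby] .
        then show False using False by (simp add: c1.sr_def)
      qed
      ultimately show ?thesis unfolding sv unfolding e by simp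
    next
      case True
      \<comment> \<open>Two maps that respect the relation \<open>x + b y = 0\<close> and agree at
        \<open>x\<close> modulo \<pi> also agree at \<open>y\<close>. Thus a statement about
        \<open>x\<close> carries over to the pair.\<close>
      have y_of_x: "cg 1 (f y) (g y)"
        if f: "f (x + msmul b y) = f x + msmul b (f y)" "cg 1 (f (x + msmul b y)) 0"
          and g: "g (x + msmul b y) = g x + msmul b (g y)" "cg 1 (g (x + msmul b y)) 0"
          and fg: "cg 1 (f x) (g x)" for f g :: "'a m2 \<Rightarrow> 'a m2"
      proof (rule mcong_unit_cancel[OF b])
        have "cg 1 (f x + msmul b (f y) - f x) (g x + msmul b (g y) - g x)"
          by (rule mcong_sub[OF mcong_trans[OF f(2)[unfolded f(1)] mcong_sym[OF g(2)[unfolded g(1)]]] fg])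
        then show "cg 1 (msmul b (f y)) (msmul b (g y))" by simp
      qed
      have sr0: "cg 1 (c1.sr (x + msmul b y)) 0" using c1.sr_cong[OF True] by (simp add: c1.sr_def)
      show ?thesis
      proof (cases "cg 1 x 0")
        case x0: True
        have "cg 1 (c1.sr x) 0" using c1.sr_cong[OF x0] by (simp add: c1.sr_def)
        then have 1: "cg 1 (c1.sr x) x" by (rule mcong_trans[OF _ mcong_sym[OF x0]])
        have "cg 1 (c1.sr y) y"
          by (rule y_of_x[of c1.sr "\<lambda>v. v", OF c1.sr_lin(2)[of x "msmul b y", unfolded c1.sr_lin(3)] sr0 refl True 1])
        then have "rel_prod (cg 1) (cg 1) (s v) v" unfolding sv unfolding e using 1 by simp
        then show ?thesis by (rule t.coef_per[OF sW[OF v] v])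
      next
        case False
        \<comment> \<open>One element \<open>t\<close> realises the reflection at \<open>x\<close>,
          hence at \<open>y\<close>; it lies in \<open>H\<close> because it commutes with
          \<open>N1\<close> and so with \<open>b N1\<close>.\<close>
        obtain t where t: "t \<in> c1.C" "cg 1 (c1.act t x) (c1.sr x)" using c1.sr_orbit[OF x False Ds] by blast
        have act0: "cg 1 (c1.act t (x + msmul b y)) 0" using c1.act_cong[OF True, of t] by (simp add: c1.act_lin)
        have ty: "cg 1 (c1.act t y) (c1.sr y)"
          by (rule y_of_x[of "c1.act t" c1.sr, OF c1.act_lin(1)[of t x "msmul b y", unfolded c1.act_lin(4)] act0
                c1.sr_lin(2)[of x "msmul b y", unfolded c1.sr_lin(3)] sr0 t(2)])
        have tN2: "t \<in> cents {N2}"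
          using c1.Alg_commN[OF c1.C_D(1)[OF t(1)]] c1.C_D(2)[OF t(1)]
          by (simp add: cents_def N2b msmul_mult_left msmul_mult_right)
        have tH: "t \<in> H" by (rule H_I[OF c1.C_cents[OF t(1)] tN2])
        have mx: "- x \<in> c1.W" and my: "- y \<in> c1.W" using x y c1.W_closed by auto
        have ax: "c1.act t x \<in> c1.W" and ay: "c1.act t y \<in> c2.W" using c1.act_W[OF t(1)] x y WW by auto
        have 1: "c1.\<Phi> t * c1.E (- x) = sm 1 (c1.E (- c1.act t x) * c1.\<Phi> t)"
          using c1.E_act[OF o t(1) mx] by (simp add: c1.act_lin)
        have 2: "c2.\<Phi> t * c2.E (- y) = sm 1 (c2.E (- c1.act t y) * c2.\<Phi> t)"
          using c2.E_conj[OF o tN2 g0D(1)[OF c1.WD(1)[OF my]] g0D(1)[OF c1.WD(1)[OF c1.act_W[OF t(1) my]]]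
              c1.act_commute[OF t(1)]] by (simp add: c1.act_lin)
        have "cf Z (x, y) = 1 * 1 * cf Z (c1.act t x, c1.act t y)"
          by (rule coef_conj[OF o hh Z tH x ax 1 y(1) ay 2])
        also have "\<dots> = cf Z (c1.sr x, c1.sr y)"
          using t.coef_per[of "(c1.act t x, c1.act t y)" "(c1.sr x, c1.sr y)" Z] ax ay sx sy t(2) ty by simp
        finally show ?thesis unfolding sv unfolding e ..
      qed
    qed
  qed
  show ?thesis
  proof (rule t.commute_if_coef_invariant[OF \<kappa>, of commutant s])
    show "Z \<in> blk (n1 * n2) (n1 * n2)" if "Z \<in> commutant" for Z using that by (simp add: commutant_def)
    show "Z * Z' \<in> commutant" if "Z \<in> commutant" "Z' \<in> commutant" for Z Z' by (rule commutant_mult[OF that])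
    show "s v \<in> c1.W \<times> c2.W" if "v \<in> c1.W \<times> c2.W" for v by (rule sW[OF that])
    show "s (v - w) = s v - s w" for v w by (cases v; cases w) (simp add: s_def c1.sr_lin)
    show "rel_prod (cg 1) (cg 1) v w"
      if "v \<in> c1.W \<times> c2.W" "w \<in> c1.W \<times> c2.W" "rel_prod (cg 1) (cg 1) (s v) (s w)" for v w
      using that c1.sr_cong_iff by (cases v; cases w) (simp add: s_def WW)
    \<comment> \<open>Both pairings are reversed by the same reflection, since the second is formed
      with the multiple \<open>b N1\<close>.\<close>
    show "BB (s v) (s w) = BB w v" if "v \<in> c1.W \<times> c2.W" "w \<in> c1.W \<times> c2.W" for v w
    proof -
      obtain x y x' y' where e: "v = (x, y)" "w = (x', y')" by (cases v; cases w)
      have W: "x \<in> c1.W" "y \<in> c1.W" "x' \<in> c1.W" "y' \<in> c1.W" using that WW unfolding e by auto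
      have "c2.\<beta> (c1.sr y) (c1.sr y') = c2.\<beta> y' y"
        unfolding c2.\<beta>_def unfolding N2b tf_msmul_left c1.tf_sr[OF W(2,4)] ..
      then show ?thesis unfolding e s_def BB_def using c1.\<beta>_sr[OF W(1,3)] by simp
    qed
    show "cf Z (s v) = cf Z v" if "Z \<in> commutant" "v \<in> c1.W \<times> c2.W" for Z v by (rule inv[OF that])
  qed (rule Z)+
qed

lemma commutant_commutative_even:
  assumes "even l" "Z \<in> commutant" "Z' \<in> commutant"
  shows "Z * Z' = Z' * Z"
proof -
  have n: "n1 * n2 = 1" using c1.even_dim[OF assms(1)] c2.even_dim[OF assms(1)] by simp
  have Zb: "Z \<in> blk 1 1" "Z' \<in> blk 1 1" using assms(2,3) n by (simp_all add: commutant_def)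
  show ?thesis
  proof (rule fm_eqI)
    fix i j
    show "ent (Z * Z') i j = ent (Z' * Z) i j"
      by (cases "i = 0"; cases "j = 0") (use Zb in \<open>auto simp: ent_blk_mult[OF Zb(1)] ent_blk_mult[OF Zb(2)] blk_iff\<close>)
  qed
qed

text \<open>Carries \<open>multiplicity_le_one\<close> back to matrices of fixed size.\<close>

lemma multiplicity_free_if_commutative:
  assumes comm: "\<And>Z Z'. Z \<in> commutant \<Longrightarrow> Z' \<in> commutant \<Longrightarrow> Z * Z' = Z' * Z"
  shows "multiplicity_free G \<delta> \<pi> l (Stab G \<delta> \<pi> \<psi> l A1 \<inter> Stab G \<delta> \<pi> \<psi> l A2) (n1 * n2)
     (\<lambda>g. tensor_mat n1 n2 (\<phi>1 g) (\<phi>2 g))"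
  unfolding multiplicity_free_def H_eq
proof (intro allI impI, elim conjE)
  fix m \<sigma> T1 T2
  assume irr: "irreducible_rep G \<delta> \<pi> l H m \<sigma>" and T: "T1 \<in> carrier_mat (n1 * n2) m" "T2 \<in> carrier_mat (n1 * n2) m"
    and i: "\<forall>h\<in>H. T1 * \<sigma> h = tensor_mat n1 n2 (\<phi>1 h) (\<phi>2 h) * T1" "\<forall>h\<in>H. T2 * \<sigma> h = tensor_mat n1 n2 (\<phi>1 h) (\<phi>2 h) * T2"
  have m: "0 < m" and rep: "is_rep G \<delta> \<pi> l H m \<sigma>" using irr unfolding irreducible_rep_def by blast+
  have \<sigma>c: "\<sigma> g \<in> carrier_mat m m" if "g \<in> H" for g using rep that unfolding is_rep_def by blast
  have \<sigma>: "pgH.prep m (\<lambda>g. em (\<sigma> g))"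
    unfolding pgH.prep_def
  proof (intro conjI ballI impI)
    show "em (\<sigma> g) \<in> blk m m" if "g \<in> H" for g by (rule em_blk[OF \<sigma>c[OF that]])
    show "em (\<sigma> g) = em (\<sigma> h)" if "g \<in> H" "h \<in> H" "cg l g h" for g h
    proof -
      have "\<sigma> g = \<sigma> h" using rep that unfolding is_rep_def by blast
      then show ?thesis by simp
    qed
    show "em (\<sigma> (g \<star> h)) = em (\<sigma> g) * em (\<sigma> h)" if "g \<in> H" "h \<in> H" for g h
    proof -
      have "\<sigma> (g \<star> h) = \<sigma> g * \<sigma> h" using rep that unfolding is_rep_def by blast
      then show ?thesis using em_mult[OF \<sigma>c[OF that(1)] \<sigma>c[OF that(2)]] by simp
    qed
    have "\<sigma> mI = 1\<^sub>m m" using rep unfolding is_rep_def by blast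
    then show "em (\<sigma> mI) = idn m" by (simp add: idn_def)
  qed
  have \<rho>e: "em (tensor_mat n1 n2 (\<phi>1 h) (\<phi>2 h)) = \<rho> h" and tc: "tensor_mat n1 n2 (\<phi>1 h) (\<phi>2 h) \<in> carrier_mat (n1 * n2) (n1 * n2)"
    if "h \<in> H" for h
    unfolding \<rho>_def c1.\<Phi>_def c2.\<Phi>_def
    using em_tensor_mat[OF c1.\<phi>c[OF H_D(1)[OF that]] c2.\<phi>c[OF H_D(2)[OF that]]] by (simp_all add: tensor_mat_def)
  have int: "em T * em (\<sigma> h) = \<rho> h * em T"
    if "T \<in> carrier_mat (n1 * n2) m" "\<forall>h\<in>H. T * \<sigma> h = tensor_mat n1 n2 (\<phi>1 h) (\<phi>2 h) * T" "h \<in> H" for T h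
    using em_mult[OF that(1) \<sigma>c[OF that(3)]] em_mult[OF tc[OF that(3)] that(1)] \<rho>e[OF that(3)] that(2,3) by simp
  obtain a b where ab: "(a, b) \<noteq> (0, 0)" "sm a (em T1) + sm b (em T2) = 0"
    using pgH.multiplicity_le_one[OF \<sigma> irreducible_rep_schur[OF irr] m prep\<rho> _ em_blk[OF T(1)] em_blk[OF T(2)]
        int[OF T(1) i(1)] int[OF T(2) i(2)]] comm unfolding commutant_def by blast
  have "em (a \<cdot>\<^sub>m T1 + b \<cdot>\<^sub>m T2) = em (0\<^sub>m (n1 * n2) m)"
    using ab(2) T by (subst em_add[of _ "n1 * n2" m]) (auto simp: em_smult em_zero)
  then have "a \<cdot>\<^sub>m T1 + b \<cdot>\<^sub>m T2 = 0\<^sub>m (n1 * n2) m"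
    using T by (intro em_inj[of _ "n1 * n2" m]) auto
  then show "\<exists>a b. (a, b) \<noteq> (0, 0) \<and> a \<cdot>\<^sub>m T1 + b \<cdot>\<^sub>m T2 = 0\<^sub>m (n1 * n2) m" using ab(1) by blast
qed

end

theorem theorem5p1:
  fixes \<pi> \<delta> :: "'a::idom" and \<psi> :: "'a \<Rightarrow> complex" and G :: gtype and l :: nat
    and A1 A2 :: "'a m2" and n1 n2 :: nat and \<phi>1 \<phi>2 :: "'a m2 \<Rightarrow> complex mat"
  assumes O: "complete_dvr_finite_odd_residue \<pi>"
    and theta: "\<delta> dvd 1" "\<not> (\<exists>y. y * y = \<delta>)"
    and psi_add: "\<And>x y. \<psi> (x + y) = \<psi> x * \<psi> y"
    and psi_unit: "\<And>x. norm (\<psi> x) = 1"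
    and psi_level: "\<And>z. \<psi> (\<pi> ^ l * z) = 1"
    and psi_nontriv: "\<exists>z. \<psi> (\<pi> ^ (l - 1) * z) \<noteq> 1"
    and l: "l \<ge> 2"
    and A1: "A1 \<in> lie G \<pi> (l div 2)" and A2: "A2 \<in> lie G \<pi> (l div 2)"
    and reg: "regular G \<pi> A1" "regular G \<pi> A2" "regular G \<pi> (madd A1 A2)"
    and tt: "tt_cus G \<delta> \<pi> (l div 2) A1" "tt_cus G \<delta> \<pi> (l div 2) A2"
    and phi1: "irreducible_rep G \<delta> \<pi> l (Stab G \<delta> \<pi> \<psi> l A1) n1 \<phi>1"
    and phi1c: "contains_char (Kset G \<delta> \<pi> l (l - l div 2)) n1 \<phi>1 (psiA G \<delta> \<pi> \<psi> l A1)"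
    and phi2: "irreducible_rep G \<delta> \<pi> l (Stab G \<delta> \<pi> \<psi> l A2) n2 \<phi>2"
    and phi2c: "contains_char (Kset G \<delta> \<pi> l (l - l div 2)) n2 \<phi>2 (psiA G \<delta> \<pi> \<psi> l A2)"
  shows "multiplicity_free G \<delta> \<pi> l (Stab G \<delta> \<pi> \<psi> l A1 \<inter> Stab G \<delta> \<pi> \<psi> l A2) (n1 * n2)
           (\<lambda>g. tensor_mat n1 n2 (\<phi>1 g) (\<phi>2 g))"
proof -
  interpret setting \<pi> \<delta> \<psi> G l
    by unfold_locales (fact O theta psi_add psi_unit psi_level psi_nontriv l)+
  obtain a1 N1 where N1: "N1 \<in> g0" "cg r A1 (qsc a1 + N1)" using lie_normal_form[OF A1] by blast
  obtain a2 N2 where N2: "N2 \<in> g0" "cg r A2 (qsc a2 + N2)" using lie_normal_form[OF A2] by blast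
  define D1 where "D1 = hf * tf N1 N1"
  define D2 where "D2 = hf * tf N2 N2"
  have NN1: "N1 \<star> N1 = msmul D1 mI" and NN2: "N2 \<star> N2 = msmul D2 mI"
    unfolding D1_def D2_def by (rule g0_sq[OF N1(1)], rule g0_sq[OF N2(1)])
  note t1 = tt_cus_normal_form[OF N1(2,1) NN1 tt(1)] and t2 = tt_cus_normal_form[OF N2(2,1) NN2 tt(2)]
  interpret c1: crep \<pi> \<delta> \<psi> G l N1 D1 a1 A1 n1 \<phi>1
    by unfold_locales (fact N1 NN1 t1(1) A1 phi1 phi1c)+
  show ?thesis
  \<comment> \<open>For even \<open>l\<close>, and in the noncommuting odd case, \<open>N2\<close>
    is used as it stands; the commuting odd case first adjusts it.\<close>
  proof (cases "odd l \<and> cg r (N1 \<star> N2) (N2 \<star> N1)")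
    case False
    interpret pair \<pi> \<delta> \<psi> G l N1 D1 a1 A1 n1 \<phi>1 N2 D2 a2 A2 n2 \<phi>2
      by unfold_locales (fact N2 NN2 t2(1) A2 phi2 phi2c)+
    show ?thesis
      using False commutant_commutative_A commutant_commutative_even
      by (intro multiplicity_free_if_commutative) blast
  next
    case True
    obtain v where v: "(2 * D1) * v = 1" using unit_ex[of "2 * D1"] pi_prime pi_2 c1.D_unit by blast
    define t where "t = tf N2 N1"
    \<comment> \<open>Multiplying \<open>N2 N1 + N1 N2 = t\<close> by \<open>N1\<close> on the right
      and using commutation modulo \<open>\<pi> ^ r\<close> gives \<open>2 D1 N2 = t N1\<close>
      there, so \<open>b\<close> is \<open>t\<close> divided by \<open>2 D1\<close>.\<close>
    define b where "b = v * t"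
    have e: "N2 \<star> N1 \<star> N1 + N1 \<star> N2 \<star> N1 = msmul t N1"
      using arg_cong[OF g0_anticomm[OF N2(1) N1(1)], of "\<lambda>X. X \<star> N1"] by (simp add: mm_add_left msmul_mult_left t_def)
    have "cg r (N2 \<star> N1 \<star> N1 + N1 \<star> N2 \<star> N1) (N2 \<star> N1 \<star> N1 + N2 \<star> N1 \<star> N1)"
      using True by (intro mcong_add mcong_refl mcong_mult_right) simp
    moreover have "N2 \<star> N1 \<star> N1 + N2 \<star> N1 \<star> N1 = msmul (2 * D1) N2"
      by (simp add: mm_assoc NN1 msmul_mult_right msmul_add_left[symmetric])
    ultimately have "cg r (msmul t N1) (msmul (2 * D1) N2)" unfolding e by simp
    from mcong_msmul[OF this, of v] have N2b: "cg r (msmul b N1) N2"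
      using v by (simp add: b_def mult.commute[of v "2 * D1"])
    have NNb: "msmul b N1 \<star> msmul b N1 = msmul (b * b * D1) mI"
      by (simp add: msmul_mult_left msmul_mult_right NN1 mult.assoc)
    have "cg r (msmul b N1 \<star> msmul b N1) (N2 \<star> N2)" by (rule mcong_mult[OF N2b N2b])
    then have "cg r (msmul (b * b * D1 - D2) mI) 0"
      unfolding NNb NN2 by (subst (asm) mcong_diff) (simp add: msmul_diff_left)
    then have "\<pi> ^ r dvd b * b * D1 - D2" by (simp add: mI_cong_0_iff)
    moreover have "\<pi> dvd \<pi> ^ r" using r1 by (simp add: dvd_power)
    ultimately have bD: "\<pi> dvd b * b * D1 - D2" by (rule dvd_trans[rotated])
    \<comment> \<open>Replacing \<open>N2\<close> by \<open>b N1\<close> replaces \<open>D2\<close>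
      by \<open>b * b * D1\<close>, which is congruent to it modulo \<pi> and therefore still a
      nonsquare; the case \<open>y = 0\<close> shows that \<open>b\<close> is a unit.\<close>
    have nsb: "\<not> \<pi> dvd y * y - b * b * D1" for y
    proof
      assume "\<pi> dvd y * y - b * b * D1"
      from dvd_add[OF this bD] have "\<pi> dvd y * y - D2" by simp
      then show False using t2(1) by blast
    qed
    have bu: "\<not> \<pi> dvd b" using nsb[of 0] by auto
    \<comment> \<open>The traceless part of \<open>A2\<close> matters only modulo
      \<open>\<pi> ^ r\<close>, so the exact multiple \<open>b N1\<close> may serve in its
      place.\<close>
    have An: "cg r A2 (qsc a2 + msmul b N1)"
      by (rule mcong_trans[OF N2(2) mcong_add[OF mcong_refl mcong_sym[OF N2b]]])
    interpret pair \<pi> \<delta> \<psi> G l N1 D1 a1 A1 n1 \<phi>1 "msmul b N1" "b * b * D1" a2 A2 n2 \<phi>2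
      by unfold_locales (fact g0_msmul[OF N1(1)] NNb nsb An A2 phi2 phi2c)+
    show ?thesis
      using True commutant_commutative_B[OF _ refl bu t1(2)]
      by (intro multiplicity_free_if_commutative) blast
  qed
qed

end
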